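(* Let $n \geq 4$ and let $C \subset \mathscr{C}_B(\mathbb{R}^n)$ be a cone in the space of algebraic curvature tensors on $\mathbb{R}^n$ with the following properties: (i) $C$ is closed, convex, and $O(n)$-invariant. (ii) $C$ is invariant under the ordinary differential equation $\frac{d}{dt} R = Q(R)$ on $\mathscr{C}_B(\mathbb{R}^n)$. (iii) If $R \in C \setminus \{0\}$, then the scalar curvature of $R$ is nonnegative and the Ricci tensor of $R$ is non-zero. (iv) The algebraic curvature tensor $I_{ijkl} = \delta_{ik}\,\delta_{jl} - \delta_{il}\,\delta_{jk}$ lies in the interior of $C$. Let $(M,g)$ be a compact Einstein manifold of dimension $n$, i.e. a compact Riemannian manifold with $\mathrm{Ric} = \rho\, g$ for some constant $\rho$. Suppose that the curvature tensor of $(M,g)$ lies in the interior of the cone $C$ at every point $p \in M$. Then $(M,g)$ has constant sectional curvature.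
   Context: $\mathscr{C}_B(\mathbb{R}^n)$ is the (finite-dimensional) vector space of algebraic curvature tensors on $\mathbb{R}^n$, i.e. $(0,4)$-tensors $R$ with $R_{ijkl} = -R_{jikl} = -R_{ijlk} = R_{klij}$ and satisfying the first Bianchi identity $R_{ijkl} + R_{jkil} + R_{kijl} = 0$. "Interior" refers to the interior as a subset of $\mathscr{C}_B(\mathbb{R}^n)$. The Ricci tensor of $R$ is $\mathrm{Ric}_{ik} = \sum_{j=1}^n R_{ijkj}$ and the scalar curvature is its trace; the sign convention is that the unit round sphere has $R_{ijkl} = g_{ik} g_{jl} - g_{il} g_{jk}$. For $R \in \mathscr{C}_B(\mathbb{R}^n)$, $Q(R) \in \mathscr{C}_B(\mathbb{R}^n)$ is defined by \[Q(R)_{ijkl} = \sum_{p,q=1}^n R_{ijpq} \, R_{klpq} + 2 \sum_{p,q=1}^n (R_{ipkq} \, R_{jplq} - R_{iplq} \, R_{jpkq}).\] A cone is a set closed under multiplication by positive scalars. $O(n)$ acts on $\mathscr{C}_B(\mathbb{R}^n)$ by change of orthonormal basis. $C$ is invariant under the ODE if every solution $R(t)$, $t \in [0,T)$, of $\frac{d}{dt}R = Q(R)$ with $R(0) \in C$ satisfies $R(t) \in C$ for all $t \in [0,T)$. The curvature tensor of $(M,g)$ at a point $p$ is regarded as an element of $\mathscr{C}_B(\mathbb{R}^n)$ by identifying $T_pM$ with $\mathbb{R}^n$ via an orthonormal basis; since $C$ is $O(n)$-invariant, membership in $C$ (or its interior) does not depend on the choice of basis. *)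

theory Defs
  imports "HOL-Analysis.Analysis"
begin

text \<open>
  A \<open>(0,4)\<close>-tensor on \<open>real ^ 'n\<close> is stored as the array \<open>R $ i $ j $ k $ l\<close> of its components in
  the standard basis.
\<close>

type_synonym 'n tensor4 = "real ^ 'n ^ 'n ^ 'n ^ 'n"

definition alg_curv :: "('n::finite) tensor4 set" where
  "alg_curv = {R. (\<forall>i j k l.
      R $ i $ j $ k $ l = - (R $ j $ i $ k $ l) \<and>
      R $ i $ j $ k $ l = - (R $ i $ j $ l $ k) \<and>
      R $ i $ j $ k $ l = R $ k $ l $ i $ j \<and>
      R $ i $ j $ k $ l + R $ j $ k $ i $ l + R $ k $ i $ j $ l = 0)}"

definition interior_alg_curv :: "('n::finite) tensor4 set \<Rightarrow> 'n tensor4 set" where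
  "interior_alg_curv C = (top_of_set alg_curv) interior_of C"

definition id_curv :: "('n::finite) tensor4" where
  "id_curv = (\<chi> i j k l.
     (if i = k then 1 else 0) * (if j = l then 1 else 0)
   - (if i = l then 1 else 0) * (if j = k then 1 else 0))"

definition ricci :: "('n::finite) tensor4 \<Rightarrow> real ^ 'n ^ 'n" where
  "ricci R = (\<chi> i k. \<Sum>j\<in>UNIV. R $ i $ j $ k $ j)"

definition scal :: "('n::finite) tensor4 \<Rightarrow> real" where
  "scal R = trace (ricci R)"

definition Q_curv :: "('n::finite) tensor4 \<Rightarrow> 'n tensor4" where
  "Q_curv R = (\<chi> i j k l.
     (\<Sum>p\<in>UNIV. \<Sum>q\<in>UNIV. R $ i $ j $ p $ q * R $ k $ l $ p $ q)
   + 2 * (\<Sum>p\<in>UNIV. \<Sum>q\<in>UNIV.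
            R $ i $ p $ k $ q * R $ j $ p $ l $ q - R $ i $ p $ l $ q * R $ j $ p $ k $ q))"

definition tensor4_apply ::
    "('n::finite) tensor4 \<Rightarrow> real ^ 'n \<Rightarrow> real ^ 'n \<Rightarrow> real ^ 'n \<Rightarrow> real ^ 'n \<Rightarrow> real" where
  "tensor4_apply R u v w z = (\<Sum>a\<in>UNIV. \<Sum>b\<in>UNIV. \<Sum>c\<in>UNIV. \<Sum>d\<in>UNIV.
     R $ a $ b $ c $ d * u $ a * v $ b * w $ c * z $ d)"

text \<open>Components of \<open>R\<close> in the basis formed by the rows of the matrix \<open>E\<close>.\<close>

definition change_frame :: "real ^ 'n ^ 'n \<Rightarrow> ('n::finite) tensor4 \<Rightarrow> 'n tensor4" where
  "change_frame E R = (\<chi> i j k l. tensor4_apply R (E $ i) (E $ j) (E $ k) (E $ l))"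

text \<open>The rows of the orthogonal matrices are exactly the orthonormal bases.\<close>

definition O_invariant :: "('n::finite) tensor4 set \<Rightarrow> bool" where
  "O_invariant C \<longleftrightarrow> (\<forall>A R. orthogonal_matrix A \<longrightarrow> R \<in> C \<longrightarrow> change_frame A R \<in> C)"

text \<open>At \<open>t = 0\<close> the derivative is one-sided.\<close>

definition Q_ode_invariant :: "('n::finite) tensor4 set \<Rightarrow> bool" where
  "Q_ode_invariant C \<longleftrightarrow>
    (\<forall>(T::real) (R :: real \<Rightarrow> 'n tensor4).
       0 < T \<longrightarrow>
       (\<forall>t\<in>{0..<T}. R t \<in> alg_curv) \<longrightarrow>
       (\<forall>t\<in>{0..<T}. (R has_vector_derivative Q_curv (R t)) (at t within {0..<T})) \<longrightarrow>
       R 0 \<in> C \<longrightarrow>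
       (\<forall>t\<in>{0..<T}. R t \<in> C))"

definition partial_deriv ::
    "'n::finite \<Rightarrow> (real ^ 'n \<Rightarrow> 'b::real_normed_vector) \<Rightarrow> real ^ 'n \<Rightarrow> 'b" where
  "partial_deriv i f x = frechet_derivative f (at x) (axis i 1)"

text \<open>Only meaningful for open \<open>S\<close>, since \<open>partial_deriv\<close> takes derivatives \<open>at x\<close>.\<close>

primrec Ck_on :: "nat \<Rightarrow> (real ^ 'n::finite) set \<Rightarrow> (real ^ 'n \<Rightarrow> 'b::real_normed_vector) \<Rightarrow> bool" where
  "Ck_on 0 S f \<longleftrightarrow> continuous_on S f"
| "Ck_on (Suc k) S f \<longleftrightarrow> f differentiable_on S \<and> (\<forall>i. Ck_on k S (partial_deriv i f))"

definition smooth_on :: "(real ^ 'n::finite) set \<Rightarrow> (real ^ 'n \<Rightarrow> 'b::real_normed_vector) \<Rightarrow> bool" where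
  "smooth_on S f \<longleftrightarrow> (\<forall>k. Ck_on k S f)"

type_synonym ('m, 'n) chart = "'m set \<times> ('m \<Rightarrow> real ^ 'n)"

abbreviation chart_dom :: "('m, 'n::finite) chart \<Rightarrow> 'm set" where
  "chart_dom \<equiv> fst"

abbreviation coord :: "('m, 'n::finite) chart \<Rightarrow> 'm \<Rightarrow> real ^ 'n" where
  "coord \<equiv> snd"

definition chart_image :: "('m, 'n::finite) chart \<Rightarrow> (real ^ 'n) set" where
  "chart_image c = coord c ` chart_dom c"

definition transition :: "('m, 'n::finite) chart \<Rightarrow> ('m, 'n) chart \<Rightarrow> real ^ 'n \<Rightarrow> real ^ 'n" where
  "transition c d = coord d \<circ> inv_into (chart_dom c) (coord c)"

definition chart_on :: "'m topology \<Rightarrow> ('m, 'n::finite) chart \<Rightarrow> bool" where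
  "chart_on X c \<longleftrightarrow>
     openin X (chart_dom c) \<and> open (chart_image c) \<and>
     homeomorphic_map (subtopology X (chart_dom c)) (top_of_set (chart_image c)) (coord c)"

text \<open>
  A smooth manifold without boundary, of dimension \<open>CARD('n)\<close>. The smooth structure is given by an
  atlas, which need not be maximal.
\<close>

definition smooth_manifold :: "'m topology \<Rightarrow> ('m, 'n::finite) chart set \<Rightarrow> bool" where
  "smooth_manifold X A \<longleftrightarrow>
     Hausdorff_space X \<and> second_countable X \<and>
     (\<forall>c\<in>A. chart_on X c) \<and>
     (\<Union>c\<in>A. chart_dom c) = topspace X \<and>
     (\<forall>c\<in>A. \<forall>d\<in>A. smooth_on (coord c ` (chart_dom c \<inter> chart_dom d)) (transition c d))"

definition bilin :: "real ^ 'n ^ 'n \<Rightarrow> real ^ 'n \<Rightarrow> real ^ ('n::finite) \<Rightarrow> real" where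
  "bilin G v w = v \<bullet> (G *v w)"

text \<open>
  A tangent vector at \<open>p\<close> is represented in each chart \<open>c\<close> around \<open>p\<close> by a vector of \<open>real ^ 'n\<close>, and
  its representatives in two charts correspond to each other under the derivative of the transition
  map. Accordingly a metric is a family of matrix-valued functions \<open>g c\<close>, one on the image of each
  chart, where \<open>g c x\<close> is the matrix of the components \<open>g(\<partial>\<^sub>i, \<partial>\<^sub>j)\<close> at the point with coordinates \<open>x\<close>;
  the last condition is the transformation law of a \<open>(0,2)\<close>-tensor.
\<close>

type_synonym ('m, 'n) metric_field = "('m, 'n) chart \<Rightarrow> real ^ 'n \<Rightarrow> real ^ 'n ^ 'n"

definition riemannian_metric :: "('m, 'n::finite) chart set \<Rightarrow> ('m, 'n) metric_field \<Rightarrow> bool" where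
  "riemannian_metric A g \<longleftrightarrow>
     (\<forall>c\<in>A. smooth_on (chart_image c) (g c) \<and>
        (\<forall>x\<in>chart_image c. transpose (g c x) = g c x \<and> (\<forall>v. v \<noteq> 0 \<longrightarrow> 0 < bilin (g c x) v v))) \<and>
     (\<forall>c\<in>A. \<forall>d\<in>A. \<forall>p\<in>chart_dom c \<inter> chart_dom d. \<forall>v w.
        bilin (g c (coord c p)) v w =
        bilin (g d (coord d p))
          (frechet_derivative (transition c d) (at (coord c p)) v)
          (frechet_derivative (transition c d) (at (coord c p)) w))"

definition riemannian_manifold ::
    "'m topology \<Rightarrow> ('m, 'n::finite) chart set \<Rightarrow> ('m, 'n) metric_field \<Rightarrow> bool" where
  "riemannian_manifold X A g \<longleftrightarrow> smooth_manifold X A \<and> riemannian_metric A g"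

text \<open>\<open>christoffel G k i j x\<close> is the Christoffel symbol with upper index \<open>k\<close> and lower indices \<open>i, j\<close>.\<close>

definition christoffel ::
    "(real ^ 'n \<Rightarrow> real ^ 'n ^ 'n) \<Rightarrow> 'n \<Rightarrow> 'n \<Rightarrow> 'n \<Rightarrow> real ^ ('n::finite) \<Rightarrow> real" where
  "christoffel G k i j x = (\<Sum>l\<in>UNIV. matrix_inv (G x) $ k $ l *
     (partial_deriv i (\<lambda>y. G y $ j $ l) x + partial_deriv j (\<lambda>y. G y $ i $ l) x
      - partial_deriv l (\<lambda>y. G y $ i $ j) x)) / 2"

text \<open>
  \<open>curv_up G m j k l x\<close> is the \<open>\<partial>\<^sub>m\<close>-component of
  \<open>\<nabla>\<^sub>k \<nabla>\<^sub>l \<partial>\<^sub>j - \<nabla>\<^sub>l \<nabla>\<^sub>k \<partial>\<^sub>j\<close>, where \<open>\<nabla>\<^sub>k\<close> is the Levi-Civita derivative along \<open>\<partial>\<^sub>k\<close>. After lowering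
  \<open>m\<close> into the first slot, the unit round sphere has \<open>R\<^sub>i\<^sub>j\<^sub>k\<^sub>l = g\<^sub>i\<^sub>k g\<^sub>j\<^sub>l - g\<^sub>i\<^sub>l g\<^sub>j\<^sub>k\<close>.
\<close>

definition curv_up ::
    "(real ^ 'n \<Rightarrow> real ^ 'n ^ 'n) \<Rightarrow> 'n \<Rightarrow> 'n \<Rightarrow> 'n \<Rightarrow> 'n \<Rightarrow> real ^ ('n::finite) \<Rightarrow> real" where
  "curv_up G m j k l x =
     partial_deriv k (christoffel G m l j) x - partial_deriv l (christoffel G m k j) x
   + (\<Sum>s\<in>UNIV. christoffel G m k s x * christoffel G s l j x
                - christoffel G m l s x * christoffel G s k j x)"

definition riemann :: "(real ^ 'n \<Rightarrow> real ^ 'n ^ 'n) \<Rightarrow> real ^ ('n::finite) \<Rightarrow> 'n tensor4" where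
  "riemann G x = (\<chi> i j k l. \<Sum>m\<in>UNIV. G x $ i $ m * curv_up G m j k l x)"

definition ricci_metric :: "(real ^ 'n \<Rightarrow> real ^ 'n ^ 'n) \<Rightarrow> real ^ ('n::finite) \<Rightarrow> real ^ 'n ^ 'n" where
  "ricci_metric G x =
     (\<chi> i k. \<Sum>j\<in>UNIV. \<Sum>l\<in>UNIV. matrix_inv (G x) $ j $ l * riemann G x $ i $ j $ k $ l)"

definition einstein_metric :: "('m, 'n::finite) chart set \<Rightarrow> ('m, 'n) metric_field \<Rightarrow> real \<Rightarrow> bool" where
  "einstein_metric A g \<rho> \<longleftrightarrow> (\<forall>c\<in>A. \<forall>x\<in>chart_image c. ricci_metric (g c) x = \<rho> *\<^sub>R g c x)"

definition orthonormal_frame :: "real ^ 'n ^ 'n \<Rightarrow> real ^ 'n ^ ('n::finite) \<Rightarrow> bool" where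
  "orthonormal_frame G E \<longleftrightarrow> (\<forall>i j. bilin G (E $ i) (E $ j) = (if i = j then 1 else 0))"

text \<open>
  \<open>K\<close> is meant to be invariant under \<open>O(n)\<close>; then it does not matter which chart around \<open>p\<close> and which
  orthonormal basis of the tangent space at \<open>p\<close> are used.
\<close>

definition curvature_in_at ::
    "('m, 'n::finite) chart set \<Rightarrow> ('m, 'n) metric_field \<Rightarrow> 'n tensor4 set \<Rightarrow> 'm \<Rightarrow> bool" where
  "curvature_in_at A g K p \<longleftrightarrow>
     (\<forall>c\<in>A. p \<in> chart_dom c \<longrightarrow>
        (\<forall>E. orthonormal_frame (g c (coord c p)) E \<longrightarrow>
           change_frame E (riemann (g c) (coord c p)) \<in> K))"

definition sectional_curvature ::
    "(real ^ 'n \<Rightarrow> real ^ 'n ^ 'n) \<Rightarrow> real ^ 'n \<Rightarrow> real ^ 'n \<Rightarrow> real ^ ('n::finite) \<Rightarrow> real" where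
  "sectional_curvature G x v w =
     tensor4_apply (riemann G x) v w v w /
     (bilin (G x) v v * bilin (G x) w w - (bilin (G x) v w)\<^sup>2)"

definition constant_sectional_curvature ::
    "('m, 'n::finite) chart set \<Rightarrow> ('m, 'n) metric_field \<Rightarrow> bool" where
  "constant_sectional_curvature A g \<longleftrightarrow>
     (\<exists>\<kappa>. \<forall>c\<in>A. \<forall>x\<in>chart_image c. \<forall>v w. v \<noteq> w \<longrightarrow> independent {v, w} \<longrightarrow>
        sectional_curvature (g c) x v w = \<kappa>)"

end

theory Submission
  imports Defs
begin

text \<open>
  Let \<open>\<kappa>\<close> be the largest number such that \<open>S = R - \<kappa> I\<close> lies in \<open>C\<close> everywhere. By compactness \<open>\<kappa> > 0\<close>,
  and \<open>S\<close> touches the boundary of \<open>C\<close> at some point \<open>p\<close>; let \<open>a\<close> be a supporting functional of \<open>C\<close> there.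
  Since \<open>C\<close> is invariant under the ODE, \<open>a (Q S) \<ge> 0\<close>, and \<open>a I > 0\<close> because \<open>I\<close> is an interior point.
  Along a geodesic through \<open>p\<close>, in a parallel orthonormal frame, \<open>a S\<close> has a minimum at \<open>p\<close>, whence
  \<open>a (\<Delta> R) \<ge> 0\<close>. For an Einstein metric \<open>\<Delta> R = 2 \<rho> R - Q R\<close>; writing \<open>\<mu> = \<rho> - (n - 1) \<kappa> \<ge> 0\<close> for the
  Einstein constant of \<open>S\<close>, this is \<open>2 \<rho> S - Q S - 2 \<kappa> \<mu> I\<close>, so \<open>a (\<Delta> R) \<ge> 0\<close> forces \<open>\<mu> = 0\<close>.
  Then \<open>S\<close> is Ricci-flat everywhere and hence zero.

  The Laplacian at \<open>p\<close> is computed in coordinates in which the metric is the identity and the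
  Christoffel symbols vanish at \<open>p\<close>; there, second covariant derivatives of the curvature involve only
  its second partial derivatives and the first derivatives of the Christoffel symbols.
\<close>

text \<open>Charts carry only matrix-valued functions, so curvature is compared through its
  components in orthonormal frames. Normal coordinates can be used only once the curvature is known
  to transform as a tensor; hence the study of pullbacks. The geodesic and its parallel frame become
  a straight coordinate line and a frame that is parallel up to o(t^2), since only the quadratic
  coefficient of \<open>a S\<close> matters at a minimum. The supremum \<kappa> is finite because
  (iii) makes the scalar curvature of \<open>S\<close> nonnegative, which is \<kappa> (n - 1) \<le>
  \<rho>, that is, \<mu> \<ge> 0; the final vanishing of \<open>S\<close> uses the other half of
  (iii). Since \<open>C\<close> is a cone, \<open>a S = 0\<close>, which removes the term 2 \<rho>
  S. The coefficient of \<open>I\<close> is 2 \<rho> \<kappa> from the linear term minus 4 \<kappa>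
  \<mu> + 2 (n - 1) \<kappa>^2 from \<open>Q (S + \<kappa> I)\<close>; with \<rho> = \<mu> + (n - 1)
  \<kappa> this is -2 \<kappa> \<mu>. Invariance under the ODE speaks only of solutions that exist,
  so a local solution is built as a power series.\<close>

abbreviation (input) sum_UNIV :: "('a \<Rightarrow> 'b::comm_monoid_add) \<Rightarrow> 'b"
    (binder "\<Oplus>" 10) where
  "sum_UNIV f \<equiv> sum f UNIV"

notation partial_deriv ("\<partial>")

section \<open>Partial derivatives and smoothness\<close>

lemma partial_deriv_eq:
  assumes "(f has_derivative D) (at x)"
  shows "\<partial> i f x = D (axis i 1)"
  unfolding partial_deriv_def using frechet_derivative_at[OF assms] by simp

text \<open>Functions that agree near \<open>x\<close> have the same derivatives there, so the
  choice made by \<open>frechet_derivative\<close> is the same even where no derivative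
  exists.\<close>

lemma partial_deriv_cong:
  assumes "open S" "x \<in> S" "\<And>y. y \<in> S \<Longrightarrow> f y = g y"
  shows "\<partial> i f x = \<partial> i g x"
proof -
  have "(f has_derivative D) (at x) \<longleftrightarrow> (g has_derivative D) (at x)" for D
    using assms by (metis has_derivative_transform_within_open)
  thus ?thesis unfolding partial_deriv_def frechet_derivative_def by simp
qed

lemma partial_deriv_const [simp]: "\<partial> i (\<lambda>x. c) x = 0"
  by (rule partial_deriv_eq[OF has_derivative_const, THEN trans]) simp

lemma partial_deriv_add:
  assumes "f differentiable (at x)" "g differentiable (at x)"
  shows "\<partial> i (\<lambda>y. f y + g y) x = \<partial> i f x + \<partial> i g x"
  using partial_deriv_eq[OF has_derivative_add[OF assms[unfolded frechet_derivative_works]], of i]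
  by (simp add: partial_deriv_def)

lemma partial_deriv_diff:
  fixes f g :: "real ^ 'n::finite \<Rightarrow> real"
  assumes "f differentiable (at x)" "g differentiable (at x)"
  shows "\<partial> i (\<lambda>y. f y - g y) x = \<partial> i f x - \<partial> i g x"
  using partial_deriv_eq[OF has_derivative_diff[OF assms[unfolded frechet_derivative_works]], of i]
  by (simp add: partial_deriv_def)

lemma partial_deriv_mult:
  fixes f g :: "real ^ 'n::finite \<Rightarrow> real"
  assumes "f differentiable (at x)" "g differentiable (at x)"
  shows "\<partial> i (\<lambda>y. f y * g y) x = f x * \<partial> i g x + \<partial> i f x * g x"
  using partial_deriv_eq[OF has_derivative_mult[OF assms[unfolded frechet_derivative_works]], of i]
  by (simp add: partial_deriv_def)

lemma partial_deriv_sum: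
  fixes f :: "'a \<Rightarrow> real ^ 'n::finite \<Rightarrow> real"
  assumes "finite I" "\<And>j. j \<in> I \<Longrightarrow> f j differentiable (at x)"
  shows "\<partial> i (\<lambda>y. \<Sum>j\<in>I. f j y) x = (\<Sum>j\<in>I. \<partial> i (f j) x)"
  using assms
proof (induction I rule: finite_induct)
  case (insert j I)
  have "(\<lambda>y. \<Sum>j\<in>I. f j y) differentiable (at x)"
    using insert by (intro differentiable_sum) auto
  then show ?case using insert by (simp add: partial_deriv_add)
qed simp

lemma partial_deriv_bounded_linear:
  assumes "bounded_linear L" "f differentiable (at x)"
  shows "\<partial> i (\<lambda>y. L (f y)) x = L (\<partial> i f x)"
  using partial_deriv_eq[OF bounded_linear.has_derivative[OF assms(1) assms(2)[unfolded
    frechet_derivative_works]], of i]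
  by (simp add: partial_deriv_def)

section \<open>Closure properties of k times differentiable and of smooth functions\<close>

lemma Ck_on_cong:
  assumes "open S" "\<And>y. y \<in> S \<Longrightarrow> f y = g y"
  shows "Ck_on k S f \<longleftrightarrow> Ck_on k S g"
  using assms(2)
proof (induction k arbitrary: f g)
  case 0
  then show ?case by (auto intro: continuous_on_eq)
next
  case (Suc k)
  have "Ck_on k S (\<partial> i f) \<longleftrightarrow> Ck_on k S (\<partial> i g)" for i
    by (rule Suc.IH) (rule partial_deriv_cong[OF assms(1) _ Suc.prems])
  moreover have "f differentiable_on S \<longleftrightarrow> g differentiable_on S"
    unfolding differentiable_on_eq_differentiable_at[OF assms(1)] differentiable_def
    using Suc.prems assms(1) by (metis has_derivative_transform_within_open)
  ultimately show ?case by simp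
qed

lemma Ck_on_SucD: "Ck_on (Suc k) S f \<Longrightarrow> Ck_on k S f"
  by (induction k arbitrary: f) (auto intro: differentiable_imp_continuous_on)

lemma Ck_on_subset:
  assumes "Ck_on k S f" "T \<subseteq> S"
  shows "Ck_on k T f"
  using assms by (induction k arbitrary: f) (auto intro: continuous_on_subset differentiable_on_subset)

lemma Ck_on_const [simp]: "Ck_on k S (\<lambda>x. c)"
proof (induction k arbitrary: c)
  case (Suc k)
  have "\<partial> i (\<lambda>x::real^'a. c) = (\<lambda>x. 0)" for i by (rule ext) simp
  with Suc show ?case by simp
qed simp

text \<open>Replaces the partial derivatives by a formula valid on \<open>S\<close> only; through
  this rule the inductions on \<open>k\<close> use the product and chain rules.\<close>

lemma Ck_on_SucI:
  assumes "open S" "\<And>x. x \<in> S \<Longrightarrow> f differentiable (at x)"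
    and "\<And>i x. x \<in> S \<Longrightarrow> \<partial> i f x = h i x" "\<And>i. Ck_on k S (h i)"
  shows "Ck_on (Suc k) S f"
proof -
  have "Ck_on k S (\<partial> i f)" for i
    using Ck_on_cong[OF assms(1), of "\<partial> i f" "h i"] assms by blast
  thus ?thesis using assms by (simp add: differentiable_on_eq_differentiable_at)
qed

lemma Ck_on_Suc_differentiable:
  assumes "open S" "Ck_on (Suc k) S f" "x \<in> S"
  shows "f differentiable (at x)"
  using assms by (simp add: differentiable_on_eq_differentiable_at)

lemma Ck_on_add:
  assumes S: "open S" and "Ck_on k S f" "Ck_on k S g"
  shows "Ck_on k S (\<lambda>x. f x + g x)"
  using assms(2,3)
proof (induction k arbitrary: f g)
  case (Suc k)
  note d = Ck_on_Suc_differentiable[OF S Suc.prems(1)] Ck_on_Suc_differentiable[OF S Suc.prems(2)]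
  show ?case
    by (rule Ck_on_SucI[OF S _ partial_deriv_add]) (use d Suc in auto)
qed (auto intro: continuous_intros)

lemma Ck_on_mult:
  fixes f g :: "real ^ 'n::finite \<Rightarrow> real"
  assumes S: "open S" and "Ck_on k S f" "Ck_on k S g"
  shows "Ck_on k S (\<lambda>x. f x * g x)"
  using assms(2,3)
proof (induction k arbitrary: f g)
  case (Suc k)
  note d = Ck_on_Suc_differentiable[OF S Suc.prems(1)] Ck_on_Suc_differentiable[OF S Suc.prems(2)]
  show ?case
  proof (rule Ck_on_SucI[OF S _ partial_deriv_mult])
    show "Ck_on k S (\<lambda>x. f x * \<partial> i g x + \<partial> i f x * g x)" for i
      using Suc Ck_on_SucD[OF Suc.prems(1)] Ck_on_SucD[OF Suc.prems(2)] by (intro Ck_on_add[OF S]) auto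
  qed (use d in auto)
qed (auto intro: continuous_intros)

lemma Ck_on_bounded_linear:
  assumes S: "open S" and L: "bounded_linear L" and "Ck_on k S f"
  shows "Ck_on k S (\<lambda>x. L (f x))"
  using assms(3)
proof (induction k arbitrary: f)
  case 0
  then show ?case by (auto intro: bounded_linear.continuous_on[OF L])
next
  case (Suc k)
  note d = Ck_on_Suc_differentiable[OF S Suc.prems(1)]
  show ?case
    by (rule Ck_on_SucI[OF S _ partial_deriv_bounded_linear[OF L]])
      (use d Suc in \<open>auto intro: differentiable_compose[where f=L] bounded_linear_imp_differentiable[OF L]\<close>)
qed

text \<open>The derivative of 1/f is -f' (1/f)^2, so the induction hypothesis is applied to 1/f
  itself.\<close>

lemma Ck_on_inverse:
  fixes f :: "real ^ 'n::finite \<Rightarrow> real"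
  assumes S: "open S" and nz: "\<And>x. x \<in> S \<Longrightarrow> f x \<noteq> 0" and "Ck_on k S f"
  shows "Ck_on k S (\<lambda>x. inverse (f x))"
  using assms(3)
proof (induction k)
  case 0
  then show ?case using nz by (auto intro: continuous_intros)
next
  case (Suc k)
  note d = Ck_on_Suc_differentiable[OF S Suc.prems(1)]
  have pd: "\<partial> i (\<lambda>x. inverse (f x)) x = (-1) * (\<partial> i f x * (inverse (f x) * inverse (f x)))"
    if "x \<in> S" for i x
  proof -
    have "((\<lambda>x. inverse (f x)) has_derivative
            (\<lambda>h. - (inverse (f x) * frechet_derivative f (at x) h * inverse (f x)))) (at x)"
      using d[OF that] nz[OF that] by (intro Deriv.has_derivative_inverse) (auto simp:
        frechet_derivative_works)
    from partial_deriv_eq[OF this, of i] show ?thesis by (simp add: partial_deriv_def)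
  qed
  show ?case
  proof (rule Ck_on_SucI[OF S _ pd])
    have "Ck_on k S (\<lambda>x. inverse (f x))" using Suc Ck_on_SucD by blast
    then show "Ck_on k S (\<lambda>x. (-1) * (\<partial> i f x * (inverse (f x) * inverse (f x))))" for i
      using Suc.prems by (intro Ck_on_mult[OF S]) auto
  qed (use d nz in auto)
qed

lemma smooth_on_cong:
  assumes "open S" "\<And>y. y \<in> S \<Longrightarrow> f y = g y"
  shows "smooth_on S f \<longleftrightarrow> smooth_on S g"
  unfolding smooth_on_def using Ck_on_cong[OF assms(1), of f g] assms(2) by blast

lemma smooth_on_subset: "smooth_on S f \<Longrightarrow> T \<subseteq> S \<Longrightarrow> smooth_on T f"
  unfolding smooth_on_def using Ck_on_subset by blast

lemma smooth_on_const: "smooth_on S (\<lambda>x. c)"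
  by (simp add: smooth_on_def)

lemma smooth_on_add: "open S \<Longrightarrow> smooth_on S f \<Longrightarrow> smooth_on S g \<Longrightarrow> smooth_on S (\<lambda>x. f x + g x)"
  unfolding smooth_on_def using Ck_on_add by blast

lemma smooth_on_mult:
  fixes f g :: "real ^ 'n::finite \<Rightarrow> real"
  shows "open S \<Longrightarrow> smooth_on S f \<Longrightarrow> smooth_on S g \<Longrightarrow> smooth_on S (\<lambda>x. f x * g x)"
  unfolding smooth_on_def using Ck_on_mult by blast

lemma smooth_on_inverse:
  fixes f :: "real ^ 'n::finite \<Rightarrow> real"
  shows "open S \<Longrightarrow> smooth_on S f \<Longrightarrow> (\<And>x. x \<in> S \<Longrightarrow> f x \<noteq> 0) \<Longrightarrow> smooth_on S (\<lambda>x. inverse (f x))"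
  unfolding smooth_on_def using Ck_on_inverse by blast

lemma smooth_on_divide:
  fixes f g :: "real ^ 'n::finite \<Rightarrow> real"
  shows "open S \<Longrightarrow> smooth_on S f \<Longrightarrow> smooth_on S g \<Longrightarrow> (\<And>x. x \<in> S \<Longrightarrow> g x \<noteq> 0) \<Longrightarrow>
    smooth_on S (\<lambda>x. f x / g x)"
  unfolding divide_inverse by (intro smooth_on_mult smooth_on_inverse)

lemma smooth_on_diff:
  fixes f g :: "real ^ 'n::finite \<Rightarrow> real"
  assumes "open S" "smooth_on S f" "smooth_on S g" shows "smooth_on S (\<lambda>x. f x - g x)"
  using smooth_on_add[OF assms(1,2) smooth_on_mult[OF assms(1) smooth_on_const assms(3)], of "-1"]
  by simp

lemma smooth_on_sum:
  fixes f :: "'a \<Rightarrow> real ^ 'n::finite \<Rightarrow> real"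
  assumes "open S" "\<And>i. i \<in> I \<Longrightarrow> smooth_on S (f i)"
  shows "smooth_on S (\<lambda>x. \<Sum>i\<in>I. f i x)"
  using assms(2) by (induction I rule: infinite_finite_induct) (auto intro:
    smooth_on_add smooth_on_const assms(1))

lemma smooth_on_prod:
  fixes f :: "'a \<Rightarrow> real ^ 'n::finite \<Rightarrow> real"
  assumes "open S" "\<And>i. i \<in> I \<Longrightarrow> smooth_on S (f i)"
  shows "smooth_on S (\<lambda>x. \<Prod>i\<in>I. f i x)"
  using assms(2) by (induction I rule: infinite_finite_induct) (auto intro:
    smooth_on_mult smooth_on_const assms(1))

lemma smooth_on_bounded_linear: "open S \<Longrightarrow> bounded_linear L \<Longrightarrow> smooth_on S f \<Longrightarrow> smooth_on S (\<lambda>x. L (f x))"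
  unfolding smooth_on_def using Ck_on_bounded_linear by blast

lemma smooth_on_vec_nth: "open S \<Longrightarrow> smooth_on S f \<Longrightarrow> smooth_on S (\<lambda>x. f x $ i)"
  by (rule smooth_on_bounded_linear) (auto intro: bounded_linear_vec_nth)

lemma smooth_on_partial_deriv: "smooth_on S f \<Longrightarrow> smooth_on S (\<partial> i f)"
  unfolding smooth_on_def using Ck_on.simps(2) by blast

lemma smooth_on_differentiable: "open S \<Longrightarrow> smooth_on S f \<Longrightarrow> x \<in> S \<Longrightarrow> f differentiable (at x)"
  unfolding smooth_on_def using Ck_on_Suc_differentiable by blast

lemma smooth_on_continuous: "smooth_on S f \<Longrightarrow> continuous_on S f"
  unfolding smooth_on_def using Ck_on.simps(1) by blast

lemma bounded_linear_smooth_on: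
  assumes "bounded_linear L" shows "smooth_on S L"
proof -
  have "Ck_on k UNIV L" for k
  proof (cases k)
    case 0
    then show ?thesis by (simp add: linear_continuous_on[OF assms])
  next
    case (Suc m)
    have "Ck_on (Suc m) UNIV L"
      by (rule Ck_on_SucI[where h="\<lambda>i x. L (axis i 1)"])
        (auto intro: bounded_linear_imp_differentiable assms partial_deriv_eq
           bounded_linear_imp_has_derivative)
    then show ?thesis using Suc by simp
  qed
  then show ?thesis by (meson smooth_on_def Ck_on_subset subset_UNIV)
qed

lemma linear_eq_sum_axis:
  fixes D :: "real ^ 'n::finite \<Rightarrow> 'b::real_vector"
  assumes "linear D" shows "D v = (\<Oplus>i. v $ i *\<^sub>R D (axis i 1))"
proof -
  have "D v = D (\<Oplus>i. v $ i *\<^sub>R axis i 1)"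
    by (metis (no_types, lifting) basis_expansion scalar_mult_eq_scaleR sum.cong)
  also have "\<dots> = (\<Oplus>i. v $ i *\<^sub>R D (axis i 1))"
    using assms by (simp add: linear_sum linear_cmul)
  finally show ?thesis .
qed

lemma frechet_derivative_eq_partial:
  assumes "f differentiable (at x)"
  shows "frechet_derivative f (at x) v = (\<Oplus>i. v $ i *\<^sub>R \<partial> i f x)"
  unfolding partial_deriv_def
  by (rule linear_eq_sum_axis) (use assms in \<open>auto simp: linear_frechet_derivative\<close>)

lemma differentiable_vec:
  fixes F :: "'a::euclidean_space \<Rightarrow> real ^ 'n::finite"
  assumes "\<And>i. (\<lambda>y. F y $ i) differentiable (at x)"
  shows "F differentiable (at x)"
proof -
  have "F differentiable (at x) \<longleftrightarrow> (\<forall>b\<in>Basis. (\<lambda>y. F y \<bullet> b) differentiable (at x))"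
    by (rule differentiable_componentwise_within)
  then show ?thesis using assms by (auto simp: Basis_vec_def inner_axis)
qed

lemma partial_deriv_vec_nth:
  fixes F :: "real ^ 'm::finite \<Rightarrow> real ^ 'n::finite"
  assumes "F differentiable (at x)"
  shows "\<partial> i F x $ j = \<partial> i (\<lambda>y. F y $ j) x"
  using partial_deriv_bounded_linear[OF bounded_linear_vec_nth[of j] assms, of i] by simp

lemma partial_deriv_compose:
  fixes g :: "real ^ 'n::finite \<Rightarrow> real" and F :: "real ^ 'm::finite \<Rightarrow> real ^ 'n"
  assumes g: "g differentiable (at (F x))" and F: "\<And>j. (\<lambda>y. F y $ j) differentiable (at x)"
  shows "\<partial> i (\<lambda>y. g (F y)) x
    = (\<Oplus>j. \<partial> j g (F x) * \<partial> i (\<lambda>y. F y $ j) x)"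
proof -
  have dF: "F differentiable (at x)" using F by (rule differentiable_vec)
  have "((\<lambda>y. g (F y)) has_derivative
     (\<lambda>h. frechet_derivative g (at (F x)) (frechet_derivative F (at x) h))) (at x)"
    using has_derivative_compose[of F _ x UNIV g "frechet_derivative g (at (F x))"] dF g
    by (auto simp: frechet_derivative_works)
  from partial_deriv_eq[OF this, of i]
  have "\<partial> i (\<lambda>y. g (F y)) x = frechet_derivative g (at (F x)) (\<partial> i F x)"
    by (simp add: partial_deriv_def)
  also have "\<dots> = (\<Oplus>j. \<partial> i F x $ j *\<^sub>R \<partial> j g (F x))"
    by (rule frechet_derivative_eq_partial[OF g])
  finally show ?thesis by (simp add: partial_deriv_vec_nth[OF dF] mult.commute)
qed

text \<open>The chain rule yields partial derivatives of \<open>g\<close> composed with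
  \<open>F\<close>, times partial derivatives of \<open>F\<close>. The induction therefore ranges
  over all smooth \<open>g\<close> while \<open>F\<close> stays fixed.\<close>

lemma smooth_on_compose:
  fixes g :: "real ^ 'n::finite \<Rightarrow> real" and F :: "real ^ 'm::finite \<Rightarrow> real ^ 'n"
  assumes S: "open S" and T: "open T" and F: "\<And>j. smooth_on S (\<lambda>y. F y $ j)"
    and FST: "F ` S \<subseteq> T" and g: "smooth_on T g"
  shows "smooth_on S (\<lambda>x. g (F x))"
proof -
  have "Ck_on k S (\<lambda>x. g (F x))" for k
    using g
  proof (induction k arbitrary: g)
    case 0
    have "F differentiable_on S"
      using F smooth_on_differentiable[OF S]
      by (auto simp: differentiable_on_eq_differentiable_at[OF S] intro: differentiable_vec)
    then have "continuous_on S F" by (rule differentiable_imp_continuous_on)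
    then show ?case
      using smooth_on_continuous[OF 0] continuous_on_compose2[of T g S F] FST by simp
  next
    case (Suc k)
    have d: "g differentiable (at (F x))" "(\<lambda>y. F y $ j) differentiable (at x)" if "x \<in> S" for x j
      using smooth_on_differentiable[OF T Suc.prems] smooth_on_differentiable[OF S F] FST that by auto
    have "Ck_on k S (\<lambda>x. \<Sum>j\<in>J. \<partial> j g (F x) * \<partial> i (\<lambda>y. F y $ j) x)"
      if "finite J" for J i
      using that
    proof induction
      case (insert j J)
      have "Ck_on k S (\<lambda>x. \<partial> j g (F x))"
        by (rule Suc.IH) (rule smooth_on_partial_deriv[OF Suc.prems])
      moreover have "Ck_on k S (\<partial> i (\<lambda>y. F y $ j))"
        using smooth_on_partial_deriv[OF F] by (auto simp: smooth_on_def)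
      ultimately show ?case using insert by (auto intro!: Ck_on_add[OF S] Ck_on_mult[OF S])
    qed simp
    moreover have "(\<lambda>x. g (F x)) differentiable (at x)" if "x \<in> S" for x
      using d[OF that] differentiable_vec[of F x] differentiable_compose[of g F x UNIV]
      by blast
    ultimately show ?case
      by (intro Ck_on_SucI[OF S _ partial_deriv_compose]) (use d in auto)
  qed
  then show ?thesis by (simp add: smooth_on_def)
qed

section \<open>Symmetry of second partial derivatives\<close>

lemma has_real_derivative_along_axis:
  fixes f :: "real ^ 'n::finite \<Rightarrow> real"
  assumes "f differentiable (at (x + t *\<^sub>R axis i 1))"
  shows "((\<lambda>t. f (x + t *\<^sub>R axis i 1)) has_real_derivative \<partial> i f (x + t *\<^sub>R axis i 1)) (at t)"
proof -
  let ?y = "x + t *\<^sub>R axis i 1"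
  have 1: "((\<lambda>t. x + t *\<^sub>R axis i 1) has_derivative (\<lambda>h. h *\<^sub>R (axis i 1 :: real^'n))) (at t)"
    by (auto intro!: derivative_eq_intros)
  have "((\<lambda>t. f (x + t *\<^sub>R axis i 1)) has_derivative (\<lambda>h.
    frechet_derivative f (at ?y) (h *\<^sub>R axis i 1))) (at t)"
    using has_derivative_compose[OF 1, of f "frechet_derivative f (at ?y)"] assms
    by (auto simp: frechet_derivative_works)
  moreover have "frechet_derivative f (at ?y) (h *\<^sub>R axis i 1) = \<partial> i f ?y * h" for h
    using linear_frechet_derivative[OF assms] by (simp add: partial_deriv_def linear_cmul mult.commute)
  ultimately show ?thesis by (simp add: has_field_derivative_def)
qed

text \<open>Two applications of the mean value theorem: to the increment in direction
  \<open>b\<close> as a function of the step in direction \<open>a\<close>, then to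
  \<open>\<partial> a f\<close> along \<open>b\<close>.\<close>

lemma second_difference_eq:
  fixes f :: "real ^ 'n::finite \<Rightarrow> real"
  assumes S: "open S" "smooth_on S f" and h: "h > 0"
    and sub: "\<And>s t. 0 \<le> s \<Longrightarrow> s \<le> h \<Longrightarrow> 0 \<le> t \<Longrightarrow> t \<le> h \<Longrightarrow> x + s *\<^sub>R axis a 1 + t *\<^sub>R axis b 1 \<in> S"
  shows "\<exists>s t. 0 \<le> s \<and> s \<le> h \<and> 0 \<le> t \<and> t \<le> h \<and>
    f (x + h *\<^sub>R axis a 1 + h *\<^sub>R axis b 1) - f (x + h *\<^sub>R axis a 1) - f (x + h *\<^sub>R axis b 1) + f x
    = h * h * \<partial> b (\<partial> a f) (x + s *\<^sub>R axis a 1 + t *\<^sub>R axis b 1)"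
proof -
  define u where "u s = f (x + h *\<^sub>R axis b 1 + s *\<^sub>R axis a 1) - f (x + s *\<^sub>R axis a 1)" for s
  have "\<exists>s. 0 < s \<and> s < h \<and> u h - u 0 = (h - 0) *
     (\<partial> a f (x + h *\<^sub>R axis b 1 + s *\<^sub>R axis a 1) - \<partial> a f (x + s *\<^sub>R axis a 1))"
  proof (rule MVT2[OF h])
    fix s assume s: "0 \<le> s" "s \<le> h"
    have "x + h *\<^sub>R axis b 1 + s *\<^sub>R axis a 1 \<in> S" "x + s *\<^sub>R axis a 1 \<in> S"
      using sub[OF s, of h] sub[OF s, of 0] h by (auto simp: algebra_simps)
    then show "(u has_real_derivative (\<partial> a f (x + h *\<^sub>R axis b 1 + s *\<^sub>R axis a 1) - \<partial> a f (x
      + s *\<^sub>R axis a 1))) (at s)"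
      unfolding u_def using S smooth_on_differentiable
      by (intro DERIV_diff has_real_derivative_along_axis) auto
  qed
  then obtain s where s: "0 < s" "s < h" and us: "u h - u 0 = h *
     (\<partial> a f (x + s *\<^sub>R axis a 1 + h *\<^sub>R axis b 1) - \<partial> a f (x + s *\<^sub>R axis a 1))"
    by (auto simp: algebra_simps)
  have "\<exists>t. 0 < t \<and> t < h \<and> \<partial> a f (x + s *\<^sub>R axis a 1 + h *\<^sub>R axis b 1) - \<partial> a f (x + s *\<^sub>R axis a 1
    + 0 *\<^sub>R axis b 1)
      = (h - 0) * \<partial> b (\<partial> a f) (x + s *\<^sub>R axis a 1 + t *\<^sub>R axis b 1)"
  proof (rule MVT2[OF h])
    fix t assume t: "0 \<le> t" "t \<le> h"
    have "x + s *\<^sub>R axis a 1 + t *\<^sub>R axis b 1 \<in> S" using sub s t by auto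
    then show "((\<lambda>t. \<partial> a f (x + s *\<^sub>R axis a 1 + t *\<^sub>R axis b 1)) has_real_derivative
      \<partial> b (\<partial> a f) (x + s *\<^sub>R axis a 1 + t *\<^sub>R axis b 1)) (at t)"
      using S smooth_on_differentiable smooth_on_partial_deriv
      by (intro has_real_derivative_along_axis) blast
  qed
  then obtain t where t: "0 < t" "t < h" and "\<partial> a f (x + s *\<^sub>R axis a 1 + h *\<^sub>R axis b 1) - \<partial> a f (x
    + s *\<^sub>R axis a 1)
      = h * \<partial> b (\<partial> a f) (x + s *\<^sub>R axis a 1 + t *\<^sub>R axis b 1)"
    by auto
  with us have "u h - u 0 = h * h * \<partial> b (\<partial> a f) (x + s *\<^sub>R axis a 1 + t *\<^sub>R axis b 1)"
    by simp
  moreover have "u h - u 0 = f (x + h *\<^sub>R axis a 1 + h *\<^sub>R axis b 1) - f (x + h *\<^sub>R axis a 1) - f (x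
    + h *\<^sub>R axis b 1) + f x"
    by (simp add: u_def algebra_simps)
  ultimately show ?thesis using s t by (intro exI[of _ s] exI[of _ t]) auto
qed

text \<open>The second difference is symmetric in the two directions, so both mixed derivatives take
  a common value at points close to \<open>x\<close>; if they differed at \<open>x\<close>, this
  would contradict their continuity.\<close>

lemma partial_deriv_commute:
  fixes f :: "real ^ 'n::finite \<Rightarrow> real"
  assumes S: "open S" "smooth_on S f" and x: "x \<in> S"
  shows "\<partial> a (\<partial> b f) x = \<partial> b (\<partial> a f) x"
proof (rule ccontr)
  define F where "F = \<partial> a (\<partial> b f)"
  define G where "G = \<partial> b (\<partial> a f)"
  define e where "e = \<bar>F x - G x\<bar> / 2"
  assume "\<not> ?thesis"
  then have e: "e > 0" by (simp add: e_def F_def G_def)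
  have "continuous (at x) F" "continuous (at x) G"
    using S x smooth_on_continuous smooth_on_partial_deriv unfolding F_def G_def
    by (metis continuous_on_eq_continuous_at)+
  then obtain d1 d2 where d: "d1 > 0" "d2 > 0"
    and F: "\<And>y. dist y x < d1 \<Longrightarrow> dist (F y) (F x) < e" and G: "\<And>y. dist y x < d2 \<Longrightarrow> dist (G y) (G x) < e"
    unfolding continuous_at_eps_delta using e by metis
  obtain d3 where d3: "d3 > 0" "ball x d3 \<subseteq> S" using S x open_contains_ball by blast
  \<comment> \<open>The test points have distance at most 2h from \<open>x\<close>; dividing by 3
    puts them strictly inside all three balls.\<close>
  define h where "h = min d1 (min d2 d3) / 3"
  have h: "h > 0" using d d3 by (simp add: h_def)
  have near: "dist (x + s *\<^sub>R axis i 1 + t *\<^sub>R axis j 1) x < min d1 (min d2 d3)"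
    if "0 \<le> s" "s \<le> h" "0 \<le> t" "t \<le> h" for s t and i j :: 'n
  proof -
    have "dist (x + s *\<^sub>R axis i 1 + t *\<^sub>R axis j 1) x = norm (s *\<^sub>R (axis i 1 :: real^'n) + t *\<^sub>R axis j 1)"
      by (simp add: dist_norm)
    also have "\<dots> \<le> s + t"
      by (rule norm_triangle_le) (use that in \<open>simp add: norm_axis_1\<close>)
    also have "\<dots> < 3 * h" using that h by simp
    finally show ?thesis by (simp add: h_def)
  qed
  have sub: "x + s *\<^sub>R axis i 1 + t *\<^sub>R axis j 1 \<in> S"
    if "0 \<le> s" "s \<le> h" "0 \<le> t" "t \<le> h" for s t and i j :: 'n
    using near[OF that, of i j] d3(2) by (auto simp: dist_commute subset_iff)
  obtain s t where st: "0 \<le> s" "s \<le> h" "0 \<le> t" "t \<le> h" and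
    1: "f (x + h *\<^sub>R axis a 1 + h *\<^sub>R axis b 1) - f (x + h *\<^sub>R axis a 1) - f (x + h *\<^sub>R axis b 1) + f x
    = h * h * G (x + s *\<^sub>R axis a 1 + t *\<^sub>R axis b 1)"
    unfolding G_def using second_difference_eq[OF S h sub] by blast
  obtain s' t' where st': "0 \<le> s'" "s' \<le> h" "0 \<le> t'" "t' \<le> h" and
    2: "f (x + h *\<^sub>R axis b 1 + h *\<^sub>R axis a 1) - f (x + h *\<^sub>R axis b 1) - f (x + h *\<^sub>R axis a 1) + f x
    = h * h * F (x + s' *\<^sub>R axis b 1 + t' *\<^sub>R axis a 1)"
    unfolding F_def using second_difference_eq[OF S h sub] by blast
  have "h * h * G (x + s *\<^sub>R axis a 1 + t *\<^sub>R axis b 1) = h * h * F (x + s' *\<^sub>R axis b 1 + t' *\<^sub>R axis a 1)"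
    unfolding 1[symmetric] 2[symmetric] by (simp add: add.commute add.left_commute)
  then have "G (x + s *\<^sub>R axis a 1 + t *\<^sub>R axis b 1) = F (x + s' *\<^sub>R axis b 1 + t' *\<^sub>R axis a 1)"
    using h by simp
  moreover have "dist (F (x + s' *\<^sub>R axis b 1 + t' *\<^sub>R axis a 1)) (F x) < e"
    using near[OF st'] by (intro F) simp
  moreover have "dist (G (x + s *\<^sub>R axis a 1 + t *\<^sub>R axis b 1)) (G x) < e"
    using near[OF st] by (intro G) simp
  ultimately have "dist (F x) (G x) < 2 * e"
    by (metis dist_commute dist_triangle_half_l field_sum_of_halves
      mult_2 nonzero_mult_div_cancel_left zero_neq_numeral)
  then show False by (simp add: e_def dist_real_def)
qed

section \<open>Christoffel symbols and curvature under coordinate changes\<close>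

lemma bilin_sum: "bilin M v w = (\<Oplus>i j. v $ i * M $ i $ j * w $ j)"
  by (simp add: bilin_def inner_vec_def matrix_vector_mult_def sum_distrib_left mult.assoc)

lemma bilin_add: "bilin M (u + v) w = bilin M u w + bilin M v w"
  "bilin M w (u + v) = bilin M w u + bilin M w v"
  by (simp_all add: bilin_def inner_add_left inner_add_right matrix_vector_right_distrib)

lemma bilin_minus: "bilin M (- u) w = - bilin M u w" "bilin M w (- u) = - bilin M w u"
  by (simp_all add: bilin_sum sum_negf)

lemma bilin_diff: "bilin M (u - v) w = bilin M u w - bilin M v w"
  "bilin M w (u - v) = bilin M w u - bilin M w v"
  using bilin_add[where v="- v"] by (simp_all add: bilin_minus)

lemma bilin_sum_left: "bilin M (\<Sum>i\<in>I. c i *\<^sub>R v i) w = (\<Sum>i\<in>I. c i * bilin M (v i) w)"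
  by (simp add: bilin_def inner_sum_left)

lemma bilin_sum_right: "bilin M w (\<Sum>i\<in>I. c i *\<^sub>R v i) = (\<Sum>i\<in>I. c i * bilin M w (v i))"
  by (simp add: bilin_def inner_sum_right linear_sum[OF matrix_vector_mul_linear]
    linear_cmul[OF matrix_vector_mul_linear])

lemma matrix_inv_works:
  fixes A :: "real ^ 'n ^ 'n"
  assumes "invertible A"
  shows "A ** matrix_inv A = mat 1" "matrix_inv A ** A = mat 1"
  using someI_ex[OF assms[unfolded invertible_def]] unfolding matrix_inv_def by auto

lemma sum3_pull:
  "(\<Oplus>a b d. h a b d) = (\<Oplus>d a b. h a b d)"
  by (rule trans[OF sum.cong[OF refl sum.swap] sum.swap])

lemma sum4_pull:
  "(\<Oplus>a b c d. h a b c d) = (\<Oplus>d a b c. h a b c d)"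
  by (rule trans[OF sum.cong[OF refl sum3_pull] sum.swap])

lemma sum4_rotate:
  "(\<Oplus>i j a s. h i j a s) = (\<Oplus>s j a i. h i j a s)"
  "(\<Oplus>i j a s. h i j a s) = (\<Oplus>i s a j. h i j a s)"
  by (rule trans[OF sum4_pull sum.cong[OF refl sum3_pull[symmetric]]])
    (rule sum.cong[OF refl], rule trans[OF sum3_pull sum.cong[OF refl sum.swap]])

lemma sum4_perm:
  "(\<Oplus>c s d b. h b c d s) = (\<Oplus>b c d s. h b c d s)"
  by (rule trans[OF sum4_pull]) (intro sum.cong[OF refl] sum.swap)

text \<open>A coordinate patch detached from any manifold, so that it covers images of charts,
  overlaps of charts and normal coordinates alike.\<close>

locale metric_chart =
  fixes U :: "(real ^ 'n::finite) set" and G :: "real ^ 'n \<Rightarrow> real ^ 'n ^ 'n"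
  assumes open_U: "open U"
    and smooth_G: "\<And>i j. smooth_on U (\<lambda>x. G x $ i $ j)"
    and sym_G: "\<And>x i j. x \<in> U \<Longrightarrow> G x $ i $ j = G x $ j $ i"
    and pos_G: "\<And>x v. x \<in> U \<Longrightarrow> v \<noteq> 0 \<Longrightarrow> 0 < bilin (G x) v v"
begin

lemma bilin_sym: "x \<in> U \<Longrightarrow> bilin (G x) v w = bilin (G x) w v"
  unfolding bilin_sum using sym_G[of x] by (subst sum.swap) (simp add: mult_ac)

lemma invertible_G: assumes "x \<in> U" shows "invertible (G x)"
proof -
  have "v = 0" if "G x *v v = 0" for v
    using pos_G[OF assms, of v] that by (auto simp: bilin_def)
  then show ?thesis unfolding invertible_left_inverse matrix_left_invertible_ker by blast
qed

lemma G_inv: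
  assumes "x \<in> U"
  shows "(\<Oplus>l. G x $ i $ l * matrix_inv (G x) $ l $ j) = (if i = j then 1 else 0)"
    "(\<Oplus>l. matrix_inv (G x) $ i $ l * G x $ l $ j) = (if i = j then 1 else 0)"
  using matrix_inv_works[OF invertible_G[OF assms]]
  by (auto simp: vec_eq_iff matrix_matrix_mult_def mat_def)

text \<open>By Cramer's rule the entries of the inverse are quotients of determinants, and these are
  polynomials in the entries of \<open>G\<close>.\<close>

lemma smooth_G_inv: "smooth_on U (\<lambda>x. matrix_inv (G x) $ k $ l)"
proof -
  have *: "matrix_inv (G x) $ k $ l = det (\<chi> i j. if j = k then axis l 1 $ i else G x $ i $ j) / det (G x)"
    if "x \<in> U" for x
  proof -
    have "det (G x) \<noteq> 0" using invertible_G[OF that] by (simp add: invertible_det_nz)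
    moreover have "G x *v (\<chi> i. matrix_inv (G x) $ i $ l) = axis l 1"
      using G_inv(1)[OF that] by (simp add: matrix_vector_mult_def vec_eq_iff axis_def)
    ultimately have "(\<chi> i. matrix_inv (G x) $ i $ l)
      = (\<chi> k. det (\<chi> i j. if j = k then axis l 1 $ i else G x $ i $ j) / det (G x))"
      using cramer by blast
    then show ?thesis by (metis (no_types, lifting) vec_lambda_beta)
  qed
  have 1: "smooth_on U (\<lambda>x. det (\<chi> i j. if j = k then axis l 1 $ i else G x $ i $ j))" unfolding det_def
  proof (intro smooth_on_sum smooth_on_mult smooth_on_prod smooth_on_const open_U)
    show "smooth_on U (\<lambda>x. (\<chi> i j. if j = k then axis l 1 $ i else G x $ i $ j) $ i $ p i)" for i p
      by (cases "p i = k") (auto intro: smooth_G smooth_on_const)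
  qed
  have 2: "smooth_on U (\<lambda>x. det (G x))" unfolding det_def
    by (intro smooth_on_sum smooth_on_mult smooth_on_prod smooth_on_const open_U smooth_G)
  have "smooth_on U (\<lambda>x. det (\<chi> i j. if j = k then axis l 1 $ i else G x $ i $ j) / det (G x))"
    using invertible_G by (intro smooth_on_divide 1 2 open_U) (auto simp: invertible_det_nz)
  then show ?thesis using smooth_on_cong[OF open_U *] by fast
qed

lemma smooth_christoffel: "smooth_on U (christoffel G k i j)"
proof -
  have "smooth_on U (\<lambda>x. (\<Oplus>l. matrix_inv (G x) $ k $ l *
     (\<partial> i (\<lambda>y. G y $ j $ l) x + \<partial> j (\<lambda>y. G y $ i $ l) x
      - \<partial> l (\<lambda>y. G y $ i $ j) x)) * (1/2))"
    by (intro smooth_on_mult smooth_on_sum smooth_on_diff smooth_on_add smooth_on_const open_U smooth_G_inv)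
     (intro smooth_on_partial_deriv smooth_G)+
  then show ?thesis by (simp add: christoffel_def[abs_def])
qed

lemma smooth_curv_up: "smooth_on U (curv_up G m j k l)"
  unfolding curv_up_def[abs_def]
  by (intro smooth_on_mult smooth_on_sum smooth_on_diff smooth_on_add open_U smooth_christoffel
    smooth_on_partial_deriv)

lemma smooth_riemann: "smooth_on U (\<lambda>x. riemann G x $ i $ j $ k $ l)"
  unfolding riemann_def by (simp, intro smooth_on_mult smooth_on_sum open_U smooth_G smooth_curv_up)

lemma differentiable_G: "x \<in> U \<Longrightarrow> (\<lambda>x. G x $ i $ j) differentiable (at x)"
  by (rule smooth_on_differentiable[OF open_U smooth_G])

lemma differentiable_christoffel: "x \<in> U \<Longrightarrow> christoffel G k i j differentiable (at x)"
  by (rule smooth_on_differentiable[OF open_U smooth_christoffel])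

lemma partial_deriv_G_sym: "x \<in> U \<Longrightarrow> \<partial> a (\<lambda>x. G x $ i $ j) x = \<partial> a (\<lambda>x. G x $ j $ i) x"
  by (rule partial_deriv_cong[OF open_U]) (auto simp: sym_G)

lemma christoffel_sym: "x \<in> U \<Longrightarrow> christoffel G k i j x = christoffel G k j i x"
  unfolding christoffel_def using partial_deriv_G_sym[of x _ i j]
  by (simp add: add.commute)

lemma christoffel_lower:
  assumes "x \<in> U"
  shows "(\<Oplus>s. G x $ m $ s * christoffel G s i j x)
    = (\<partial> i (\<lambda>y. G y $ j $ m) x + \<partial> j (\<lambda>y. G y $ i $ m) x
      - \<partial> m (\<lambda>y. G y $ i $ j) x) / 2"
proof -
  let ?d = "\<lambda>l. (\<partial> i (\<lambda>y. G y $ j $ l) x + \<partial> j (\<lambda>y. G y $ i $ l) x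
      - \<partial> l (\<lambda>y. G y $ i $ j) x) / 2"
  have "(\<Oplus>s. G x $ m $ s * christoffel G s i j x)
    = (\<Oplus>s l. (G x $ m $ s * matrix_inv (G x) $ s $ l) * ?d l)"
    by (simp add: christoffel_def sum_distrib_left sum_divide_distrib mult_ac)
  also have "\<dots> = (\<Oplus>l. (\<Oplus>s. G x $ m $ s * matrix_inv (G x) $ s $ l) * ?d l)"
    by (subst sum.swap) (simp only: sum_distrib_right)
  also have "\<dots> = (\<Oplus>l. if m = l then ?d l else 0)"
    by (rule sum.cong) (auto simp: G_inv(1)[OF assms])
  finally show ?thesis by simp
qed

text \<open>This is \<nabla>g = 0 in coordinates: in the sum of the two lowered Christoffel symbols
  all derivatives cancel except the one on the left.\<close>

lemma metric_compat:
  assumes "x \<in> U"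
  shows "\<partial> a (\<lambda>x. G x $ i $ j) x
    = (\<Oplus>s. christoffel G s a i x * G x $ s $ j) + (\<Oplus>s. christoffel G s a j x * G x $ i $ s)"
proof -
  have "(\<Oplus>s. christoffel G s a i x * G x $ s $ j) = (\<Oplus>s. G x $ j $ s * christoffel G s a i x)"
    by (simp add: sym_G[OF assms, of j] mult.commute)
  moreover have "(\<Oplus>s. christoffel G s a j x * G x $ i $ s) = (\<Oplus>s. G x $ i $ s * christoffel G s a j x)"
    by (simp add: mult.commute)
  ultimately show ?thesis unfolding christoffel_lower[OF assms]
    using partial_deriv_G_sym[OF assms, of _ i] partial_deriv_G_sym[OF assms, of _ j a]
    by (simp add: field_simps)
qed

text \<open>The connection as a bilinear map \<Gamma>(u, v); vector notation keeps the index sums in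
  the transformation law manageable.\<close>

definition chr :: "real ^ 'n \<Rightarrow> real ^ 'n \<Rightarrow> real ^ 'n \<Rightarrow> real ^ 'n" where
  "chr x u v = (\<chi> k. \<Oplus>i j. christoffel G k i j x * u $ i * v $ j)"

lemma chr_sym: "x \<in> U \<Longrightarrow> chr x u v = chr x v u"
  unfolding chr_def using christoffel_sym[of x] by (subst sum.swap) (simp add: mult_ac)

lemma linear_chr: "linear (chr x u)"
  by (rule linearI) (simp_all add: vec_eq_iff chr_def sum.distrib algebra_simps sum_distrib_left)

lemma chr_sum: "chr x u (\<Sum>i\<in>I. c i *\<^sub>R v i) = (\<Sum>i\<in>I. c i *\<^sub>R chr x u (v i))"
  by (simp add: linear_sum[OF linear_chr] linear_cmul[OF linear_chr])

lemma chr_diff: "chr x u (v - w) = chr x u v - chr x u w"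
  by (simp add: vec_eq_iff chr_def sum_subtractf algebra_simps)

text \<open>Metric compatibility contracted with vectors: the left side is the derivative of the
  metric in direction \<open>w\<close>, evaluated on \<open>u\<close> and \<open>v\<close>.\<close>

lemma metric_compat_bilin:
  assumes "x \<in> U"
  shows "(\<Oplus>i j. u $ i * (\<Oplus>a. \<partial> a (\<lambda>x. G x $ i $ j) x * w $ a) * v $ j)
    = bilin (G x) (chr x w u) v + bilin (G x) u (chr x w v)"
proof -
  have 1: "(\<Oplus>i j a s. u $ i * christoffel G s a i x * G x $ s $ j * w $ a * v $ j)
    = bilin (G x) (chr x w u) v"
    by (rule trans[OF sum4_rotate(1)]) (simp add: bilin_sum chr_def sum_distrib_left sum_distrib_right
      mult_ac)
  have 2: "(\<Oplus>i j a s. u $ i * christoffel G s a j x * G x $ i $ s * w $ a * v $ j)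
    = bilin (G x) u (chr x w v)"
    by (rule trans[OF sum4_rotate(2)]) (simp add: bilin_sum chr_def sum_distrib_left sum_distrib_right
      mult_ac)
  show ?thesis unfolding metric_compat[OF assms] 1[symmetric] 2[symmetric]
    by (simp add: sum_distrib_left sum_distrib_right sum.distrib algebra_simps)
qed

text \<open>The derivative of \<Gamma> in direction \<open>u\<close>, applied to \<open>v\<close>
  and \<open>w\<close>.\<close>

definition dchr :: "real ^ 'n \<Rightarrow> real ^ 'n \<Rightarrow> real ^ 'n \<Rightarrow> real ^ 'n \<Rightarrow> real ^ 'n" where
  "dchr x u v w = (\<chi> a. \<Oplus>b c d. \<partial> d (christoffel G a b c) x * u $ d * v $ b * w $ c)"

text \<open>The curvature operator R(v, w)u; the vector acted upon comes first, in accordance with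
  the order of the lower indices of \<open>curv_up\<close>.\<close>

definition curvv :: "real ^ 'n \<Rightarrow> real ^ 'n \<Rightarrow> real ^ 'n \<Rightarrow> real ^ 'n \<Rightarrow> real ^ 'n" where
  "curvv x u v w = (\<chi> a. \<Oplus>b c d. curv_up G a b c d x * u $ b * v $ c * w $ d)"

lemma chr_chr: "chr x v (chr x w u) $ a = (\<Oplus>b c d s. 
    christoffel G a c s x * christoffel G s d b x * u $ b * v $ c * w $ d)"
proof -
  have "chr x v (chr x w u) $ a = (\<Oplus>c s d b. 
    christoffel G a c s x * christoffel G s d b x * u $ b * v $ c * w $ d)"
    by (simp add: chr_def sum_distrib_left mult_ac)
  also have "\<dots> = (\<Oplus>b c d s. 
    christoffel G a c s x * christoffel G s d b x * u $ b * v $ c * w $ d)"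
    by (rule sum4_perm)
  finally show ?thesis .
qed

lemma curvv_eq:
  "curvv x u v w = dchr x v w u - dchr x w v u + chr x v (chr x w u) - chr x w (chr x v u)"
proof -
  have 1: "dchr x v w u $ a = (\<Oplus>b c d. \<partial> c (christoffel G a d b) x * u $ b * v $ c * w $ d)" for a
    unfolding dchr_def by (simp, rule trans[OF sum3_pull[symmetric]]) (simp add: mult_ac)
  have 2: "dchr x w v u $ a = (\<Oplus>b c d. \<partial> d (christoffel G a c b) x * u $ b * v $ c * w $ d)" for a
    unfolding dchr_def by (simp, rule trans[OF sum.swap]) (simp add: mult_ac)
  have 4: "chr x w (chr x v u) $ a = (\<Oplus>b c d s. 
    christoffel G a d s x * christoffel G s c b x * u $ b * v $ c * w $ d)" for a
    unfolding chr_chr by (rule sum.cong[OF refl], rule trans[OF sum.swap]) (simp add: mult_ac)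
  show ?thesis
    unfolding vec_eq_iff
    by (simp add: 1 2 chr_chr[of x v w] 4 curvv_def curv_up_def sum.distrib sum_subtractf algebra_simps
        sum_distrib_left sum_distrib_right)
qed

end

text \<open>\<open>src\<close> is a metric on \<open>U\<close> and \<open>tgt\<close> its pullback
  to \<open>U'\<close>, so \<open>f\<close> runs from the \<open>tgt\<close> patch to the
  \<open>src\<close> patch. The instances are transition maps and normal coordinates.\<close>

locale chart_change = src: metric_chart U G + tgt: metric_chart U' G'
  for U :: "(real ^ 'n::finite) set" and G and U' :: "(real ^ 'n) set" and G' +
  fixes f :: "real ^ 'n \<Rightarrow> real ^ 'n"
  assumes f_smooth: "\<And>a. smooth_on U' (\<lambda>y. f y $ a)"
    and f_maps: "f ` U' \<subseteq> U"
    and pullback: "\<And>y i j. y \<in> U' \<Longrightarrow> G' y $ i $ j =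
      bilin (G (f y)) (\<chi> a. \<partial> i (\<lambda>y. f y $ a) y) (\<chi> a. \<partial> j (\<lambda>y. f y $ a) y)"
begin

text \<open>The image of the \<open>i\<close>-th coordinate vector under the differential of
  \<open>f\<close>, a vector in the patch \<open>U\<close>.\<close>

definition J :: "'n \<Rightarrow> real ^ 'n \<Rightarrow> real ^ 'n" where
  "J i y = (\<chi> a. \<partial> i (\<lambda>y. f y $ a) y)"

definition dJ :: "'n \<Rightarrow> 'n \<Rightarrow> real ^ 'n \<Rightarrow> real ^ 'n" where
  "dJ i j y = (\<chi> a. \<partial> i (\<lambda>y. J j y $ a) y)"

lemma smooth_J: "smooth_on U' (\<lambda>y. J i y $ a)"
  unfolding J_def using smooth_on_partial_deriv[OF f_smooth] by simp

lemma differentiable_J: "y \<in> U' \<Longrightarrow> (\<lambda>y. J i y $ a) differentiable (at y)"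
  by (rule smooth_on_differentiable[OF tgt.open_U smooth_J])

lemma f_in: "y \<in> U' \<Longrightarrow> f y \<in> U"
  using f_maps by blast

lemma dJ_sym: "y \<in> U' \<Longrightarrow> dJ i j y = dJ j i y"
  unfolding dJ_def J_def using partial_deriv_commute[OF tgt.open_U f_smooth] by (simp add: vec_eq_iff)

lemma pullback_J: "y \<in> U' \<Longrightarrow> G' y $ i $ j = bilin (G (f y)) (J i y) (J j y)"
  using pullback by (simp add: J_def)

lemma partial_deriv_compose_f:
  assumes "y \<in> U'" "g differentiable (at (f y))"
  shows "\<partial> i (\<lambda>y. g (f y)) y = (\<Oplus>a. \<partial> a g (f y) * J i y $ a)"
  using partial_deriv_compose[where F=f and x=y and g=g and i=i, OF assms(2)]
    smooth_on_differentiable[OF tgt.open_U f_smooth assms(1)]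
  by (simp add: J_def)

lemma differentiable_compose_f:
  assumes "y \<in> U'" "g differentiable (at (f y))"
  shows "(\<lambda>y. g (f y)) differentiable (at y)"
proof -
  have "f differentiable (at y)"
    by (rule differentiable_vec) (rule smooth_on_differentiable[OF tgt.open_U f_smooth assms(1)])
  then show ?thesis using assms(2) by (rule differentiable_compose[where g=f and f=g, rotated])
qed

text \<open>The product rule applied to the pullback formula; the derivative of \<open>G\<close> is
  expressed through \<Gamma>, which turns derivatives of the \<open>J i\<close> into covariant
  ones.\<close>

lemma partial_deriv_G':
  assumes y: "y \<in> U'"
  shows "\<partial> a (\<lambda>y. G' y $ i $ j) y
    = bilin (G (f y)) (dJ a i y + src.chr (f y) (J a y) (J i y)) (J j y)
    + bilin (G (f y)) (J i y) (dJ a j y + src.chr (f y) (J a y) (J j y))"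
proof -
  note d = differentiable_J[OF y] differentiable_compose_f[OF y src.differentiable_G[OF f_in[OF y]]]
  have "\<partial> a (\<lambda>y. G' y $ i $ j) y
     = \<partial> a (\<lambda>y. \<Oplus>b c. J i y $ b * G (f y) $ b $ c * J j y $ c) y"
    by (rule partial_deriv_cong[OF tgt.open_U y]) (simp add: pullback_J bilin_sum)
  also have "\<dots> = (\<Oplus>b c. J i y $ b * G (f y) $ b $ c * dJ a j y $ c
      + (J i y $ b * (\<Oplus>d. \<partial> d (\<lambda>y. G y $ b $ c) (f y) * J a y $ d)
         + dJ a i y $ b * G (f y) $ b $ c) * J j y $ c)"
    using d by (simp add: partial_deriv_sum partial_deriv_mult differentiable_mult dJ_def
       partial_deriv_compose_f[OF y src.differentiable_G[OF f_in[OF y]]] del: sum.distrib)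
  also have "\<dots> = bilin (G (f y)) (J i y) (dJ a j y) + bilin (G (f y)) (dJ a i y) (J j y)
     + (\<Oplus>b c. J i y $ b * (\<Oplus>d. \<partial> d (\<lambda>y. G y $ b $ c) (f y) * J a y $ d) * J j y $ c)"
    by (simp add: bilin_sum sum.distrib algebra_simps)
  finally show ?thesis unfolding src.metric_compat_bilin[OF f_in[OF y]] by (simp add: bilin_add)
qed

text \<open>The covariant derivative of \<open>J j\<close> along \<open>J i\<close> for the metric
  \<open>G\<close>, minus the image of the one for \<open>G'\<close>. Its vanishing is the
  transformation law of the Christoffel symbols.\<close>

definition defect :: "'n \<Rightarrow> 'n \<Rightarrow> real ^ 'n \<Rightarrow> real ^ 'n" where
  "defect i j y = dJ i j y + src.chr (f y) (J i y) (J j y) - (\<Oplus>k. christoffel G' k i j y *\<^sub>R J k y)"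

text \<open>\<open>G'\<close> is the Gram matrix of the vectors \<open>J k\<close>; since it is
  positive definite, they are linearly independent.\<close>

lemma J_spans:
  assumes y: "y \<in> U'"
  obtains c where "v = (\<Oplus>k. c k *\<^sub>R J k y)"
proof -
  define M where "M = (\<chi> a k. J k y $ a)"
  have M: "M *v c = (\<Oplus>k. c $ k *\<^sub>R J k y)" for c
    by (simp add: M_def matrix_vector_mult_def vec_eq_iff mult.commute)
  have "c = 0" if "M *v c = 0" for c
  proof (rule ccontr)
    assume "c \<noteq> 0"
    then have "0 < bilin (G' y) c c" by (rule tgt.pos_G[OF y])
    also have "bilin (G' y) c c = bilin (G (f y)) (M *v c) (M *v c)"
      unfolding M bilin_sum_left bilin_sum_right unfolding bilin_sum[of "G' y"]
      by (subst sum.swap) (simp add: pullback_J[OF y] sum_distrib_left mult_ac)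
    finally show False using that by (simp add: bilin_def)
  qed
  then have "invertible M" unfolding invertible_left_inverse matrix_left_invertible_ker by blast
  then have "v = M *v (matrix_inv M *v v)"
    by (simp add: matrix_vector_mul_assoc matrix_inv_works)
  then show thesis using that M by metis
qed

text \<open>The defect, lowered with the metric, is symmetric in its first and skew in its last two
  arguments, because both connections are torsion-free and metric.\<close>

lemma defect_zero: assumes y: "y \<in> U'" shows "defect i j y = 0"
proof -
  define A where "A i j k = bilin (G (f y)) (defect i j y) (J k y)" for i j k
  have sym: "A i j k = A j i k" for i j k
    unfolding A_def defect_def
    using dJ_sym[OF y, of i j] src.chr_sym[OF f_in[OF y], of "J i y"
      "J j y"] tgt.christoffel_sym[OF y, of _ i j] by simp
  have skew: "A i j k = - A i k j" for i j k
  proof -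
    have "A i j k + A i k j = \<partial> i (\<lambda>y. G' y $ j $ k) y
       - ((\<Oplus>s. christoffel G' s i j y * G' y $ s $ k) + (\<Oplus>s. christoffel G' s i k y * G' y $ j $ s))"
      unfolding A_def defect_def partial_deriv_G'[OF y]
      using src.bilin_sym[OF f_in[OF y]] by (simp add: bilin_diff bilin_add bilin_sum_left pullback_J[OF y])
    then show ?thesis using tgt.metric_compat[OF y, of i j k] by simp
  qed
  \<comment> \<open>Alternating the two symmetries six times returns to the same indices with the
    opposite sign.\<close>
  have A0: "A i j k = 0" for i j k
    using sym[of i j k] sym[of i k j] sym[of j k i] skew[of i j k] skew[of j k i] skew[of k i j] by linarith
  have "bilin (G (f y)) (defect i j y) v = 0" for v
  proof -
    obtain c where "v = (\<Oplus>k. c k *\<^sub>R J k y)" using J_spans[OF y] .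
    then show ?thesis using A0 by (simp add: bilin_sum_right A_def)
  qed
  then show ?thesis using src.pos_G[OF f_in[OF y], of "defect i j y"] by force
qed

text \<open>Second derivatives of \<open>f\<close> are thereby determined by its first derivatives,
  so third derivatives can be computed by differentiating the right side.\<close>

lemma dJ_eq:
  assumes y: "y \<in> U'"
  shows "dJ i j y = (\<Oplus>k. christoffel G' k i j y *\<^sub>R J k y) - src.chr (f y) (J i y) (J j y)"
  using defect_zero[OF y, of i j] by (simp add: defect_def algebra_simps)

lemma partial_deriv_dJ:
  assumes y: "y \<in> U'"
  shows "(\<chi> a. \<partial> k (\<lambda>y. dJ l j y $ a) y)
    = (\<Oplus>m. christoffel G' m l j y *\<^sub>R dJ k m y) + (\<Oplus>m. \<partial> k (christoffel G' m l j) y *\<^sub>R J m y)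
      - (src.dchr (f y) (J k y) (J l y) (J j y) + src.chr (f y) (dJ k l y) (J j y)
        + src.chr (f y) (J l y) (dJ k j y))"
proof -
  note d = differentiable_J[OF y] differentiable_compose_f[OF y src.differentiable_christoffel[OF
    f_in[OF y]]]
    tgt.differentiable_christoffel[OF y]
  have "\<partial> k (\<lambda>y. dJ l j y $ a) y = 
      (\<Oplus>m. christoffel G' m l j y * dJ k m y $ a + \<partial> k (christoffel G' m l j) y * J m y $ a)
    - (\<Oplus>b c. christoffel G a b c (f y) * J l y $ b * dJ k j y $ c
        + (christoffel G a b c (f y) * dJ k l y $ b
        + (\<Oplus>d. \<partial> d (christoffel G a b c) (f y) * J k y $ d) * J l y $ b) * J j y $ c)" for a
  proof -
    have "\<partial> k (\<lambda>y. dJ l j y $ a) y = \<partial> k (\<lambda>y. (\<Oplus>m. christoffel G' m l j y * J m y $ a)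
      - (\<Oplus>b c. christoffel G a b c (f y) * J l y $ b * J j y $ c)) y"
      by (rule partial_deriv_cong[OF tgt.open_U y]) (simp add: dJ_eq src.chr_def)
    also have "\<dots> = (\<Oplus>m. christoffel G' m l j y * dJ k m y $ a + \<partial> k (christoffel G' m l j) y * J m y $ a)
    - (\<Oplus>b c. christoffel G a b c (f y) * J l y $ b * dJ k j y $ c
        + (christoffel G a b c (f y) * dJ k l y $ b
        + (\<Oplus>d. \<partial> d (christoffel G a b c) (f y) * J k y $ d) * J l y $ b) * J j y $ c)"
      using d by (simp add: partial_deriv_diff partial_deriv_sum partial_deriv_mult
        differentiable_mult differentiable_sum dJ_def
       partial_deriv_compose_f[OF y src.differentiable_christoffel[OF f_in[OF y]]])
    finally show ?thesis .
  qed
  then show ?thesis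
    by (simp add: vec_eq_iff src.chr_def src.dchr_def sum.distrib
      algebra_simps sum_distrib_left sum_distrib_right)
qed

text \<open>An integrability condition: skew-symmetrizing the third derivatives of \<open>f\<close>
  gives zero, while the formula obtained from \<open>dJ_eq\<close> gives the difference of the two
  curvatures.\<close>

lemma curv_up_transform:
  assumes y: "y \<in> U'"
  shows "(\<Oplus>m. curv_up G' m j k l y *\<^sub>R J m y) = src.curvv (f y) (J j y) (J k y) (J l y)"
proof -
  define c where "c = src.chr (f y)"
  define D where "D k l = (\<chi> a. \<partial> k (\<lambda>y. dJ l j y $ a) y)" for k l
  have D: "D k l = (\<Oplus>m s. (christoffel G' m l j y * christoffel G' s k m y) *\<^sub>R J s y)
     - (\<Oplus>m. christoffel G' m l j y *\<^sub>R c (J k y) (J m y))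
     + (\<Oplus>m. \<partial> k (christoffel G' m l j) y *\<^sub>R J m y)
     - src.dchr (f y) (J k y) (J l y) (J j y) - c (dJ k l y) (J j y)
     - (\<Oplus>m. christoffel G' m k j y *\<^sub>R c (J l y) (J m y)) + c (J l y) (c (J k y) (J j y))" for k l
    unfolding D_def partial_deriv_dJ[OF y] dJ_eq[OF y, of k j] dJ_eq[OF y, of k]
    by (simp add: c_def src.chr_diff src.chr_sum scaleR_diff_right sum_subtractf scaleR_sum_right
      algebra_simps)
  \<comment> \<open>Both sides are third partial derivatives of \<open>f\<close>, taken in a
    different order.\<close>
  have "D k l = D l k"
    unfolding D_def dJ_def using partial_deriv_commute[OF tgt.open_U smooth_J y, of k l j]
      by (simp add: vec_eq_iff)
  then have eq: "(\<Oplus>m s. (christoffel G' m l j y * christoffel G' s k m y) *\<^sub>R J s y)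
     - (\<Oplus>m s. (christoffel G' m k j y * christoffel G' s l m y) *\<^sub>R J s y)
     + (\<Oplus>m. \<partial> k (christoffel G' m l j) y *\<^sub>R J m y)
     - (\<Oplus>m. \<partial> l (christoffel G' m k j) y *\<^sub>R J m y)
     = src.curvv (f y) (J j y) (J k y) (J l y)"
    unfolding D src.curvv_eq using dJ_sym[OF y, of k l] by (simp add: c_def algebra_simps)
  have sw: "(\<Oplus>m s. (christoffel G' m l j y * christoffel G' s k m y) *\<^sub>R J s y)
    = (\<Oplus>m. (\<Oplus>s. christoffel G' m k s y * christoffel G' s l j y) *\<^sub>R J m y)" for k l
    by (subst sum.swap) (simp add: scaleR_sum_left mult.commute)
  show ?thesis unfolding eq[symmetric] sw curv_up_def
    by (simp add: sum_subtractf scaleR_diff_left scaleR_add_left sum.distrib)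
qed

lemma riemann_transform:
  assumes y: "y \<in> U'"
  shows "riemann G' y = change_frame (\<chi> i. J i y) (riemann G (f y))"
proof -
  have "riemann G' y $ i $ j $ k $ l = change_frame (\<chi> i. J i y) (riemann G (f y)) $ i $ j $ k $ l"
    for i j k l
  proof -
    define h where "h a b c d e = J i y $ a * (G (f y) $ a $ e * (curv_up G e b c d (f y) * J j y $ b
      * J k y $ c * J l y $ d))"
      for a b c d e
    have cv: "src.curvv (f y) (J j y) (J k y) (J l y) $ e
      = (\<Oplus>b c d. curv_up G e b c d (f y) * J j y $ b * J k y $ c * J l y $ d)" for e
      by (simp add: src.curvv_def)
    have "riemann G' y $ i $ j $ k $ l = bilin (G (f y)) (J i y) (\<Oplus>m. curv_up G' m j k l y *\<^sub>R J m y)"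
      unfolding bilin_sum_right by (simp add: riemann_def pullback_J[OF y] mult.commute)
    also have "\<dots> = (\<Oplus>a e. J i y $ a * G (f y) $ a $ e * src.curvv (f y) (J j y) (J k y) (J l y) $ e)"
      unfolding curv_up_transform[OF y] bilin_sum ..
    also have "\<dots> = (\<Oplus>a e b c d. h a b c d e)"
      unfolding cv h_def by (simp only: sum_distrib_left mult.assoc)
    also have "\<dots> = (\<Oplus>a b c d e. h a b c d e)"
      by (simp only: sum4_pull[of "h _"])
    also have "\<dots> = change_frame (\<chi> i. J i y) (riemann G (f y)) $ i $ j $ k $ l"
      unfolding change_frame_def tensor4_apply_def riemann_def vec_lambda_beta h_def
      by (intro sum.cong refl) (simp add: sum_distrib_left mult_ac)
    finally show ?thesis .
  qed
  then show ?thesis by (simp add: vec_eq_iff)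
qed

end

section \<open>Algebraic curvature tensors\<close>

lemma alg_curvD:
  assumes "R \<in> alg_curv"
  shows "R $ j $ i $ k $ l = - R $ i $ j $ k $ l" "R $ i $ j $ l $ k = - R $ i $ j $ k $ l"
    "R $ k $ l $ i $ j = R $ i $ j $ k $ l" "R $ i $ j $ k $ l + R $ j $ k $ i $ l + R $ k $ i $ j $ l = 0"
  using assms unfolding alg_curv_def mem_Collect_eq by blast+

lemma alg_curvI:
  assumes "\<And>i j k l. R $ j $ i $ k $ l = - R $ i $ j $ k $ l"
    "\<And>i j k l. R $ i $ j $ l $ k = - R $ i $ j $ k $ l"
    "\<And>i j k l. R $ k $ l $ i $ j = R $ i $ j $ k $ l"
    "\<And>i j k l. R $ i $ j $ k $ l + R $ j $ k $ i $ l + R $ k $ i $ j $ l = 0"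
  shows "R \<in> alg_curv"
  unfolding alg_curv_def mem_Collect_eq using assms by blast

lemma subspace_alg_curv: "subspace alg_curv"
  unfolding subspace_def
proof (intro conjI ballI allI)
  fix x y :: "'a tensor4" and c :: real
  assume x: "x \<in> alg_curv"
  show "c *\<^sub>R x \<in> alg_curv"
  proof (rule alg_curvI)
    fix i j k l
    note X = alg_curvD(1)[OF x, of j i k l] alg_curvD(2)[OF x, of i j l k] alg_curvD(3)[OF x, of k l i j]
      alg_curvD(4)[OF x, of i j k l]
    show "(c *\<^sub>R x) $ j $ i $ k $ l = - (c *\<^sub>R x) $ i $ j $ k $ l" by (simp add: X(1))
    show "(c *\<^sub>R x) $ i $ j $ l $ k = - (c *\<^sub>R x) $ i $ j $ k $ l" by (simp add: X(2))
    show "(c *\<^sub>R x) $ k $ l $ i $ j = (c *\<^sub>R x) $ i $ j $ k $ l" by (simp add: X(3))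
    show "(c *\<^sub>R x) $ i $ j $ k $ l + (c *\<^sub>R x) $ j $ k $ i $ l + (c *\<^sub>R x) $ k $ i $ j $ l = 0"
      using X(4) by (simp flip: distrib_left)
  qed
  assume y: "y \<in> alg_curv"
  show "x + y \<in> alg_curv"
  proof (rule alg_curvI)
    fix i j k l
    note X = alg_curvD(1)[OF x, of j i k l] alg_curvD(2)[OF x, of i j l k] alg_curvD(3)[OF x, of k l i j]
      alg_curvD(4)[OF x, of i j k l]
    note Y = alg_curvD(1)[OF y, of j i k l] alg_curvD(2)[OF y, of i j l k] alg_curvD(3)[OF y, of k l i j]
      alg_curvD(4)[OF y, of i j k l]
    show "(x + y) $ j $ i $ k $ l = - (x + y) $ i $ j $ k $ l" by (simp add: X(1) Y(1))
    show "(x + y) $ i $ j $ l $ k = - (x + y) $ i $ j $ k $ l" by (simp add: X(2) Y(2))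
    show "(x + y) $ k $ l $ i $ j = (x + y) $ i $ j $ k $ l" by (simp add: X(3) Y(3))
    show "(x + y) $ i $ j $ k $ l + (x + y) $ j $ k $ i $ l + (x + y) $ k $ i $ j $ l = 0"
      using X(4) Y(4) by simp
  qed
qed (simp add: alg_curv_def)

section \<open>The model tensor I and the quadratic term Q\<close>

abbreviation dl :: "'a \<Rightarrow> 'a \<Rightarrow> real" where
  "dl i j \<equiv> (if i = j then 1 else 0)"

lemma id_curv_nth: "id_curv $ i $ j $ k $ l = dl i k * dl j l - dl i l * dl j k"
  by (simp add: id_curv_def)

lemma id_curv_in_alg_curv: "id_curv \<in> alg_curv"
  by (rule alg_curvI) (auto simp: id_curv_nth)

text \<open>The first Bianchi identity, arranged so that \<open>R $ i $ j $ p $ q\<close> is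
  replaced by components in which \<open>p\<close> and \<open>q\<close> occupy the second and fourth
  slots, as in the other half of \<open>Q_curv\<close>.\<close>

lemma alg_curv_split:
  assumes "R \<in> alg_curv"
  shows "R $ i $ j $ p $ q = R $ i $ p $ j $ q - R $ i $ q $ j $ p"
  using alg_curvD(4)[OF assms, of i j p q] alg_curvD(1)[OF assms, of p i j q] alg_curvD(3)[OF assms,
    of j p i q]
  by linarith

text \<open>The quadratic expression that Hamilton denotes by B, up to index conventions; its
  symmetries make those of \<open>Q_curv\<close> visible.\<close>

definition Acurv :: "('n::finite) tensor4 \<Rightarrow> 'n \<Rightarrow> 'n \<Rightarrow> 'n \<Rightarrow> 'n \<Rightarrow> real" where
  "Acurv R i j k l = (\<Oplus>p q. R $ i $ p $ j $ q * R $ k $ p $ l $ q)"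

lemma Acurv_sym: "Acurv R k l i j = Acurv R i j k l"
  by (simp add: Acurv_def mult.commute)

lemma Acurv_flip:
  assumes "R \<in> alg_curv"
  shows "Acurv R j i l k = Acurv R i j k l"
proof -
  have "Acurv R j i l k = (\<Oplus>p q. R $ i $ q $ j $ p * R $ k $ q $ l $ p)"
    unfolding Acurv_def by (intro sum.cong refl arg_cong2[of _ _ _ _ "(*)"] alg_curvD(3)[OF assms])
  then show ?thesis unfolding Acurv_def by (simp add: sum.swap[of "\<lambda>p q.
    R $ i $ q $ j $ p * R $ k $ q $ l $ p"])
qed

lemma sum_alg_curv_square:
  assumes "R \<in> alg_curv"
  shows "(\<Oplus>p q. R $ k $ p $ l $ q * R $ i $ j $ p $ q) = Acurv R i j k l - Acurv R i j l k"
proof -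
  have "(\<Oplus>p q. R $ k $ p $ l $ q * R $ i $ j $ p $ q)
    = Acurv R i j k l - (\<Oplus>p q. R $ k $ p $ l $ q * R $ i $ q $ j $ p)"
    unfolding Acurv_def alg_curv_split[OF assms, of i j]
      by (simp add: right_diff_distrib sum_subtractf mult.commute)
  also have "(\<Oplus>p q. R $ k $ p $ l $ q * R $ i $ q $ j $ p) = Acurv R k l j i"
    unfolding Acurv_def by (intro sum.cong refl arg_cong2[of _ _ _ _ "(*)"] alg_curvD(3)[OF assms])
  also have "Acurv R k l j i = Acurv R i j l k"
    using Acurv_sym[of R k l j i] Acurv_flip[OF assms, of j i k l] by simp
  finally show ?thesis .
qed

text \<open>Splitting the factor with indices \<open>k l\<close> gives two sums, one with these
  indices exchanged; each equals a difference of two terms \<open>Acurv\<close>, so together they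
  give this difference twice.\<close>

lemma Q_curv_eq_Acurv:
  assumes "R \<in> alg_curv"
  shows "Q_curv R $ i $ j $ k $ l = 2 * (Acurv R i j k l - Acurv R i j l k + Acurv R i k j l
    - Acurv R i l j k)"
proof -
  have "(\<Oplus>p q. R $ i $ j $ p $ q * R $ k $ l $ p $ q)
    = (\<Oplus>p q. R $ k $ p $ l $ q * R $ i $ j $ p $ q)
      - (\<Oplus>p q. R $ k $ q $ l $ p * R $ i $ j $ p $ q)"
    unfolding alg_curv_split[OF assms, of k l] by (simp add: algebra_simps sum_subtractf)
  also have "(\<Oplus>p q. R $ k $ q $ l $ p * R $ i $ j $ p $ q)
    = (\<Oplus>p q. R $ l $ p $ k $ q * R $ i $ j $ p $ q)"
    by (intro sum.cong refl arg_cong2[of _ _ _ _ "(*)"] alg_curvD(3)[OF assms])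
  finally show ?thesis
    unfolding Q_curv_def sum_alg_curv_square[OF assms] by (simp add: Acurv_def sum_subtractf)
qed

lemma Q_curv_in_alg_curv:
  assumes "R \<in> alg_curv"
  shows "Q_curv R \<in> alg_curv"
proof (rule alg_curvI)
  fix i j k l
  note F = Acurv_flip[OF assms] and S = Acurv_sym[of R] and Q = Q_curv_eq_Acurv[OF assms]
  show "Q_curv R $ j $ i $ k $ l = - Q_curv R $ i $ j $ k $ l"
    unfolding Q F[of j i k l] F[of j i l k] S[of j k i l] S[of j l i k] by simp
  show "Q_curv R $ i $ j $ l $ k = - Q_curv R $ i $ j $ k $ l"
    unfolding Q by simp
  show "Q_curv R $ k $ l $ i $ j = Q_curv R $ i $ j $ k $ l"
    unfolding Q S[of k l i j] S[of k l j i] F[of j i k l] F[of k i l j] F[of k j l i] S[of j k i l] by simp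
  show "Q_curv R $ i $ j $ k $ l + Q_curv R $ j $ k $ i $ l + Q_curv R $ k $ i $ j $ l = 0"
    unfolding Q S[of j k i l] F[of j k l i] F[of j i k l] S[of j l k i] F[of k i l j] S[of k l i j] by simp
qed

lemma sum_dl [simp]:
  fixes f :: "'n::finite \<Rightarrow> real"
  shows "(\<Oplus>q. f q * dl p q) = f p" "(\<Oplus>q. f q * dl q p) = f p"
    "(\<Oplus>q. dl p q * f q) = f p" "(\<Oplus>q. dl q p * f q) = f p"
  by (simp_all add: if_distrib[of "\<lambda>x. _ * x"] if_distrib[of "\<lambda>x. x * _"] cong: if_cong)

text \<open>Contracting with \<open>id_curv\<close> produces a trace, which is the Ricci tensor,
  minus a term with transposed indices; this governs both the mixed terms and the square of
  \<open>id_curv\<close>.\<close>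

lemma Acurv_add_id_curv:
  fixes S :: "('n::finite) tensor4"
  assumes "S \<in> alg_curv" "\<And>i k. (\<Oplus>j. S $ i $ j $ k $ j) = \<mu> * dl i k"
  shows "Acurv (S + \<kappa> *\<^sub>R id_curv) i j k l = Acurv S i j k l + \<kappa> * (2 * \<mu> * dl i j * dl k l
    - 2 * S $ i $ l $ j $ k)
    + \<kappa>\<^sup>2 * ((real CARD('n) - 2) * dl i j * dl k l + dl i k * dl j l)"
proof -
  define T where "T i p j q = S $ i $ p $ j $ q" for i p j q
  define e where "e i p j q = dl i j * dl p q - dl i q * dl p j" for i p j q :: 'n
  have 1: "(\<Oplus>p q. T i p j q * e k p l q) = \<mu> * dl i j * dl k l - S $ i $ l $ j $ k" for i j k l
  proof -
    have "(\<Oplus>p q. T i p j q * e k p l q)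
      = (\<Oplus>p. dl k l * (\<Oplus>q. T i p j q * dl p q) - (\<Oplus>q. T i p j q * dl k q) * dl p l)"
      by (simp only: e_def right_diff_distrib sum_subtractf sum_distrib_left sum_distrib_right mult_ac)
    also have "\<dots> = dl k l * (\<Oplus>p. T i p j p) - T i l j k"
      by (simp only: sum_dl sum_subtractf sum_distrib_left)
    finally show ?thesis using assms(2)[of i j] by (simp add: T_def)
  qed
  \<comment> \<open>The trace of \<open>e\<close> contributes n - 1, and the transposed term takes
    away one more, hence n - 2.\<close>
  have 2: "(\<Oplus>p q. e i p j q * e k p l q) = (real CARD('n) - 2) * dl i j * dl k l + dl i k * dl j l"
    for i j k l
  proof -
    have "(\<Oplus>p q. e i p j q * e k p l q)
      = (\<Oplus>p. dl k l * (\<Oplus>q. e i p j q * dl p q) - (\<Oplus>q. e i p j q * dl k q) * dl p l)"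
      by (simp only: e_def[of k] right_diff_distrib sum_subtractf sum_distrib_left sum_distrib_right
        mult_ac)
    also have "\<dots> = dl k l * (\<Oplus>p. e i p j p) - e i l j k"
      by (simp only: sum_dl sum_subtractf sum_distrib_left)
    also have "(\<Oplus>p. e i p j p) = (real CARD('n) - 1) * dl i j"
      by (simp add: e_def sum_subtractf)
    finally have "(\<Oplus>p q. e i p j q * e k p l q) = dl k l * ((real CARD('n) - 1) * dl i j) - e i l j k" .
    moreover have "e i l j k = dl i j * dl k l - dl i k * dl j l" by (auto simp: e_def)
    ultimately show ?thesis by (simp only: algebra_simps)
  qed
  have "Acurv (S + \<kappa> *\<^sub>R id_curv) i j k l = (\<Oplus>p q. T i p j q * T k p l q
      + \<kappa> * (T i p j q * e k p l q) + \<kappa> * (T k p l q * e i p j q) + \<kappa>\<^sup>2 * (e i p j q * e k p l q))"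
    unfolding Acurv_def by (intro sum.cong refl) (simp add:
      T_def e_def id_curv_nth power2_eq_square algebra_simps)
  also have "\<dots> = Acurv S i j k l + \<kappa> * (\<mu> * dl i j * dl k l - S $ i $ l $ j $ k)
      + \<kappa> * (\<mu> * dl k l * dl i j - S $ k $ j $ l $ i)
      + \<kappa>\<^sup>2 * ((real CARD('n) - 2) * dl i j * dl k l + dl i k * dl j l)"
    unfolding sum.distrib sum_distrib_left[symmetric] 1 2 by (simp only: T_def Acurv_def)
  also have "S $ k $ j $ l $ i = S $ i $ l $ j $ k"
    using alg_curvD(3)[OF assms(1), of k j l i] alg_curvD(1)[OF assms(1), of l i k j]
      alg_curvD(2)[OF assms(1), of i l k j]
    by simp
  finally show ?thesis by (simp only: algebra_simps)
qed

text \<open>The terms linear in the components of \<open>S\<close> cancel in pairs by skew-symmetry,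
  so only multiples of \<open>id_curv\<close> remain besides \<open>Q_curv S\<close>. In the square,
  n - 2 becomes n - 1 because the term \<open>dl i k * dl j l\<close> adds another copy.\<close>

lemma Q_curv_add_id_curv:
  fixes S :: "('n::finite) tensor4"
  assumes S: "S \<in> alg_curv" and ric: "\<And>i k. (\<Oplus>j. S $ i $ j $ k $ j) = \<mu> * dl i k"
  shows "Q_curv (S + \<kappa> *\<^sub>R id_curv) = Q_curv S + (4 * \<kappa> * \<mu> + 2 * (real CARD('n) - 1) * \<kappa>\<^sup>2) *\<^sub>R id_curv"
proof -
  have R: "S + \<kappa> *\<^sub>R id_curv \<in> alg_curv"
    using S id_curv_in_alg_curv subspace_alg_curv by (metis subspace_add subspace_scale)
  have e: "S $ i $ l $ j $ k = - S $ i $ l $ k $ j" "dl k l = dl l k" for i j k l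
    using alg_curvD(2)[OF S, of i l j k] by auto
  have "Q_curv (S + \<kappa> *\<^sub>R id_curv) $ i $ j $ k $ l
     = (Q_curv S + (4 * \<kappa> * \<mu> + 2 * (real CARD('n) - 1) * \<kappa>\<^sup>2) *\<^sub>R id_curv) $ i $ j $ k $ l" for i j k l
    unfolding vector_add_component vector_scaleR_component Q_curv_eq_Acurv[OF R] Q_curv_eq_Acurv[OF S]
      Acurv_add_id_curv[OF S ric] id_curv_nth e(1)[of i l j k] e(1)[of i k j l] e(2)[of k l] real_scaleR_def
    by (simp only: algebra_simps power2_eq_square)
  then show ?thesis by (simp add: vec_eq_iff)
qed

text \<open>\<open>D a b i j k l\<close> plays the role of \<open>(\<nabla>\<^sub>a \<nabla>\<^sub>b R)\<^sub>i\<^sub>j\<^sub>k\<^sub>l\<close> in an orthonormal basis.\<close>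

lemma laplacian_einstein:
  fixes R :: "('n::finite) tensor4"
  assumes R: "R \<in> alg_curv"
    and bianchi: "\<And>a m i j k l. D a m i j k l + D a k i j l m + D a l i j m k = 0"
    and commute: "\<And>a b i j k l. D a b i j k l - D b a i j k l = - (\<Sum>e\<in>UNIV.
        R $ e $ i $ a $ b * R $ e $ j $ k $ l + R $ e $ j $ a $ b * R $ i $ e $ k $ l
      + R $ e $ k $ a $ b * R $ i $ j $ e $ l + R $ e $ l $ a $ b * R $ i $ j $ k $ e)"
    and div: "\<And>a i j k. (\<Oplus>c. D a c c i j k) = 0"
    and sym: "\<And>a b i j k l. D a b k l i j = D a b i j k l" "\<And>a b i j k l. D a b j i k l = - D a b i j k l"
    and ric: "\<And>i k. (\<Oplus>j. R $ i $ j $ k $ j) = \<rho> * dl i k"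
  shows "(\<Oplus>c. D c c i j k l) = 2 * \<rho> * R $ i $ j $ k $ l - Q_curv R $ i $ j $ k $ l"
proof -
  define W where "W a b i j k l = (\<Sum>e\<in>UNIV.
        R $ e $ i $ a $ b * R $ e $ j $ k $ l + R $ e $ j $ a $ b * R $ i $ e $ k $ l
      + R $ e $ k $ a $ b * R $ i $ j $ e $ l + R $ e $ l $ a $ b * R $ i $ j $ k $ e)" for a b i j k l
  have DW: "D a b i j k l = D b a i j k l - W a b i j k l" for a b i j k l
    using commute[of a b i j k l] by (simp add: W_def)
  \<comment> \<open>The second Bianchi identity moves one derivative index \<open>c\<close> into the
    tensor. Commuting the two derivatives then produces divergences, which vanish, and the curvature
    terms \<open>W\<close>.\<close>
  have "(\<Oplus>c. D c c i j k l) = (\<Oplus>c. W c k i j l c + W c l i j c k + D k c c l i j - D l c c k i j)"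
  proof (rule sum.cong[OF refl])
    fix c
    show "D c c i j k l = W c k i j l c + W c l i j c k + D k c c l i j - D l c c k i j"
      using bianchi[of c c i j k l]
      unfolding DW[of c k i j l c] DW[of c l i j c k] sym(1)[of k c l c i j, symmetric]
        sym(1)[of l c c k i j, symmetric]
        sym(2)[of k c l c i j] by simp
  qed
  also have "\<dots> = (\<Oplus>c. W c k i j l c) + (\<Oplus>c. W c l i j c k)"
    by (simp add: sum.distrib sum_subtractf div)
  finally have lap: "(\<Oplus>c. D c c i j k l) = (\<Oplus>c. W c k i j l c) + (\<Oplus>c. W c l i j c k)" .
  note a1 = alg_curvD(1)[OF R] and a2 = alg_curvD(2)[OF R] and a3 = alg_curvD(3)[OF R]
  have t1: "(\<Oplus>c e. R $ e $ i $ c $ k * R $ e $ j $ l $ c) = - Acurv R i k j l" for i j k l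
  proof -
    have "R $ e $ i $ c $ k * R $ e $ j $ l $ c = - (R $ i $ e $ k $ c * R $ j $ e $ l $ c)" for e c
      using a1[of e i c k] a2[of i e c k] a1[of e j l c] by simp
    then show ?thesis by (subst sum.swap) (simp add: Acurv_def sum_negf)
  qed
  have t1': "(\<Oplus>c e. R $ e $ i $ c $ k * R $ e $ j $ c $ l) = Acurv R i k j l" for i j k l
  proof -
    have "R $ e $ i $ c $ k * R $ e $ j $ c $ l = - (R $ e $ i $ c $ k * R $ e $ j $ l $ c)" for e c
      using a2[of e j c l] by simp
    then show ?thesis using t1[where i=i and j=j and k=k and l=l] by (simp add: sum_negf)
  qed
  have t2: "(\<Oplus>c e. R $ e $ j $ c $ k * R $ i $ e $ l $ c) = Acurv R j k i l" for i j k l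
  proof -
    have "R $ e $ j $ c $ k * R $ i $ e $ l $ c = - (R $ e $ j $ c $ k * R $ e $ i $ l $ c)" for e c
      using a1[of i e l c] by simp
    then show ?thesis using t1[where i=j and j=i and k=k and l=l] by (simp add: sum_negf)
  qed
  have t2': "(\<Oplus>c e. R $ e $ j $ c $ k * R $ i $ e $ c $ l) = - Acurv R j k i l" for i j k l
  proof -
    have "R $ e $ j $ c $ k * R $ i $ e $ c $ l = - (R $ e $ j $ c $ k * R $ i $ e $ l $ c)" for e c
      using a2[of i e c l] by simp
    then show ?thesis using t2[where i=i and j=j and k=k and l=l] by (simp add: sum_negf)
  qed
  have t3: "(\<Oplus>c e. R $ e $ l $ c $ k * R $ i $ j $ e $ c) = Acurv R i j l k - Acurv R i j k l" for i j k l
  proof -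
    have "R $ e $ l $ c $ k = R $ l $ e $ k $ c" for e c
      using a1[of e l c k] a2[of l e c k] by simp
    then show ?thesis using sum_alg_curv_square[OF R, of l k i j] by (subst sum.swap) simp
  qed
  have t3': "(\<Oplus>c e. R $ e $ l $ c $ k * R $ i $ j $ c $ e) = - (Acurv R i j l k - Acurv R i j k l)"
    for i j k l
  proof -
    have "R $ e $ l $ c $ k * R $ i $ j $ c $ e = - (R $ e $ l $ c $ k * R $ i $ j $ e $ c)" for e c
      using a2[of i j c e] by simp
    then show ?thesis using t3[where i=i and j=j and k=k and l=l] by (simp add: sum_negf)
  qed
  have r: "(\<Oplus>c. R $ e $ c $ c $ k) = - \<rho> * dl e k" for e k
  proof -
    have "R $ e $ c $ c $ k = - R $ e $ c $ k $ c" for c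
      using a2[of e c c k] by simp
    then show ?thesis using ric[of e k] by (simp add: sum_negf)
  qed
  \<comment> \<open>The Ricci tensor appears here, and the Einstein condition turns its contraction
    into multiplication by -\<rho>.\<close>
  have t4: "(\<Oplus>c e. R $ e $ c $ c $ k * f e) = - \<rho> * f k" for k f
  proof -
    have "(\<Oplus>c e. R $ e $ c $ c $ k * f e) = (\<Oplus>e. (- \<rho> * dl e k) * f e)"
      by (subst sum.swap) (simp only: r flip: sum_distrib_right)
    also have "\<dots> = - \<rho> * (\<Oplus>e. dl e k * f e)"
      by (simp only: sum_distrib_left mult.assoc)
    finally show ?thesis by simp
  qed
  \<comment> \<open>Each of the two halves contributes \<rho> times the curvature, after exchanging
    \<open>l\<close> and \<open>k\<close>; this is the origin of the factor 2 \<rho>.\<close>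
  have w1: "(\<Oplus>c. W c k i j l c) = - Acurv R i k j l + Acurv R j k i l + (Acurv R i j l k
    - Acurv R i j k l) - \<rho> * R $ i $ j $ l $ k"
    unfolding W_def by (simp add: sum.distrib t1 t2 t3 t4)
  have w2: "(\<Oplus>c. W c l i j c k) = Acurv R i l j k - Acurv R j l i k - (Acurv R i j k l
    - Acurv R i j l k) - \<rho> * R $ i $ j $ l $ k"
    unfolding W_def by (simp add: sum.distrib t1' t2' t3' t4)
  show ?thesis unfolding lap w1 w2 Q_curv_eq_Acurv[OF R] a2[of i j l k]
    using Acurv_sym[of R j k i l] Acurv_sym[of R j l i k] by (simp add: algebra_simps)
qed

section \<open>Components of a tensor in another basis\<close>

lemma linear_tensor4_apply:
  "linear (\<lambda>u. tensor4_apply R u v w z)" "linear (\<lambda>v. tensor4_apply R u v w z)"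
  "linear (\<lambda>w. tensor4_apply R u v w z)" "linear (\<lambda>z. tensor4_apply R u v w z)"
  "linear (\<lambda>R. tensor4_apply R u v w z)"
  by (rule linearI; simp add: tensor4_apply_def algebra_simps sum.distrib sum_distrib_left)+

lemma change_frame_nth: "change_frame E R $ i $ j $ k $ l = tensor4_apply R (E $ i) (E $ j) (E $ k) (E $ l)"
  by (simp add: change_frame_def)

lemma linear_change_frame: "linear (change_frame E)"
  by (intro linearI) (simp_all add: vec_eq_iff change_frame_nth linear_add[OF linear_tensor4_apply(5)]
    linear_cmul[OF linear_tensor4_apply(5)])

lemma change_frame_mat_1: "change_frame (mat 1) R = R"
proof -
  have "tensor4_apply R (mat 1 $ i) (mat 1 $ j) (mat 1 $ k) (mat 1 $ l) = R $ i $ j $ k $ l" for i j k l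
  proof -
    have "tensor4_apply R (mat 1 $ i) (mat 1 $ j) (mat 1 $ k) (mat 1 $ l)
      = (\<Oplus>a b c. (\<Oplus>d. R $ a $ b $ c $ d * dl l d) * dl k c * dl j b * dl i a)"
      unfolding tensor4_apply_def mat_def by (simp only:
        vec_lambda_beta sum_distrib_left sum_distrib_right mult_ac)
    also have "\<dots> = (\<Oplus>a. (\<Oplus>b. (\<Oplus>c. R $ a $ b $ c $ l * dl k c) * dl j b) * dl i a)"
      by (simp only: sum_dl flip: sum_distrib_right)
    also have "\<dots> = R $ i $ j $ k $ l" by (simp only: sum_dl)
    finally show ?thesis .
  qed
  then show ?thesis by (simp add: vec_eq_iff change_frame_nth)
qed

lemma change_frame_mult: "change_frame (E ** F) R = change_frame E (change_frame F R)"
proof -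
  have row: "(E ** F) $ i = (\<Oplus>a. E $ i $ a *\<^sub>R F $ a)" for i
    by (simp add: vec_eq_iff matrix_matrix_mult_def)
  have 1: "tensor4_apply R (\<Oplus>a. c a *\<^sub>R f a) v w z = (\<Oplus>a. c a * tensor4_apply R (f a) v w z)"
    for c and f :: "'a \<Rightarrow> _" and v w z
    by (simp add: linear_sum[OF linear_tensor4_apply(1)] linear_cmul[OF linear_tensor4_apply(1)])
  have 2: "tensor4_apply R v (\<Oplus>a. c a *\<^sub>R f a) w z = (\<Oplus>a. c a * tensor4_apply R v (f a) w z)"
    for c and f :: "'a \<Rightarrow> _" and v w z
    by (simp add: linear_sum[OF linear_tensor4_apply(2)] linear_cmul[OF linear_tensor4_apply(2)])
  have 3: "tensor4_apply R v w (\<Oplus>a. c a *\<^sub>R f a) z = (\<Oplus>a. c a * tensor4_apply R v w (f a) z)"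
    for c and f :: "'a \<Rightarrow> _" and v w z
    by (simp add: linear_sum[OF linear_tensor4_apply(3)] linear_cmul[OF linear_tensor4_apply(3)])
  have 4: "tensor4_apply R v w z (\<Oplus>a. c a *\<^sub>R f a) = (\<Oplus>a. c a * tensor4_apply R v w z (f a))"
    for c and f :: "'a \<Rightarrow> _" and v w z
    by (simp add: linear_sum[OF linear_tensor4_apply(4)] linear_cmul[OF linear_tensor4_apply(4)])
  have "tensor4_apply R ((E ** F) $ i) ((E ** F) $ j) ((E ** F) $ k) ((E ** F) $ l)
    = tensor4_apply (change_frame F R) (E $ i) (E $ j) (E $ k) (E $ l)" for i j k l
    unfolding row unfolding 1 unfolding 2 unfolding 3 unfolding 4
      unfolding sum_distrib_left tensor4_apply_def[of "change_frame F R"] change_frame_nth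
    by (intro sum.cong refl) simp
  then show ?thesis by (simp add: vec_eq_iff change_frame_nth)
qed

lemma tensor4_apply_id_curv: "tensor4_apply id_curv u v w z = (u \<bullet> w) * (v \<bullet> z) - (u \<bullet> z) * (v \<bullet> w)"
proof -
  have "tensor4_apply id_curv u v w z = (\<Oplus>a b c d. 
     (u $ a * v $ b * (w $ c * dl a c)) * (z $ d * dl b d)
       - (u $ a * v $ b * (w $ c * dl b c)) * (z $ d * dl a d))"
    unfolding tensor4_apply_def id_curv_nth by (intro sum.cong refl) (simp only: algebra_simps)
  also have "\<dots> = (\<Oplus>a b. (u $ a * v $ b * w $ a) * z $ b - (u $ a * v $ b * w $ b) * z $ a)"
    by (simp only: sum_subtractf sum_dl flip: sum_distrib_left sum_distrib_right)
  also have "\<dots> = (\<Oplus>a b. (u $ a * w $ a) * (v $ b * z $ b) - (u $ a * z $ a) * (v $ b * w $ b))"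
    by (simp only: mult_ac)
  finally show ?thesis by (simp add: inner_vec_def sum_subtractf sum_product)
qed

lemma change_frame_id_curv:
  assumes "orthogonal_matrix E"
  shows "change_frame E id_curv = id_curv"
proof -
  have "E ** transpose E = mat 1" using assms by (simp add: orthogonal_matrix_def)
  then have "E $ i \<bullet> E $ j = dl i j" for i j
    by (simp add: vec_eq_iff matrix_matrix_mult_def transpose_def mat_def inner_vec_def)
  then show ?thesis by (simp add: vec_eq_iff change_frame_nth tensor4_apply_id_curv id_curv_nth)
qed

text \<open>The identities survive multilinear substitution by any matrix. Besides orthogonal ones,
  the matrix may be a Jacobian or the inverse of a frame.\<close>

lemma change_frame_alg_curv:
  assumes R: "R \<in> alg_curv"
  shows "change_frame E R \<in> alg_curv"
proof (rule alg_curvI)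
  fix i j k l
  let ?u = "\<lambda>x. E $ i $ x" and ?v = "\<lambda>x. E $ j $ x" and ?w = "\<lambda>x. E $ k $ x" and ?z = "\<lambda>x. E $ l $ x"
  let ?S = "\<lambda>r. \<Oplus>a b c d. r a b c d * ?u a * ?v b * ?w c * ?z d"
  have neg: "?S (\<lambda>a b c d. - r a b c d) = - ?S r" for r by (simp add: sum_negf)
  have "change_frame E R $ j $ i $ k $ l = ?S (\<lambda>a b c d. R $ b $ a $ c $ d)"
    unfolding change_frame_nth tensor4_apply_def
    by (rule trans[OF sum.swap]) (simp only: mult_ac)
  also have "\<dots> = - change_frame E R $ i $ j $ k $ l"
    unfolding change_frame_nth tensor4_apply_def neg[symmetric]
    by (intro sum.cong refl arg_cong2[of _ _ _ _ "(*)"] alg_curvD(1)[OF R])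
  finally show "change_frame E R $ j $ i $ k $ l = - change_frame E R $ i $ j $ k $ l" .
  have "change_frame E R $ i $ j $ l $ k = ?S (\<lambda>a b c d. R $ a $ b $ d $ c)"
    unfolding change_frame_nth tensor4_apply_def
    by (rule sum.cong[OF refl], rule sum.cong[OF refl], rule trans[OF sum.swap]) (simp only: mult_ac)
  also have "\<dots> = - change_frame E R $ i $ j $ k $ l"
    unfolding change_frame_nth tensor4_apply_def neg[symmetric]
    by (intro sum.cong refl arg_cong2[of _ _ _ _ "(*)"] alg_curvD(2)[OF R])
  finally show "change_frame E R $ i $ j $ l $ k = - change_frame E R $ i $ j $ k $ l" .
  have "change_frame E R $ k $ l $ i $ j = ?S (\<lambda>a b c d. R $ c $ d $ a $ b)"
    unfolding change_frame_nth tensor4_apply_def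
    by (rule trans[OF sum4_pull], rule trans[OF sum4_pull]) (simp only: mult_ac)
  also have "\<dots> = change_frame E R $ i $ j $ k $ l"
    unfolding change_frame_nth tensor4_apply_def
    by (intro sum.cong refl arg_cong2[of _ _ _ _ "(*)"] alg_curvD(3)[OF R])
  finally show "change_frame E R $ k $ l $ i $ j = change_frame E R $ i $ j $ k $ l" .
  have 1: "change_frame E R $ j $ k $ i $ l = ?S (\<lambda>a b c d. R $ b $ c $ a $ d)"
    unfolding change_frame_nth tensor4_apply_def
    by (rule trans[OF sum3_pull]) (simp only: mult_ac)
  have 2: "change_frame E R $ k $ i $ j $ l = ?S (\<lambda>a b c d. R $ c $ a $ b $ d)"
    unfolding change_frame_nth tensor4_apply_def
    by (rule trans[OF sum3_pull[symmetric]]) (simp only: mult_ac)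
  have "change_frame E R $ i $ j $ k $ l + change_frame E R $ j $ k $ i $ l
    + change_frame E R $ k $ i $ j $ l
    = ?S (\<lambda>a b c d. R $ a $ b $ c $ d + R $ b $ c $ a $ d + R $ c $ a $ b $ d)"
    unfolding 1 2 unfolding change_frame_nth tensor4_apply_def
    by (simp only: sum.distrib distrib_right)
  then show "change_frame E R $ i $ j $ k $ l + change_frame E R $ j $ k $ i $ l
    + change_frame E R $ k $ i $ j $ l = 0"
    by (simp add: alg_curvD(4)[OF R])
qed

lemma tendsto_change_frame:
  assumes "(E \<longlongrightarrow> E0) F" "(R \<longlongrightarrow> R0) F"
  shows "((\<lambda>x. change_frame (E x) (R x)) \<longlongrightarrow> change_frame E0 R0) F"
  unfolding change_frame_def tensor4_apply_def
  by (intro tendsto_vec_lambda tendsto_sum tendsto_mult tendsto_vec_nth assms)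

section \<open>Local solutions of quadratic differential equations\<close>

context
  fixes B :: "'a::euclidean_space \<Rightarrow> 'a \<Rightarrow> 'a" and x0 :: 'a
begin

text \<open>Coefficients of the power series solution, from comparing coefficients in x' = B(x, x).
  The guard \<open>i \<le> n\<close>, always true in the sum, hands the termination proof the bound
  on the index.\<close>

function ode_coeff :: "nat \<Rightarrow> 'a" where
  "ode_coeff 0 = x0"
| "ode_coeff (Suc n) = (\<Sum>i\<in>{..n}. if i \<le> n then B (ode_coeff i) (ode_coeff (n - i)) else 0) /\<^sub>R real (Suc n)"
  by pat_completeness auto
termination by (relation "Wellfounded.measure id") auto

lemma ode_coeff_Suc: "ode_coeff (Suc n) = (\<Sum>i\<le>n. B (ode_coeff i) (ode_coeff (n - i))) /\<^sub>R real (Suc n)"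
  by (subst ode_coeff.simps(2)) (intro arg_cong2[of _ _ _ _ scaleR] refl sum.cong; simp)

declare ode_coeff.simps(2) [simp del]

text \<open>Each of the \<open>m + 1\<close> summands is bounded by r (K r)^(m + 1), and the
  recursion divides by \<open>m + 1\<close>.\<close>

lemma norm_ode_coeff_le:
  assumes K: "\<And>a b. norm (B a b) \<le> norm a * norm b * K" "K > 0" and r: "norm x0 \<le> r"
  shows "norm (ode_coeff n) \<le> r * (K * r) ^ n"
proof (induction n rule: less_induct)
  case (less n)
  have r0: "r \<ge> 0" using r norm_ge_zero order_trans by blast
  show ?case
  proof (cases n)
    case (Suc m)
    have "norm (B (ode_coeff i) (ode_coeff (m - i))) \<le> r * (K * r) ^ Suc m" if "i \<in> {..m}" for i
    proof -
      have "norm (B (ode_coeff i) (ode_coeff (m - i))) \<le> norm (ode_coeff i) * norm (ode_coeff (m - i)) * K"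
        by (rule K)
      also have "\<dots> \<le> (r * (K * r) ^ i) * (r * (K * r) ^ (m - i)) * K"
        using less[of i] less[of "m - i"] that Suc K(2) r0 by (intro mult_mono) auto
      also have "\<dots> = r * (K * r) * ((K * r) ^ i * (K * r) ^ (m - i))" by (simp only: mult_ac)
      also have "(K * r) ^ i * (K * r) ^ (m - i) = (K * r) ^ m"
        using that by (simp flip: power_add)
      finally show ?thesis by (simp add: mult_ac)
    qed
    then have "norm (\<Sum>i\<le>m. B (ode_coeff i) (ode_coeff (m - i))) \<le> (\<Sum>i\<le>m. r * (K * r) ^ Suc m)"
      by (rule sum_norm_le)
    then show ?thesis unfolding Suc ode_coeff_Suc
      by (simp add: divide_simps mult_ac del: of_nat_Suc power_Suc)
  qed (use r in auto)
qed

text \<open>Only the symmetric part of \<open>B\<close> is known to preserve \<open>V\<close>.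
  Pairing the index \<open>i\<close> with \<open>m - i\<close> symmetrizes the sum in the
  recursion.\<close>

lemma ode_coeff_in_subspace:
  assumes V: "subspace V" "x0 \<in> V" and B: "\<And>a b. a \<in> V \<Longrightarrow> b \<in> V \<Longrightarrow> B a b + B b a \<in> V"
  shows "ode_coeff n \<in> V"
proof (induction n rule: less_induct)
  case (less n)
  show ?case
  proof (cases n)
    case (Suc m)
    have "(\<Sum>i\<le>m. B (ode_coeff i) (ode_coeff (m - i))) = (\<Sum>i\<le>m. B (ode_coeff (m - i)) (ode_coeff i))"
      by (rule sum.reindex_bij_witness[where i="\<lambda>i. m - i" and j="\<lambda>i. m - i"]) auto
    then have "2 *\<^sub>R (\<Sum>i\<le>m. B (ode_coeff i) (ode_coeff (m - i)))
      = (\<Sum>i\<le>m. B (ode_coeff i) (ode_coeff (m - i)) + B (ode_coeff (m - i)) (ode_coeff i))"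
      by (simp add: sum.distrib scaleR_2)
    also have "\<dots> \<in> V"
      using less Suc by (intro subspace_sum[OF V(1)] B) auto
    finally have "(1 / 2) *\<^sub>R 2 *\<^sub>R (\<Sum>i\<le>m. B (ode_coeff i) (ode_coeff (m - i))) \<in> V"
      by (rule subspace_scale[OF V(1)])
    then show ?thesis unfolding Suc ode_coeff_Suc by (intro subspace_scale[OF V(1)]) simp
  qed (use V in auto)
qed

text \<open>One real power series per component, so that termwise differentiation and Cauchy
  products of real series apply.\<close>

definition ode_comp :: "'a \<Rightarrow> real \<Rightarrow> real" where
  "ode_comp b t = (\<Sum>n. (ode_coeff n \<bullet> b) * t ^ n)"

definition ode_sol :: "real \<Rightarrow> 'a" where
  "ode_sol t = (\<Sum>b\<in>Basis. ode_comp b t *\<^sub>R b)"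

lemma ode_sol_0: "ode_sol 0 = x0"
proof -
  have "ode_comp b 0 = x0 \<bullet> b" for b
    unfolding ode_comp_def by (subst suminf_finite[of "{0}"]) auto
  then show ?thesis by (simp add: ode_sol_def euclidean_representation)
qed

context
  fixes K r T :: real
  assumes B: "bounded_bilinear B"
    and K: "\<And>a b. norm (B a b) \<le> norm a * norm b * K" "K > 0"
    and r: "norm x0 \<le> r" "r > 0" and T: "T = 1 / (2 * K * r)"
begin

lemma T_pos: "T > 0" using T K r by simp

text \<open>With T = 1 / (2 K r) the terms are dominated by r / 2^n on the closed interval;
  convergence at T itself is used for differentiating inside.\<close>

lemma summable_ode_coeff:
  assumes t: "\<bar>t\<bar> \<le> T" and b: "b \<in> Basis"
  shows "summable (\<lambda>n. norm ((ode_coeff n \<bullet> b) * t ^ n))"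
proof (rule summable_comparison_test')
  show "summable (\<lambda>n. r * (1 / 2 :: real) ^ n)"
    by (intro summable_mult summable_geometric) simp
  fix n :: nat
  have "\<bar>ode_coeff n \<bullet> b\<bar> \<le> r * (K * r) ^ n"
    using norm_ode_coeff_le[OF K r(1), of n] Basis_le_norm[OF b, of "ode_coeff n"] by linarith
  moreover have "\<bar>t\<bar> ^ n \<le> T ^ n" using t by (intro power_mono) auto
  ultimately have "\<bar>ode_coeff n \<bullet> b\<bar> * \<bar>t\<bar> ^ n \<le> (r * (K * r) ^ n) * T ^ n"
    using K r by (intro mult_mono) auto
  also have "\<dots> = r * (K * r * T) ^ n" by (simp add: power_mult_distrib)
  also have "K * r * T = 1 / 2" using T K r by simp
  finally show "norm (norm ((ode_coeff n \<bullet> b) * t ^ n)) \<le> r * (1 / 2) ^ n"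
    by (simp add: abs_mult power_abs)
qed

lemma ode_comp_sums:
  assumes "\<bar>t\<bar> \<le> T" "b \<in> Basis"
  shows "(\<lambda>n. (ode_coeff n \<bullet> b) * t ^ n) sums ode_comp b t"
  unfolding ode_comp_def using summable_norm_cancel[OF summable_ode_coeff[OF assms]] by (rule summable_sums)

lemma ode_sol_sums:
  assumes "\<bar>t\<bar> \<le> T"
  shows "(\<lambda>n. t ^ n *\<^sub>R ode_coeff n) sums ode_sol t"
proof -
  have "(\<lambda>n. \<Sum>b\<in>Basis. ((ode_coeff n \<bullet> b) * t ^ n) *\<^sub>R b) sums ode_sol t"
    unfolding ode_sol_def by (intro sums_sum sums_scaleR_left ode_comp_sums assms)
  moreover have "(\<Sum>b\<in>Basis. ((ode_coeff n \<bullet> b) * t ^ n) *\<^sub>R b) = t ^ n *\<^sub>R ode_coeff n" for n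
    using euclidean_representation[of "t ^ n *\<^sub>R ode_coeff n"] by (simp add: mult.commute)
  ultimately show ?thesis by simp
qed

lemma ode_sol_in_subspace:
  assumes "\<bar>t\<bar> \<le> T" "subspace V" "x0 \<in> V" "\<And>a b. a \<in> V \<Longrightarrow> b \<in> V \<Longrightarrow> B a b + B b a \<in> V"
  shows "ode_sol t \<in> V"
proof (rule closed_sequentially[OF closed_subspace[OF assms(2)]])
  show "(\<lambda>N. \<Sum>n<N. t ^ n *\<^sub>R ode_coeff n) \<longlonglongrightarrow> ode_sol t"
    using ode_sol_sums[OF assms(1)] by (simp add: sums_def)
  show "(\<Sum>n<N. t ^ n *\<^sub>R ode_coeff n) \<in> V" for N
    using assms ode_coeff_in_subspace by (intro subspace_sum subspace_scale) auto
qed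

text \<open>The Cauchy product of the series with itself; expanding \<open>B\<close> in a basis
  reduces it to products of scalar series.\<close>

lemma B_ode_sol_sums:
  assumes t: "\<bar>t\<bar> \<le> T"
  shows "(\<lambda>n. t ^ n *\<^sub>R (\<Sum>i\<le>n. B (ode_coeff i) (ode_coeff (n - i)))) sums B (ode_sol t) (ode_sol t)"
proof -
  interpret bounded_bilinear B by (rule B)
  have exp: "B x y = (\<Sum>b\<in>Basis. \<Sum>c\<in>Basis. ((x \<bullet> b) * (y \<bullet> c)) *\<^sub>R B b c)" for x y
  proof -
    have "B x y = B (\<Sum>b\<in>Basis. (x \<bullet> b) *\<^sub>R b) (\<Sum>c\<in>Basis. (y \<bullet> c) *\<^sub>R c)"
      by (simp add: euclidean_representation)
    also have "\<dots> = (\<Sum>c\<in>Basis. \<Sum>b\<in>Basis. ((x \<bullet> b) * (y \<bullet> c)) *\<^sub>R B b c)"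
      by (simp add: sum_left sum_right scaleR_left scaleR_right scaleR_sum_right mult.commute)
    finally show ?thesis by (subst sum.swap)
  qed
  have comp: "ode_sol t \<bullet> b = ode_comp b t" if "b \<in> Basis" for b
    unfolding ode_sol_def using that by (rule inner_sum_left_Basis)
  define q where "q n b c = (\<Sum>i\<le>n. (ode_coeff i \<bullet> b) * (ode_coeff (n - i) \<bullet> c))" for n b c
  have prod: "(\<lambda>n. t ^ n * q n b c) sums (ode_comp b t * ode_comp c t)" if "b \<in> Basis" "c \<in>
    Basis" for b c
  proof -
    have "(\<Sum>i\<le>n. (ode_coeff i \<bullet> b) * t ^ i * ((ode_coeff (n - i) \<bullet> c) * t ^ (n - i)))
      = t ^ n * q n b c" for n
      unfolding q_def sum_distrib_left
    proof (rule sum.cong[OF refl])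
      fix i assume "i \<in> {..n}"
      then have "t ^ n = t ^ i * t ^ (n - i)" by (simp flip: power_add)
      then show "(ode_coeff i \<bullet> b) * t ^ i * ((ode_coeff (n - i) \<bullet> c) * t ^ (n - i))
        = t ^ n * ((ode_coeff i \<bullet> b) * (ode_coeff (n - i) \<bullet> c))" by (simp add: mult_ac)
    qed
    with Cauchy_product_sums[OF summable_ode_coeff[OF t that(1)] summable_ode_coeff[OF t that(2)]]
    show ?thesis unfolding ode_comp_def by simp
  qed
  have "(\<lambda>n. \<Sum>b\<in>Basis. \<Sum>c\<in>Basis. (t ^ n * q n b c) *\<^sub>R B b c)
    sums (\<Sum>b\<in>Basis. \<Sum>c\<in>Basis. (ode_comp b t * ode_comp c t) *\<^sub>R B b c)"
    by (intro sums_sum sums_scaleR_left prod)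
  also have "(\<Sum>b\<in>Basis. \<Sum>c\<in>Basis. (ode_comp b t * ode_comp c t) *\<^sub>R B b c) = B (ode_sol
    t) (ode_sol t)"
    unfolding exp[of "ode_sol t"] by (simp add: comp cong: sum.cong)
  also have "(\<lambda>n. \<Sum>b\<in>Basis. \<Sum>c\<in>Basis. (t ^ n * q n b c) *\<^sub>R B b c)
    = (\<lambda>n. t ^ n *\<^sub>R (\<Sum>i\<le>n. B (ode_coeff i) (ode_coeff (n - i))))"
  proof (rule ext)
    fix n
    have "(\<Sum>i\<le>n. B (ode_coeff i) (ode_coeff (n - i))) = (\<Sum>b\<in>Basis. \<Sum>c\<in>Basis. q n b c
      *\<^sub>R B b c)"
      unfolding exp[of "ode_coeff _"] q_def scaleR_sum_left
      by (rule trans[OF sum.swap sum.cong[OF refl sum.swap]])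
    then show "(\<Sum>b\<in>Basis. \<Sum>c\<in>Basis. (t ^ n * q n b c) *\<^sub>R B b c)
      = t ^ n *\<^sub>R (\<Sum>i\<le>n. B (ode_coeff i) (ode_coeff (n - i)))"
      by (simp add: scaleR_sum_right)
  qed
  finally show ?thesis .
qed

lemma ode_sol_has_derivative:
  assumes t: "\<bar>t\<bar> < T"
  shows "(ode_sol has_vector_derivative B (ode_sol t) (ode_sol t)) (at t)"
proof -
  have "(ode_comp b has_real_derivative B (ode_sol t) (ode_sol t) \<bullet> b) (at t)" if b: "b \<in> Basis" for b
  proof -
    have "((\<lambda>t. \<Sum>n. (ode_coeff n \<bullet> b) * t ^ n) has_real_derivative (\<Sum>n. diffs (\<lambda>n. ode_coeff n
      \<bullet> b) n * t ^ n)) (at t)"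
      using summable_norm_cancel[OF summable_ode_coeff[OF _ b, of T]] t T_pos
      by (intro termdiffs_strong[where K=T]) auto
    moreover have "diffs (\<lambda>n. ode_coeff n \<bullet> b) n * t ^ n = (t ^ n *\<^sub>R (\<Sum>i\<le>n.
      B (ode_coeff i) (ode_coeff (n - i)))) \<bullet> b" for n
      by (simp add: diffs_def ode_coeff_Suc del: of_nat_Suc)
    moreover have "(\<lambda>n. (t ^ n *\<^sub>R (\<Sum>i\<le>n. B (ode_coeff i) (ode_coeff (n - i))))
      \<bullet> b) sums (B (ode_sol t) (ode_sol t) \<bullet> b)"
      using B_ode_sol_sums t by (intro bounded_linear.sums[OF bounded_linear_inner_left]) auto
    ultimately show ?thesis unfolding ode_comp_def[abs_def] by (simp add: sums_iff)
  qed
  then have "((\<lambda>t. \<Sum>b\<in>Basis. ode_comp b t *\<^sub>R b) has_vector_derivative (\<Sum>b\<in>Basis.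
    (B (ode_sol t) (ode_sol t) \<bullet> b) *\<^sub>R b)) (at t)"
    by (intro has_vector_derivative_sum bounded_linear.has_vector_derivative[OF bounded_linear_scaleR_left])
      (simp add: has_real_derivative_iff_has_vector_derivative)
  then show ?thesis unfolding ode_sol_def[abs_def, symmetric] by (simp add: euclidean_representation)
qed

end

end

lemma quadratic_ode_solution:
  fixes B :: "'a::euclidean_space \<Rightarrow> 'a \<Rightarrow> 'a"
  assumes B: "bounded_bilinear B" and V: "subspace V" "x0 \<in> V" "\<And>x. x \<in> V \<Longrightarrow> B x x \<in> V"
  obtains T x where "T > 0" "x 0 = x0" "\<And>t. t \<in> {0..<T} \<Longrightarrow> x t \<in> V"
    "\<And>t. t \<in> {0..<T} \<Longrightarrow> (x has_vector_derivative B (x t) (x t)) (at t within {0..<T})"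
proof -
  obtain K where K: "K > 0" "\<And>a b. norm (B a b) \<le> norm a * norm b * K"
    using bounded_bilinear.pos_bounded[OF B] by blast
  \<comment> \<open>The summand 1 keeps \<open>r\<close> positive when the initial value is
    zero.\<close>
  define r where "r = norm x0 + 1"
  define T where "T = 1 / (2 * K * r)"
  have r: "norm x0 \<le> r" "r > 0" by (auto simp: r_def add_nonneg_pos)
  have sym: "B a b + B b a \<in> V" if "a \<in> V" "b \<in> V" for a b
  proof -
    \<comment> \<open>Polarization: invariance of \<open>V\<close> under the quadratic map gives
      invariance under the symmetric part of \<open>B\<close>.\<close>
    have "B a b + B b a = B (a + b) (a + b) - B a a - B b b"
      unfolding bounded_bilinear.add_left[OF B] bounded_bilinear.add_right[OF B] by simp
    also have "\<dots> \<in> V"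
      using that by (intro subspace_diff[OF V(1) subspace_diff[OF V(1)]] V(3) subspace_add[OF V(1)])
    finally show ?thesis .
  qed
  show thesis
  proof (rule that[of T "ode_sol B x0"])
    show "T > 0" using T_pos[OF B K(2) K(1) r T_def] .
    show "ode_sol B x0 0 = x0" by (rule ode_sol_0)
    fix t assume t: "t \<in> {0..<T}"
    show "ode_sol B x0 t \<in> V"
      using t by (intro ode_sol_in_subspace[OF B K(2) K(1) r T_def _ V(1,2) sym]) auto
    show "(ode_sol B x0 has_vector_derivative B (ode_sol B x0 t) (ode_sol B x0 t)) (at t within {0..<T})"
      using t by (intro has_vector_derivative_at_within[OF ode_sol_has_derivative[OF B K(2) K(1) r
        T_def]]) auto
  qed
qed

lemma Q_curv_bilinear:
  obtains B :: "('n::finite) tensor4 \<Rightarrow> 'n tensor4 \<Rightarrow> 'n tensor4"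
  where "bounded_bilinear B" "\<And>R. B R R = Q_curv R"
proof -
  define B :: "'n tensor4 \<Rightarrow> 'n tensor4 \<Rightarrow> 'n tensor4" where "B R S = (\<chi> i j k l.
     (\<Oplus>p q. R $ i $ j $ p $ q * S $ k $ l $ p $ q)
   + 2 * (\<Oplus>p q. R $ i $ p $ k $ q * S $ j $ p $ l $ q - R $ i $ p $ l $ q * S $ j $ p $ k $ q))" for R S
  have "bilinear B" unfolding bilinear_def
    by (intro conjI allI linearI)
      (simp_all add: B_def vec_eq_iff sum.distrib sum_subtractf algebra_simps sum_distrib_left)
  then have "bounded_bilinear B" by (simp add: bilinear_conv_bounded_bilinear)
  moreover have "B R R = Q_curv R" for R by (simp add: B_def Q_curv_def)
  ultimately show thesis using that by blast
qed

text \<open>A solution starting at \<open>S\<close> stays in \<open>C\<close>, where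
  \<open>a\<close> is minimal at \<open>S\<close>; so the right derivative of \<open>a\<close> along
  it, which is \<open>a \<bullet> Q_curv S\<close> at time 0, is nonnegative. Without local
  existence the invariance of \<open>C\<close> would say nothing at \<open>S\<close>.\<close>

lemma supporting_functional_Q_curv:
  fixes C :: "('n::finite) tensor4 set"
  assumes "Q_ode_invariant C" "C \<subseteq> alg_curv" "S \<in> C" and a: "\<And>R. R \<in> C \<Longrightarrow> a \<bullet> S \<le> a \<bullet> R"
  shows "a \<bullet> Q_curv S \<ge> 0"
proof -
  obtain B :: "'n tensor4 \<Rightarrow> 'n tensor4 \<Rightarrow> 'n tensor4" where B: "bounded_bilinear B" "\<And>R. B R R = Q_curv R"
    using Q_curv_bilinear by blast
  obtain T x where T: "T > 0" and x: "x 0 = S" "\<And>t. t \<in> {0..<T} \<Longrightarrow> x t \<in> alg_curv"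
    "\<And>t. t \<in> {0..<T} \<Longrightarrow> (x has_vector_derivative B (x t) (x t)) (at t within {0..<T})"
    using quadratic_ode_solution[OF B(1) subspace_alg_curv, of S] assms(2,3) Q_curv_in_alg_curv B(2) by auto
  have xC: "x t \<in> C" if "t \<in> {0..<T}" for t
    using assms(1)[unfolded Q_ode_invariant_def, rule_format, of T x t] T x assms(3) that B(2) by auto
  have "((\<lambda>t. a \<bullet> x t) has_real_derivative a \<bullet> Q_curv S) (at 0 within {0..<T})"
    using x(3)[of 0] T x(1) B(2) unfolding has_real_derivative_iff_has_vector_derivative
    by (intro bounded_linear.has_vector_derivative[OF bounded_linear_inner_right]) auto
  then have lim: "((\<lambda>t. (a \<bullet> x t - a \<bullet> x 0) / (t - 0)) \<longlongrightarrow> a \<bullet> Q_curv S) (at 0 within {0..<T})"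
    by (simp add: has_field_derivative_iff)
  have "at 0 within {0..<T} \<noteq> bot"
    using T by (simp add: trivial_limit_within islimpt_Ico)
  moreover have "\<forall>\<^sub>F t in at 0 within {0..<T}. 0 \<le> (a \<bullet> x t - a \<bullet> x 0) / (t - 0)"
    using a xC x(1) by (auto simp: eventually_at_filter)
  ultimately show ?thesis using tendsto_lowerbound[OF lim] by blast
qed

section \<open>Orthonormal frames\<close>

text \<open>The norm is the Frobenius norm; the estimate is Cauchy-Schwarz applied to each
  row.\<close>

lemma norm_matrix_mult_le:
  fixes A :: "real ^ 'k ^ 'm" and B :: "real ^ 'n ^ 'k"
  shows "norm (A ** B) \<le> norm A * norm B"
proof -
  have "norm ((A ** B) $ i) \<le> norm (A $ i) * norm B" for i
  proof -
    have "(A ** B) $ i = (\<Oplus>k. A $ i $ k *\<^sub>R B $ k)"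
      by (simp add: vec_eq_iff matrix_matrix_mult_def)
    then have "norm ((A ** B) $ i) \<le> (\<Oplus>k. \<bar>norm (A $ i $ k)\<bar> * \<bar>norm (B $ k)\<bar>)"
      using norm_sum[of "\<lambda>k. A $ i $ k *\<^sub>R B $ k" UNIV] by simp
    also have "\<dots> \<le> L2_set (\<lambda>k. norm (A $ i $ k)) UNIV * L2_set (\<lambda>k. norm (B $ k)) UNIV"
      by (rule L2_set_mult_ineq)
    finally show ?thesis by (simp add: norm_vec_def)
  qed
  then have "norm (A ** B) \<le> L2_set (\<lambda>i. norm (A $ i) * norm B) UNIV"
    unfolding norm_vec_def[of "A ** B"] by (intro L2_set_mono) auto
  also have "\<dots> = norm A * norm B"
    by (simp add: norm_vec_def[of A] L2_set_left_distrib)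
  finally show ?thesis .
qed

lemma matrix_mult_diff: "A ** (B - C) = A ** B - A ** C" "(B - C) ** A = B ** A - C ** A"
  for A B C :: "real ^ 'n ^ 'n"
  by (simp_all add: vec_eq_iff matrix_matrix_mult_def algebra_simps sum_subtractf)

lemma matrix_mult_add: "A ** (B + C) = A ** B + A ** C" "(B + C) ** A = B ** A + C ** A"
  for A B C :: "real ^ 'n ^ 'n"
  by (simp_all add: vec_eq_iff matrix_matrix_mult_def algebra_simps sum.distrib)

lemma transpose_add: "transpose (A + B) = transpose A + transpose B"
  by (simp add: transpose_def vec_eq_iff)

lemma transpose_scaleR: "transpose (c *\<^sub>R A) = c *\<^sub>R transpose A"
  by (simp add: transpose_def vec_eq_iff)

text \<open>\<open>B\<close> is the inverse square root of \<open>M\<close>, obtained as 1 + Y with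
  symmetric \<open>Y\<close>. That its distance from the identity is at most that of
  \<open>M\<close> makes a frame that is orthonormal up to o(t^2) correctable by o(t^2).\<close>

lemma orthonormalize_near:
  fixes M :: "real ^ 'n ^ 'n"
  assumes sym: "transpose M = M" and near: "norm (M - mat 1) \<le> 1 / 10"
  obtains B where "B ** M ** transpose B = mat 1" "norm (B - mat 1) \<le> norm (M - mat 1)"
proof -
  define X where "X = M - mat 1"
  define e where "e = norm X"
  have e: "0 \<le> e" "e \<le> 1 / 10" using near by (simp_all add: e_def X_def)
  have symX: "transpose X = X"
    using sym by (simp add: X_def vec_eq_iff transpose_def mat_def)
  \<comment> \<open>With M = 1 + X, the equation (1 + Y) M (1 + Y) = 1 is exactly Y = f Y.\<close>
  define f where "f Y = (- 1 / 2) *\<^sub>R (X + X ** Y + Y ** X + Y ** X ** Y + Y ** Y)" for Y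
  define S where "S = {Y :: real ^ 'n ^ 'n. transpose Y = Y \<and> norm Y \<le> e}"
  have "closed {Y :: real ^ 'n ^ 'n. transpose Y = Y}"
    unfolding transpose_def vec_eq_iff by (auto intro!:
      closed_Collect_all closed_Collect_eq continuous_intros)
  then have "closed S"
    unfolding S_def by (intro closed_Collect_conj closed_Collect_le continuous_intros) auto
  then have S: "complete S" by (simp add: complete_eq_closed)
  have n1: "norm (A ** B) \<le> norm A * e" if "norm B \<le> e" for A B :: "real ^ 'n ^ 'n"
    by (rule order_trans[OF norm_matrix_mult_le mult_left_mono[OF that norm_ge_zero]])
  have fS: "f ` S \<subseteq> S"
  proof (intro image_subsetI)
    fix Y assume Y: "Y \<in> S"
    have "transpose (f Y) = f Y"
      unfolding f_def transpose_scaleR transpose_add matrix_transpose_mul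
      using Y symX by (simp add: S_def matrix_mul_assoc add_ac)
    moreover have "norm (f Y) \<le> e"
    proof -
      have Ye: "norm Y \<le> e" using Y by (simp add: S_def)
      have a: "norm (X ** Y) \<le> e * e" "norm (Y ** X) \<le> e * e" "norm (Y ** X ** Y) \<le> e * e * e"
        "norm (Y ** Y) \<le> e * e"
        using n1[OF Ye, of X] n1[of X Y] n1[OF Ye, of "Y ** X"] n1[OF Ye, of Y] mult_right_mono[OF Ye e(1)]
          mult_right_mono[of "norm (Y ** X)" "e * e" e] e(1)
        by (auto simp: e_def)
      have "norm (X + X ** Y + Y ** X + Y ** X ** Y + Y ** Y) \<le> e + e * e + e * e + e * e * e + e * e"
        using a by (intro norm_triangle_mono) (auto simp: e_def)
      also have "e * e * e \<le> e * e * (1 / 10)" using e by (intro mult_left_mono) auto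
      also have "e * e \<le> e * (1 / 10)" using e by (intro mult_left_mono) auto
      finally show ?thesis using e by (simp add: f_def)
    qed
    ultimately show "f Y \<in> S" by (simp add: S_def)
  qed
  \<comment> \<open>In the difference four terms have one factor bounded by \<open>e\<close> and two
    have two such factors; 4e + 2e^2 \<le> 1 holds for e \<le> 1/10, and \<open>f\<close> carries
    the factor 1/2.\<close>
  have lip: "dist (f Y) (f Z) \<le> 1 / 2 * dist Y Z" if Y: "Y \<in> S" and Z: "Z \<in> S" for Y Z
  proof -
    define W where "W = Y - Z"
    have Ye: "norm Y \<le> e" "norm Z \<le> e" using Y Z by (auto simp: S_def)
    have Xe: "norm X \<le> e" by (simp add: e_def)
    have "f Y - f Z = (- 1 / 2) *\<^sub>R (X ** W + W ** X + W ** X ** Y + Z ** X ** W + W ** Y + Z ** W)"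
      unfolding f_def W_def scaleR_diff_right[symmetric]
      by (rule arg_cong[of _ _ "scaleR _"]) (simp add: matrix_mult_diff algebra_simps matrix_mul_assoc)
    moreover have "norm (X ** W + W ** X + W ** X ** Y + Z ** X ** W + W ** Y + Z ** W)
       \<le> e * norm W + norm W * e + norm W * e * e + e * e * norm W + norm W * e + e * norm W"
    proof (intro norm_triangle_mono)
      show "norm (X ** W) \<le> e * norm W" "norm (Z ** W) \<le> e * norm W"
        using norm_matrix_mult_le[of X W] norm_matrix_mult_le[of Z W] mult_right_mono[OF Ye(2), of "norm W"]
        by (auto simp: e_def)
      show "norm (W ** X) \<le> norm W * e" "norm (W ** Y) \<le> norm W * e"
        using n1 Xe Ye by auto
      show "norm (W ** X ** Y) \<le> norm W * e * e"
        using n1[OF Ye(1), of "W ** X"] mult_right_mono[OF n1[OF Xe, of W] e(1)] by linarith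
      have "norm (Z ** X ** W) \<le> norm (Z ** X) * norm W" by (rule norm_matrix_mult_le)
      also have "\<dots> \<le> (norm Z * e) * norm W" by (rule mult_right_mono[OF n1[OF Xe] norm_ge_zero])
      also have "\<dots> \<le> (e * e) * norm W" using Ye e by (intro mult_right_mono) auto
      finally show "norm (Z ** X ** W) \<le> e * e * norm W" .
    qed
    moreover have "\<dots> = (4 * e + 2 * e * e) * norm W" by (simp add: algebra_simps)
    moreover have "(4 * e + 2 * e * e) * norm W \<le> 1 * norm W"
    proof (rule mult_right_mono)
      have "e * e \<le> e * (1 / 10)" using e by (intro mult_left_mono) auto
      then show "4 * e + 2 * e * e \<le> 1" using e by simp
    qed simp
    ultimately show ?thesis by (simp add: dist_norm W_def)
  qed
  have "\<exists>!Y. Y \<in> S \<and> f Y = Y"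
  proof (rule Banach_fix[OF S, where c="1 / 2"])
    show "S \<noteq> {}" using e by (auto simp: S_def intro!: exI[of _ 0] simp: transpose_def vec_eq_iff)
  qed (use fS lip in auto)
  then obtain Y where Y: "Y \<in> S" "f Y = Y" by auto
  have "2 *\<^sub>R Y = 2 *\<^sub>R f Y" using Y by simp
  then have "X + X ** Y + Y ** X + Y ** X ** Y + Y ** Y + 2 *\<^sub>R Y = 0"
    by (simp add: f_def)
  moreover have "(mat 1 + Y) ** M ** (mat 1 + Y) = mat 1 + (X + X ** Y + Y ** X + Y ** X ** Y + Y ** Y
    + 2 *\<^sub>R Y)"
    by (simp add: X_def matrix_mult_diff matrix_mult_add scaleR_2 algebra_simps)
  ultimately have "(mat 1 + Y) ** M ** transpose (mat 1 + Y) = mat 1"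
    using Y(1) by (simp add: S_def transpose_add transpose_mat)
  moreover have "norm ((mat 1 + Y) - mat 1) \<le> norm (M - mat 1)"
    using Y(1) by (simp add: S_def e_def X_def)
  ultimately show thesis using that by blast
qed

text \<open>\<open>B\<close> is chosen separately at each \<open>x\<close>; the norm bound later
  supplies its limit or its order of approximation.\<close>

lemma orthonormalize_tendsto:
  fixes M :: "'a \<Rightarrow> real ^ 'n ^ 'n"
  assumes lim: "(M \<longlongrightarrow> mat 1) F" and sym: "\<forall>\<^sub>F x in F. transpose (M x) = M x"
  obtains B where
    "\<forall>\<^sub>F x in F. B x ** M x ** transpose (B x) = mat 1 \<and> norm (B x - mat 1) \<le> norm (M x - mat 1)"
proof -
  define P where "P x B \<longleftrightarrow> B ** M x ** transpose B = mat 1 \<and> norm (B - mat 1) \<le> norm (M x - mat 1)" for x B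
  have "\<forall>\<^sub>F x in F. dist (M x) (mat 1) < 1 / 10" using lim by (rule tendstoD) simp
  then have "\<forall>\<^sub>F x in F. P x (SOME B. P x B)"
    using sym
  proof eventually_elim
    case (elim x)
    have "\<exists>B. P x B"
      using orthonormalize_near[OF elim(2)] elim(1) unfolding P_def by (metis dist_norm less_imp_le)
    then show ?case by (rule someI_ex)
  qed
  then show thesis unfolding P_def by (rule that)
qed

lemma bilin_frame: "bilin G (E $ i) (F $ j) = (E ** G ** transpose F) $ i $ j"
  for G E F :: "real ^ 'n ^ 'n"
  by (simp add: bilin_sum matrix_matrix_mult_def transpose_def sum_distrib_right) (rule sum.swap)

lemma orthonormal_frame_iff: "orthonormal_frame G E \<longleftrightarrow> E ** G ** transpose E = mat 1"
  by (simp add: orthonormal_frame_def bilin_frame vec_eq_iff mat_def)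

lemma orthonormal_frames_related:
  assumes E: "orthonormal_frame G E" and F: "orthonormal_frame G F" and sym: "transpose G = G"
  obtains B where "orthogonal_matrix B" "F = B ** E"
proof
  \<comment> \<open>The matrix of inner products of the rows of \<open>F\<close> with those of
    \<open>E\<close>, that is, the coefficients of \<open>F\<close> in the frame
    \<open>E\<close>.\<close>
  define B where "B = F ** G ** transpose E"
  have "E ** (G ** transpose E) = mat 1"
    using E by (simp add: orthonormal_frame_iff matrix_mul_assoc)
  then have inv: "(G ** transpose E) ** E = mat 1" by (simp add: matrix_left_right_inverse)
  have "B ** E = F ** ((G ** transpose E) ** E)" by (simp add: B_def matrix_mul_assoc)
  then show "F = B ** E" unfolding inv by simp
  have "B ** transpose B = F ** ((G ** transpose E) ** E) ** G ** transpose F"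
    by (simp add: B_def matrix_transpose_mul matrix_mul_assoc sym)
  then have "B ** transpose B = mat 1" unfolding inv using F by (simp add: orthonormal_frame_iff)
  then show "orthogonal_matrix B"
    unfolding orthogonal_matrix_def using matrix_left_right_inverse by blast
qed

lemma (in metric_chart) transpose_G: "x \<in> U \<Longrightarrow> transpose (G x) = G x"
  using sym_G by (simp add: transpose_def vec_eq_iff)

text \<open>Induction on the set of indices already served: while fewer than n vectors are chosen,
  some nonzero \<open>v\<close> is orthogonal in the standard sense to all
  \<open>G x *v E i\<close>, hence orthogonal to the \<open>E i\<close> for the metric, and can be
  normalized.\<close>

lemma (in metric_chart) orthonormal_frame_exists:
  assumes x: "x \<in> U"
  obtains E where "orthonormal_frame (G x) E"
proof -
  have "\<exists>E :: 'n \<Rightarrow> real ^ 'n. \<forall>i\<in>I. \<forall>j\<in>I. bilin (G x) (E i) (E j) = dl i j" for I :: "'n set"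
    using finite[of I]
  proof induction
    case (insert k I)
    then obtain E :: "'n \<Rightarrow> real ^ 'n" where E: "\<And>i j. i \<in> I \<Longrightarrow> j \<in> I
      \<Longrightarrow> bilin (G x) (E i) (E j) = dl i j" by blast
    define W where "W = (\<lambda>i. G x *v E i) ` I"
    have "dim W \<le> card I"
      unfolding W_def by (rule order_trans[OF dim_le_card' card_image_le]) auto
    also have "card I < CARD('n)" using insert by (intro psubset_card_mono) auto
    finally have "dim W < DIM(real ^ 'n)" by simp
    then obtain v where v: "v \<noteq> 0" "\<And>w. w \<in> span W \<Longrightarrow> orthogonal v w"
      using orthogonal_to_subspace_exists[of W] by blast
    have vE: "bilin (G x) v (E i) = 0" "bilin (G x) (E i) v = 0" if "i \<in> I" for i
    proof -
      show "bilin (G x) v (E i) = 0"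
        using v(2)[of "G x *v E i"] that by (simp add: W_def span_base bilin_def orthogonal_def)
      then show "bilin (G x) (E i) v = 0" using bilin_sym[OF x] by simp
    qed
    have pos: "0 < bilin (G x) v v" using pos_G[OF x v(1)] .
    define w where "w = (1 / sqrt (bilin (G x) v v)) *\<^sub>R v"
    have sc: "bilin (G x) (c *\<^sub>R a) b = c * bilin (G x) a b"
      "bilin (G x) a (c *\<^sub>R b) = c * bilin (G x) a b" for c a b
      by (simp_all add: bilin_sum sum_distrib_left mult_ac)
    have "bilin (G x) w w = 1"
      using pos by (simp add: w_def sc power2_eq_square[symmetric])
    moreover have "bilin (G x) w (E i) = 0" "bilin (G x) (E i) w = 0" if "i \<in> I" for i
      using vE[OF that] by (simp_all add: w_def sc)
    ultimately show ?case
      using insert E by (intro exI[of _ "E(k := w)"]) auto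
  qed simp
  from this[of UNIV] obtain E :: "'n \<Rightarrow> real ^ 'n" where "\<And>i j. bilin (G x) (E i) (E j) = dl i j" by blast
  then have "orthonormal_frame (G x) (\<chi> i. E i)" by (simp add: orthonormal_frame_def)
  then show thesis using that by blast
qed

section \<open>The Laplacian of the curvature of an Einstein metric\<close>

lemma second_partial_deriv_mult:
  fixes f g :: "real ^ 'n::finite \<Rightarrow> real"
  assumes U: "open U" "x \<in> U" and f: "smooth_on U f" and g: "smooth_on U g"
  shows "\<partial> a (\<partial> b (\<lambda>x. f x * g x)) x
    = f x * \<partial> a (\<partial> b g) x + \<partial> a f x * \<partial> b g x
    + \<partial> b f x * \<partial> a g x + \<partial> a (\<partial> b f) x * g x"
proof -
  note d = smooth_on_differentiable[OF U(1) _ U(2)]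
  have "\<partial> a (\<partial> b (\<lambda>x. f x * g x)) x
    = \<partial> a (\<lambda>x. f x * \<partial> b g x + \<partial> b f x * g x) x"
    by (rule partial_deriv_cong[OF U]) (intro partial_deriv_mult smooth_on_differentiable[OF U(1)] f g)
  also have "\<dots> = f x * \<partial> a (\<partial> b g) x + \<partial> a f x * \<partial> b g x
    + (\<partial> b f x * \<partial> a g x + \<partial> a (\<partial> b f) x * g x)"
    using d[OF f] d[OF g] d[OF smooth_on_partial_deriv[OF f]] d[OF smooth_on_partial_deriv[OF g]]
    by (simp add: partial_deriv_add partial_deriv_mult differentiable_mult)
  finally show ?thesis by simp
qed

lemma second_partial_deriv_const: "\<partial> a (\<partial> b (\<lambda>x. c)) x = 0"
proof -
  have "\<partial> b (\<lambda>x. c) = (\<lambda>x. 0)" by (rule ext) simp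
  then show ?thesis by simp
qed

lemma second_partial_deriv_sum:
  fixes f :: "'a \<Rightarrow> real ^ 'n::finite \<Rightarrow> real"
  assumes U: "open U" "x \<in> U" and f: "\<And>i. i \<in> I \<Longrightarrow> smooth_on U (f i)" and I: "finite I"
  shows "\<partial> a (\<partial> b (\<lambda>x. \<Sum>i\<in>I. f i x)) x = (\<Sum>i\<in>I. \<partial> a (\<partial> b (f i)) x)"
proof -
  have "\<partial> a (\<partial> b (\<lambda>x. \<Sum>i\<in>I. f i x)) x = \<partial> a (\<lambda>x. \<Sum>i\<in>I. \<partial> b (f i) x) x"
    by (rule partial_deriv_cong[OF U], rule partial_deriv_sum[OF I]) (rule
      smooth_on_differentiable[OF U(1) f])
  also have "\<dots> = (\<Sum>i\<in>I. \<partial> a (\<partial> b (f i)) x)"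
    by (rule partial_deriv_sum[OF I]) (rule
      smooth_on_differentiable[OF U(1) smooth_on_partial_deriv[OF f] U(2)])
  finally show ?thesis .
qed

lemma second_partial_deriv_add:
  fixes f g :: "real ^ 'n::finite \<Rightarrow> real"
  assumes U: "open U" "x \<in> U" and f: "smooth_on U f" and g: "smooth_on U g"
  shows "\<partial> a (\<partial> b (\<lambda>x. f x + g x)) x
    = \<partial> a (\<partial> b f) x + \<partial> a (\<partial> b g) x"
proof -
  note d = smooth_on_differentiable[OF U(1) smooth_on_partial_deriv U(2)]
  have "\<partial> a (\<partial> b (\<lambda>x. f x + g x)) x = \<partial> a (\<lambda>x. \<partial> b f x + \<partial> b g x) x"
    by (rule partial_deriv_cong[OF U]) (intro partial_deriv_add smooth_on_differentiable[OF U(1)] f g)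
  then show ?thesis using d[OF f] d[OF g] by (simp add: partial_deriv_add)
qed

lemma second_partial_deriv_diff:
  fixes f g :: "real ^ 'n::finite \<Rightarrow> real"
  assumes U: "open U" "x \<in> U" and f: "smooth_on U f" and g: "smooth_on U g"
  shows "\<partial> a (\<partial> b (\<lambda>x. f x - g x)) x
    = \<partial> a (\<partial> b f) x - \<partial> a (\<partial> b g) x"
  using second_partial_deriv_add[OF U smooth_on_diff[OF U(1) f g] g, of a b] by simp

lemma second_partial_deriv_cong:
  assumes "open U" "x \<in> U" "\<And>y. y \<in> U \<Longrightarrow> f y = g y"
  shows "\<partial> a (\<partial> b f) x = \<partial> a (\<partial> b g) x"
  by (rule partial_deriv_cong[OF assms(1,2)]) (rule partial_deriv_cong[OF assms(1)], use assms(3) in auto)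

text \<open>Lowering an index and contracting with the inverse metric cancel. In this form the
  Einstein equation can be differentiated twice without derivatives of the inverse metric.\<close>

lemma (in metric_chart) ricci_metric_eq_trace:
  assumes x: "x \<in> U" and alg: "riemann G x \<in> alg_curv"
  shows "ricci_metric G x $ i $ k = (\<Oplus>j. curv_up G j k j i x)"
proof -
  have "ricci_metric G x $ i $ k = (\<Oplus>j l. matrix_inv (G x) $ j $ l * riemann G x $ l $ k $ j $ i)"
    unfolding ricci_metric_def vec_lambda_beta
  proof (intro sum.cong refl arg_cong2[of _ _ _ _ "(*)"])
    fix j l
    show "riemann G x $ i $ j $ k $ l = riemann G x $ l $ k $ j $ i"
      using alg_curvD(3)[OF alg, of i j k l] alg_curvD(1)[OF alg, of k l i j] alg_curvD(2)[OF alg,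
        of l k i j] by simp
  qed
  also have "\<dots> = (\<Oplus>j l m. (matrix_inv (G x) $ j $ l * G x $ l $ m) * curv_up G m k j i x)"
    by (simp add: riemann_def sum_distrib_left mult.assoc)
  also have "\<dots> = (\<Oplus>j m. dl j m * curv_up G m k j i x)"
  proof (rule sum.cong[OF refl])
    fix j
    show "(\<Oplus>l m. (matrix_inv (G x) $ j $ l * G x $ l $ m) * curv_up G m k j i x)
      = (\<Oplus>m. dl j m * curv_up G m k j i x)"
      by (subst sum.swap) (simp only: G_inv(2)[OF x] flip: sum_distrib_right)
  qed
  finally show ?thesis by (simp only: sum_dl)
qed

text \<open>The Einstein equation and the curvature symmetries are required throughout
  \<open>U\<close>, since they are differentiated twice at \<open>p\<close>.\<close>

locale normal_point = metric_chart U G for U :: "(real ^ 'n::finite) set" and G +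
  fixes p :: "real ^ 'n" and \<rho> :: real
  assumes p: "p \<in> U" and G_p: "G p = mat 1" and christoffel_p: "\<And>k i j. christoffel G k i j p = 0"
    and einstein: "\<And>x. x \<in> U \<Longrightarrow> ricci_metric G x = \<rho> *\<^sub>R G x"
    and alg: "\<And>x. x \<in> U \<Longrightarrow> riemann G x \<in> alg_curv"
begin

definition dGam :: "'n \<Rightarrow> 'n \<Rightarrow> 'n \<Rightarrow> 'n \<Rightarrow> real" where
  "dGam a m b s = \<partial> a (christoffel G m b s) p"

abbreviation K :: "'n \<Rightarrow> 'n \<Rightarrow> 'n \<Rightarrow> 'n \<Rightarrow> real" where
  "K m j k l \<equiv> curv_up G m j k l p"

lemma G_p_nth: "G p $ i $ j = dl i j"
  by (simp add: G_p mat_def)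

lemma dGam_sym: "dGam a m b s = dGam a m s b"
  unfolding dGam_def by (rule partial_deriv_cong[OF open_U p]) (rule christoffel_sym)

lemma K_eq: "K m j k l = dGam k m l j - dGam l m k j"
  by (simp add: curv_up_def christoffel_p dGam_def)

lemma riemann_p: "riemann G p $ i $ j $ k $ l = K i j k l"
  unfolding riemann_def vec_lambda_beta G_p_nth by (rule sum_dl)

lemma partial_deriv_G_p: "\<partial> a (\<lambda>x. G x $ i $ j) p = 0"
  by (simp add: metric_compat[OF p] christoffel_p)

text \<open>Differentiating metric compatibility once more; all terms with an undifferentiated
  Christoffel symbol vanish at \<open>p\<close>.\<close>

lemma second_partial_deriv_G_p: "\<partial> b (\<partial> a (\<lambda>x. G x $ i $ j)) p = dGam b j a i + dGam b i a j"
proof -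
  note d = differentiable_christoffel[OF p] differentiable_G[OF p]
  have "\<partial> b (\<partial> a (\<lambda>x. G x $ i $ j)) p
    = \<partial> b (\<lambda>x. (\<Oplus>s. christoffel G s a i x * G x $ s $ j) + (\<Oplus>s. christoffel G s a j x * G x $ i $ s)) p"
    by (rule partial_deriv_cong[OF open_U p]) (rule metric_compat)
  also have "\<dots> = (\<Oplus>s. dGam b s a i * dl s j) + (\<Oplus>s. dGam b s a j * dl i s)"
    using d by (simp add: partial_deriv_add partial_deriv_sum partial_deriv_mult differentiable_mult
      differentiable_sum
       dGam_def christoffel_p G_p_nth)
  finally show ?thesis by (simp only: sum_dl)
qed

lemma second_partial_deriv_riemann_p:
  "\<partial> a (\<partial> b (\<lambda>x. riemann G x $ i $ j $ k $ l)) p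
    = \<partial> a (\<partial> b (curv_up G i j k l)) p + (\<Oplus>s. (dGam a s b i + dGam a i b s) * K s j k l)"
proof -
  have "\<partial> a (\<partial> b (\<lambda>x. riemann G x $ i $ j $ k $ l)) p
     = (\<Oplus>s. dl i s * \<partial> a (\<partial> b (curv_up G s j k l)) p + (dGam a s b i + dGam a i b s) * K s j k l)"
    unfolding riemann_def vec_lambda_beta
    by (simp add: second_partial_deriv_sum[OF open_U p smooth_on_mult[OF open_U smooth_G smooth_curv_up]]
      second_partial_deriv_mult[OF open_U p smooth_G smooth_curv_up]
        second_partial_deriv_G_p partial_deriv_G_p G_p_nth)
  then show ?thesis by (simp only: sum.distrib sum_dl)
qed

text \<open>The Christoffel symbols vanish at \<open>p\<close>, so their products contribute only
  products of first derivatives.\<close>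

lemma second_partial_deriv_curv_up_p:
  "\<partial> b (\<partial> a (curv_up G m j k l)) p
   = \<partial> b (\<partial> a (\<partial> k (christoffel G m l j))) p
   - \<partial> b (\<partial> a (\<partial> l (christoffel G m k j))) p
   + (\<Oplus>s. dGam b m k s * dGam a s l j + dGam a m k s * dGam b s l j
        - (dGam b m l s * dGam a s k j + dGam a m l s * dGam b s k j))"
proof -
  note s = smooth_christoffel smooth_on_partial_deriv[OF smooth_christoffel]
  have m: "smooth_on U (\<lambda>x. christoffel G m k s x * christoffel G s l j x)" for m k s l j
    by (intro smooth_on_mult[OF open_U] s)
  have "\<partial> b (\<partial> a (\<lambda>x. christoffel G m k s x * christoffel G s l j x)) p
     = dGam b m k s * dGam a s l j + dGam a m k s * dGam b s l j" for m k s l j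
    unfolding second_partial_deriv_mult[OF open_U p s(1) s(1)] by (simp add: christoffel_p dGam_def)
  then have ms: "\<partial> b (\<partial> a (\<lambda>x. \<Oplus>s. christoffel G m k s x * christoffel G s l j x
                - christoffel G m l s x * christoffel G s k j x)) p
     = (\<Oplus>s. dGam b m k s * dGam a s l j + dGam a m k s * dGam b s l j
        - (dGam b m l s * dGam a s k j + dGam a m l s * dGam b s k j))"
    by (subst second_partial_deriv_sum[OF open_U p smooth_on_diff[OF open_U m m]])
      (simp_all add: second_partial_deriv_diff[OF open_U p m m])
  show ?thesis
    unfolding curv_up_def[abs_def] ms[symmetric]
    by (subst second_partial_deriv_add[OF open_U p smooth_on_diff[OF open_U s(2) s(2)]
      smooth_on_sum[OF open_U smooth_on_diff[OF open_U m m]]])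
      (simp add: second_partial_deriv_diff[OF open_U p s(2) s(2)])
qed

text \<open>The components of \<nabla>\<nabla>R at \<open>p\<close>, with \<open>a\<close> the outer
  derivative: where the Christoffel symbols vanish, the only corrections to the second partial
  derivatives are first derivatives of the symbols, one for each slot.\<close>

definition D2 :: "'n \<Rightarrow> 'n \<Rightarrow> 'n \<Rightarrow> 'n \<Rightarrow> 'n \<Rightarrow> 'n \<Rightarrow> real" where
  "D2 a b i j k l = \<partial> a (\<partial> b (\<lambda>x. riemann G x $ i $ j $ k $ l)) p
    - (\<Oplus>s. dGam a s b i * K s j k l + dGam a s b j * K i s k l + dGam a s b k * K i j s l
      + dGam a s b l * K i j k s)"

text \<open>The second derivatives of the metric that come from lowering \<open>i\<close> absorb the
  correction in that slot; what remains is the formula for the tensor with \<open>i\<close>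
  raised.\<close>

lemma D2_eq: "D2 a b i j k l = \<partial> a (\<partial> b (curv_up G i j k l)) p
    + (\<Oplus>s. dGam a i b s * K s j k l - (dGam a s b j * K i s k l + dGam a s b k * K i j s l
      + dGam a s b l * K i j k s))"
  unfolding D2_def second_partial_deriv_riemann_p by (simp add: sum.distrib sum_subtractf algebra_simps)

text \<open>The differentiated second Bianchi identity. Third derivatives of the Christoffel symbols
  cancel cyclically because partial derivatives commute; the terms quadratic in first derivatives
  cancel by the lower-index symmetry of the symbols.\<close>

lemma D2_bianchi: "D2 a m i j k l + D2 a k i j l m + D2 a l i j m k = 0"
proof -
  define d3 where "d3 b c m k j = \<partial> a (\<partial> b (\<partial> c (christoffel G m k j))) p" for b c m k j
  have d3: "d3 b c m k j = d3 c b m k j" for b c m k j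
    unfolding d3_def by (rule partial_deriv_cong[OF open_U p]) (rule
      partial_deriv_commute[OF open_U smooth_christoffel])
  define Z where "Z m k l s = dGam a i k s * dGam m s l j + dGam m i k s * dGam a s l j
        - (dGam a i l s * dGam m s k j + dGam m i l s * dGam a s k j)
     + (dGam a i m s * K s j k l - (dGam a s m j * K i s k l + dGam a s m k * K i j s l
       + dGam a s m l * K i j k s))" for m k l s
  have D: "D2 a m i j k l = d3 m k i l j - d3 m l i k j + (\<Oplus>s. Z m k l s)" for m k l
    unfolding D2_eq second_partial_deriv_curv_up_p d3_def Z_def by (simp add: sum.distrib)
  have "Z m k l s + Z k l m s + Z l m k s = 0" for s
    unfolding Z_def K_eq dGam_sym[of a s k m] dGam_sym[of a s l m] dGam_sym[of a s l k]
      by (simp add: algebra_simps)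
  then have "(\<Oplus>s. Z m k l s) + (\<Oplus>s. Z k l m s) + (\<Oplus>s. Z l m k s) = 0"
    by (simp flip: sum.distrib)
  then show ?thesis unfolding D using d3[of m k i l j] d3[of m l i k j] d3[of k l i m j] by simp
qed

lemma K_alg: "K j i k l = - K i j k l" "K i j l k = - K i j k l" "K k l i j = K i j k l"
  using alg_curvD[OF alg[OF p]] unfolding riemann_p by blast+

lemma D2_alg: "D2 a b k l i j = D2 a b i j k l" "D2 a b j i k l = - D2 a b i j k l"
proof -
  have P: "\<partial> a (\<partial> b (\<lambda>x. riemann G x $ k $ l $ i $ j)) p = \<partial> a (\<partial> b (\<lambda>x. riemann G x $ i $ j $ k $ l)) p"
    by (rule second_partial_deriv_cong[OF open_U p]) (rule alg_curvD(3)[OF alg])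
  have neg: "\<partial> a (\<partial> b (\<lambda>x. - f x)) p = - \<partial> a (\<partial> b f) p"
    if "smooth_on U f" for f :: "real ^ 'n \<Rightarrow> real"
    using second_partial_deriv_mult[OF open_U p smooth_on_const that, of a b "-1"]
    by (simp add: second_partial_deriv_const)
  have N: "\<partial> a (\<partial> b (\<lambda>x. riemann G x $ j $ i $ k $ l)) p = - \<partial> a (\<partial> b (\<lambda>x. riemann G x $ i $ j $ k $ l)) p"
    unfolding neg[OF smooth_riemann, symmetric]
    by (rule second_partial_deriv_cong[OF open_U p]) (rule alg_curvD(1)[OF alg])
  show "D2 a b k l i j = D2 a b i j k l"
    unfolding D2_def P
    by (intro arg_cong2[of _ _ _ _ "(-)"] refl sum.cong)
      (simp only: K_alg(3)[of _ l i j] K_alg(3)[of k _ i j] K_alg(3)[of k l _ j] K_alg(3)[of k l i] add_ac)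
  have neg_sum: "(\<Oplus>s. dGam a s b j * K s i k l + dGam a s b i * K j s k l + dGam a s b k * K j i s l
    + dGam a s b l * K j i k s)
    = - (\<Oplus>s. dGam a s b i * K s j k l + dGam a s b j * K i s k l + dGam a s b k * K i j s l
      + dGam a s b l * K i j k s)"
    unfolding sum_negf[symmetric]
    by (rule sum.cong[OF refl])
      (simp add: K_alg(1)[of _ i k l] K_alg(1)[of j _ k l] K_alg(1)[of j i])
  show "D2 a b j i k l = - D2 a b i j k l"
    unfolding D2_def N neg_sum by simp
qed

lemma D2_alg3: "D2 a b i j l k = - D2 a b i j k l"
  using D2_alg[of a b] by metis

lemma K_ricci: "(\<Oplus>j. K i j k j) = \<rho> * dl i k"
proof -
  have "K i j k j = K j k j i" for j
    using K_alg(1)[of i j k j] K_alg(2)[of j i k j] K_alg(3)[of j i j k] by simp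
  then show ?thesis
    using ricci_metric_eq_trace[OF p alg[OF p], of i k] einstein[OF p] by (simp add: G_p_nth)
qed

lemma K_trace: "(\<Oplus>c. K c i c k) = \<rho> * dl k i"
  using ricci_metric_eq_trace[OF p alg[OF p], of k i] einstein[OF p] by (simp add: G_p_nth)

text \<open>Second covariant derivatives of the Ricci tensor vanish: after differentiating the
  Einstein equation, the second derivatives of the metric are cancelled by the corrections in
  \<open>i\<close> and \<open>k\<close>.\<close>

lemma D2_trace: "(\<Oplus>c. D2 a b c i c k) = 0"
proof -
  have "(\<Oplus>c. \<partial> a (\<partial> b (curv_up G c i c k)) p)
    = \<partial> a (\<partial> b (\<lambda>x. \<Oplus>c. curv_up G c i c k x)) p"
    by (rule second_partial_deriv_sum[OF open_U p smooth_curv_up, symmetric]) simp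
  also have "\<dots> = \<partial> a (\<partial> b (\<lambda>x. \<rho> * G x $ k $ i)) p"
  proof (rule second_partial_deriv_cong[OF open_U p])
    fix x assume x: "x \<in> U"
    show "(\<Oplus>c. curv_up G c i c k x) = \<rho> * G x $ k $ i"
      using ricci_metric_eq_trace[OF x alg[OF x], of k i] einstein[OF x] by simp
  qed
  also have "\<dots> = \<rho> * (dGam a i b k + dGam a k b i)"
    using second_partial_deriv_mult[OF open_U p smooth_on_const smooth_G, of a b \<rho> k i]
    by (simp add: second_partial_deriv_G_p second_partial_deriv_const)
  finally have 1: "(\<Oplus>c. \<partial> a (\<partial> b (curv_up G c i c k)) p) = \<rho> * (dGam a i b k + dGam a k b i)" .
  \<comment> \<open>The corrections in the upper and lower contracted index cancel, as covariant
    derivatives commute with traces.\<close>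
  have 2: "(\<Oplus>c s. dGam a c b s * K s i c k) = (\<Oplus>c s. dGam a s b c * K c i s k)"
    by (rule sum.swap)
  have 3: "(\<Oplus>c s. dGam a s b i * K c s c k) = \<rho> * dGam a k b i"
  proof -
    have "(\<Oplus>c s. dGam a s b i * K c s c k) = (\<Oplus>s. dGam a s b i * \<rho> * dl k s)"
      by (subst sum.swap) (simp only: K_trace mult.assoc flip: sum_distrib_left)
    then show ?thesis by (simp only: sum_dl mult.commute)
  qed
  have 4: "(\<Oplus>c s. dGam a s b k * K c i c s) = \<rho> * dGam a i b k"
  proof -
    have "(\<Oplus>c s. dGam a s b k * K c i c s) = (\<Oplus>s. dGam a s b k * \<rho> * dl s i)"
      by (subst sum.swap) (simp only: K_trace mult.assoc flip: sum_distrib_left)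
    then show ?thesis by (simp only: sum_dl mult.commute)
  qed
  show ?thesis
    unfolding D2_eq sum.distrib sum_subtractf 1 2 3 4 by (simp add: algebra_simps)
qed

text \<open>The contracted second Bianchi identity: the divergence of the curvature is a
  skew-symmetrized derivative of the Ricci tensor.\<close>

lemma D2_div: "(\<Oplus>c. D2 a c c i j k) = 0"
proof -
  have "D2 a c c i j k = D2 a j c i c k - D2 a k c i c j" for c
    using D2_bianchi[of a c c i j k] D2_alg3[of a j c i k c] by simp
  then show ?thesis by (simp add: sum_subtractf D2_trace)
qed

text \<open>The Ricci identity: the second partial derivatives cancel, and the skew-symmetrized
  first derivatives of the Christoffel symbols are the curvature at \<open>p\<close>.\<close>

lemma D2_commute: "D2 a b i j k l - D2 b a i j k l = - (\<Sum>e\<in>UNIV.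
    K e i a b * K e j k l + K e j a b * K i e k l + K e k a b * K i j e l + K e l a b * K i j k e)"
  unfolding D2_def partial_deriv_commute[OF open_U smooth_riemann p, of b a] K_eq[of _ _ a b]
    dGam_sym[of b _ a]
  by (simp add: sum_subtractf sum.distrib algebra_simps)

theorem laplacian_riemann:
  "(\<Oplus>c. D2 c c i j k l) = 2 * \<rho> * riemann G p $ i $ j $ k $ l - Q_curv (riemann G p) $ i $ j $ k $ l"
proof (rule laplacian_einstein[OF alg[OF p], where D=D2])
  show "D2 a m i j k l + D2 a k i j l m + D2 a l i j m k = 0" for a m i j k l by (rule D2_bianchi)
  show "(\<Oplus>c. D2 a c c i j k) = 0" for a i j k by (rule D2_div)
  show "D2 a b k l i j = D2 a b i j k l" "D2 a b j i k l = - D2 a b i j k l" for a b i j k l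
    by (rule D2_alg)+
qed (simp_all only: riemann_p D2_commute K_ricci)

end

section \<open>Second order expansions and the maximum principle\<close>

text \<open>The expansion f(t) = a + b t + c t^2 + o(t^2), so \<open>c\<close> is half a second
  derivative. Asking for an expansion instead of derivatives admits the corrected frames, which are
  chosen pointwise.\<close>

definition jet2 :: "(real \<Rightarrow> real) \<Rightarrow> real \<Rightarrow> real \<Rightarrow> real \<Rightarrow> bool" where
  "jet2 f a b c \<longleftrightarrow> ((\<lambda>t. (f t - a - b * t - c * t\<^sup>2) / t\<^sup>2) \<longlongrightarrow> 0) (at 0)"

lemma jet2_limit: assumes "jet2 f a b c" shows "(f \<longlongrightarrow> a) (at 0)"
proof -
  have "((\<lambda>t. (f t - a - b * t - c * t\<^sup>2) / t\<^sup>2 * t\<^sup>2 + a + b * t + c * t\<^sup>2) \<longlongrightarrow> 0 * 0\<^sup>2 + a + b * 0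
    + c * 0\<^sup>2) (at 0)"
    using assms unfolding jet2_def by (intro tendsto_intros)
  moreover have "\<forall>\<^sub>F t in at 0. (f t - a - b * t - c * t\<^sup>2) / t\<^sup>2 * t\<^sup>2 + a + b * t + c * t\<^sup>2 = f t"
    by (auto simp: eventually_at_filter)
  ultimately show ?thesis by (simp add: tendsto_cong)
qed

lemma jet2_poly: "jet2 (\<lambda>t. a + b * t + c * t\<^sup>2) a b c"
  by (simp add: jet2_def)

lemma jet2_const: "jet2 (\<lambda>t. a) a 0 0"
  by (simp add: jet2_def)

lemma jet2_cong:
  assumes "\<And>t. f t = g t" "jet2 f a b c" shows "jet2 g a b c"
  using assms by (simp add: jet2_def)

lemma jet2_add:
  assumes "jet2 f a b c" "jet2 g a' b' c'"
  shows "jet2 (\<lambda>t. f t + g t) (a + a') (b + b') (c + c')"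
proof -
  have "((\<lambda>t. (f t - a - b * t - c * t\<^sup>2) / t\<^sup>2 + (g t - a' - b' * t - c' * t\<^sup>2) / t\<^sup>2) \<longlongrightarrow> 0 + 0) (at 0)"
    using assms unfolding jet2_def by (rule tendsto_add)
  then show ?thesis unfolding jet2_def by (simp add: add_divide_distrib[symmetric] algebra_simps)
qed

lemma jet2_mult:
  assumes f: "jet2 f a b c" and g: "jet2 g a' b' c'"
  shows "jet2 (\<lambda>t. f t * g t) (a * a') (a * b' + b * a') (a * c' + b * b' + c * a')"
proof -
  have "((\<lambda>t. (f t - a - b * t - c * t\<^sup>2) / t\<^sup>2 * g t + (a + b * t + c * t\<^sup>2) * ((g t - a' - b' * t
    - c' * t\<^sup>2) / t\<^sup>2)
      + ((b * c' + c * b') * t + c * c' * t\<^sup>2))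
     \<longlongrightarrow> 0 * a' + (a + b * 0 + c * 0\<^sup>2) * 0 + ((b * c' + c * b') * 0 + c * c' * 0\<^sup>2)) (at 0)"
    using f g jet2_limit[OF g] unfolding jet2_def by (intro tendsto_intros)
  moreover have "\<forall>\<^sub>F t in at 0. (f t - a - b * t - c * t\<^sup>2) / t\<^sup>2 * g t + (a + b * t + c * t\<^sup>2) * ((g t
    - a' - b' * t - c' * t\<^sup>2) / t\<^sup>2)
      + ((b * c' + c * b') * t + c * c' * t\<^sup>2) =
     (f t * g t - a * a' - (a * b' + b * a') * t - (a * c' + b * b' + c * a') * t\<^sup>2) / t\<^sup>2"
    by (auto simp: eventually_at_filter field_simps power2_eq_square)
  ultimately show ?thesis unfolding jet2_def by (simp add: tendsto_cong)
qed

lemma jet2_sum: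
  assumes "\<And>i. i \<in> I \<Longrightarrow> jet2 (f i) (a i) (b i) (c i)"
  shows "jet2 (\<lambda>t. \<Sum>i\<in>I. f i t) (\<Sum>i\<in>I. a i) (\<Sum>i\<in>I. b i) (\<Sum>i\<in>I. c i)"
  using assms by (induction I rule: infinite_finite_induct) (auto intro: jet2_add jet2_const)

text \<open>A frame vector without linear term contributes no product of first-order terms; only its
  quadratic coefficients, contracted with the values at 0, are added.\<close>

lemma jet2_contract:
  fixes f e :: "'n::finite \<Rightarrow> real \<Rightarrow> real"
  assumes "\<And>s. jet2 (f s) (r s) (r1 s) (r2 s)" "\<And>s. jet2 (e s) (dl i s) 0 (n s)"
  shows "jet2 (\<lambda>t. \<Oplus>s. f s t * e s t) (r i) (r1 i) (r2 i + (\<Oplus>s. r s * n s))"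
proof -
  have "jet2 (\<lambda>t. \<Oplus>s. f s t * e s t) (\<Oplus>s. r s * dl i s) (\<Oplus>s. r s * 0 + r1 s * dl i s)
    (\<Oplus>s. r s * n s + r1 s * 0 + r2 s * dl i s)"
    by (intro jet2_sum jet2_mult assms)
  also have "(\<Oplus>s. r s * 0 + r1 s * dl i s) = (\<Oplus>s. r1 s * dl i s)" by simp
  also have "(\<Oplus>s. r s * n s + r1 s * 0 + r2 s * dl i s) = (\<Oplus>s. r2 s * dl i s) + (\<Oplus>s. r s * n s)"
    by (simp add: sum.distrib)
  finally show ?thesis by (simp only: sum_dl)
qed

text \<open>The linear term drops out of f(t) + f(-t), whose quotient by t^2 tends to 2c.\<close>

lemma jet2_nonneg:
  assumes f: "jet2 f 0 b c" and pos: "\<forall>\<^sub>F t in at 0. f t \<ge> 0"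
  shows "c \<ge> 0"
proof -
  have m: "filterlim (\<lambda>t::real. - t) (at 0) (at 0)"
    by (rule filterlim_atI) (auto intro!: tendsto_eq_intros simp: eventually_at_filter)
  let ?e = "\<lambda>t. (f t - 0 - b * t - c * t\<^sup>2) / t\<^sup>2"
  have "((\<lambda>t. ?e t + ?e (- t) + 2 * c) \<longlongrightarrow> 0 + 0 + 2 * c) (at 0)"
    using f unfolding jet2_def by (intro tendsto_add tendsto_const filterlim_compose[OF _ m])
  moreover have "\<forall>\<^sub>F t in at 0. ?e t + ?e (- t) + 2 * c \<ge> 0"
  proof -
    have "\<forall>\<^sub>F t in at 0. f (- t) \<ge> 0"
      using pos m by (rule eventually_compose_filterlim)
    moreover have "\<forall>\<^sub>F t in at (0::real). t \<noteq> 0" by (auto simp: eventually_at_filter)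
    ultimately show ?thesis using pos
    proof eventually_elim
      case (elim t)
      have "?e t + ?e (- t) + 2 * c = (f t + f (- t)) / t\<^sup>2"
        using elim by (simp add: field_simps)
      then show ?case using elim by simp
    qed
  qed
  ultimately have "0 + 0 + 2 * c \<ge> 0" by (rule tendsto_lowerbound) simp
  then show ?thesis by simp
qed

lemma jet2_smooth:
  fixes f :: "real ^ 'n::finite \<Rightarrow> real"
  assumes U: "open U" "p \<in> U" and f: "smooth_on U f"
  shows "jet2 (\<lambda>t. f (p + t *\<^sub>R axis c 1)) (f p) (\<partial> c f p) (\<partial> c (\<partial> c f) p / 2)"
proof -
  define h where "h t = f (p + t *\<^sub>R axis c 1)" for t
  define h1 where "h1 t = \<partial> c f (p + t *\<^sub>R axis c 1)" for t
  have "((\<lambda>t. p + t *\<^sub>R axis c 1) \<longlongrightarrow> p + 0 *\<^sub>R axis c 1) (at (0::real))"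
    by (intro tendsto_intros)
  then have evU: "\<forall>\<^sub>F t in at (0::real). p + t *\<^sub>R axis c 1 \<in> U"
    using U by (intro topological_tendstoD[of _ _ _ U]) auto
  have dh: "(h has_real_derivative h1 t) (at t)" if "p + t *\<^sub>R axis c 1 \<in> U" for t
    unfolding h_def h1_def by (rule has_real_derivative_along_axis[OF smooth_on_differentiable[OF U(1)
      f that]])
  have dh1: "(h1 has_real_derivative \<partial> c (\<partial> c f) p) (at 0)"
    unfolding h1_def using has_real_derivative_along_axis[of "\<partial> c f" p 0 c]
      smooth_on_differentiable[OF U(1) smooth_on_partial_deriv[OF f] U(2)] by simp
  have "((\<lambda>t. (h t - h 0 - h1 0 * t) / t\<^sup>2) \<longlongrightarrow> \<partial> c (\<partial> c f) p / 2) (at 0)"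
  proof (rule lhopital)
    have "h \<midarrow>0\<rightarrow> h 0" using DERIV_isCont[OF dh[of 0]] U(2) by (simp add: isCont_def)
    then show "((\<lambda>t. h t - h 0 - h1 0 * t) \<longlongrightarrow> 0) (at 0)"
      by (auto intro!: tendsto_eq_intros)
    show "((\<lambda>t::real. t\<^sup>2) \<longlongrightarrow> 0) (at 0)" by (auto intro!: tendsto_eq_intros)
    show "\<forall>\<^sub>F t::real in at 0. t\<^sup>2 \<noteq> 0" "\<forall>\<^sub>F t::real in at 0. 2 * t \<noteq> 0" by (auto simp: eventually_at_filter)
    show "\<forall>\<^sub>F t in at 0. ((\<lambda>t. h t - h 0 - h1 0 * t) has_real_derivative h1 t - h1 0) (at t)"
      using evU by eventually_elim (auto intro!: derivative_eq_intros dh)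
    show "\<forall>\<^sub>F t::real in at 0. ((\<lambda>t. t\<^sup>2) has_real_derivative 2 * t) (at t)"
      by (intro always_eventually allI) (auto intro!: derivative_eq_intros)
    have "((\<lambda>t. (h1 t - h1 0) / (t - 0) / 2) \<longlongrightarrow> \<partial> c (\<partial> c f) p / 2) (at 0)"
      using dh1 unfolding has_field_derivative_iff by (intro tendsto_divide tendsto_const) auto
    then show "((\<lambda>t. (h1 t - h1 0) / (2 * t)) \<longlongrightarrow> \<partial> c (\<partial> c f) p / 2) (at 0)"
      by (simp add: mult.commute)
  qed
  from tendsto_diff[OF this tendsto_const[of "\<partial> c (\<partial> c f) p / 2"]]
  have "((\<lambda>t. (h t - h 0 - h1 0 * t) / t\<^sup>2 - \<partial> c (\<partial> c f) p / 2) \<longlongrightarrow> 0) (at 0)" by simp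
  moreover have "\<forall>\<^sub>F t in at 0. (h t - h 0 - h1 0 * t) / t\<^sup>2 - \<partial> c (\<partial> c f) p / 2
     = (h t - h 0 - h1 0 * t - \<partial> c (\<partial> c f) p / 2 * t\<^sup>2) / t\<^sup>2"
    by (auto simp: eventually_at_filter field_simps)
  ultimately have "((\<lambda>t. (h t - h 0 - h1 0 * t - \<partial> c (\<partial> c f) p / 2 * t\<^sup>2) / t\<^sup>2) \<longlongrightarrow> 0) (at 0)"
    by (simp add: tendsto_cong)
  then show ?thesis unfolding jet2_def h_def h1_def by simp
qed

context normal_point
begin

text \<open>An orthonormal frame along the line through \<open>p\<close> in direction \<open>c\<close> which is parallel up to
  second order.\<close>

lemma parallel_frame:
  obtains E where "\<forall>\<^sub>F t in at 0. p + t *\<^sub>R axis c 1 \<in> U \<and> orthonormal_frame (G (p + t *\<^sub>R axis c 1)) (E t)"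
    "\<And>i s. jet2 (\<lambda>t. E t $ i $ s) (dl i s) 0 (- dGam c s c i / 2)"
proof -
  \<comment> \<open>Parallel transport solves E' = -\<Gamma>(e, E) with e the direction of the line.
    As \<Gamma> vanishes at \<open>p\<close>, the solution has no linear term, and its quadratic
    coefficient is minus half the derivative of \<Gamma>.\<close>
  define N where "N i s = - dGam c s c i / 2" for i s
  define x where "x t = p + t *\<^sub>R axis c 1" for t
  define E1 where "E1 t = (\<chi> i s. dl i s + 0 * t + N i s * t\<^sup>2)" for t
  have E1: "jet2 (\<lambda>t. E1 t $ i $ s) (dl i s) 0 (N i s)" for i s
    using jet2_poly[of "dl i s" 0 "N i s"] by (simp add: E1_def)
  have "(x \<longlongrightarrow> p + 0 *\<^sub>R axis c 1) (at 0)"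
    unfolding x_def by (intro tendsto_intros)
  then have evU: "\<forall>\<^sub>F t in at 0. x t \<in> U"
    using open_U p by (intro topological_tendstoD[of _ _ _ U]) auto
  \<comment> \<open>The Gram matrix of the approximate frame; \<open>N\<close> cancels the quadratic
    term of the metric, leaving the identity up to o(t^2).\<close>
  define q where "q t = E1 t ** G (x t) ** transpose (E1 t)" for t
  have q_nth: "q t $ i $ j = (\<Oplus>a. (\<Oplus>b. G (x t) $ a $ b * E1 t $ j $ b) * E1 t $ i $ a)" for t i j
    unfolding q_def bilin_frame[symmetric] bilin_sum by (simp add: sum_distrib_left mult_ac)
  have q: "jet2 (\<lambda>t. q t $ i $ j) (dl i j) 0 0" for i j
  proof -
    have "jet2 (\<lambda>t. G (x t) $ a $ b) (dl a b) 0 ((dGam c b c a + dGam c a c b) / 2)" for a b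
      using jet2_smooth[OF open_U p smooth_G, of c a b]
      by (simp add: x_def G_p_nth partial_deriv_G_p second_partial_deriv_G_p)
    then have "jet2 (\<lambda>t. \<Oplus>b. G (x t) $ a $ b * E1 t $ j $ b) (dl a j) 0
       ((dGam c j c a + dGam c a c j) / 2 + (\<Oplus>b. dl a b * N j b))" for a
      by (rule jet2_contract[OF _ E1])
    then have "jet2 (\<lambda>t. q t $ i $ j) (dl i j) 0 ((dGam c j c i + dGam c i c j) / 2 + (\<Oplus>b. dl i b * N j b)
         + (\<Oplus>a. dl a j * N i a))"
      unfolding q_nth by (rule jet2_contract[OF _ E1])
    also have "(\<Oplus>b. dl i b * N j b) = N j i" by (rule sum_dl)
    also have "(\<Oplus>a. dl a j * N i a) = N i j" by (rule sum_dl)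
    also have "(dGam c j c i + dGam c i c j) / 2 + N j i + N i j = 0"
      by (simp add: N_def field_simps)
    finally show ?thesis .
  qed
  have "((\<lambda>t. (1 / t\<^sup>2) *\<^sub>R (q t - mat 1)) \<longlongrightarrow> 0) (at 0)"
  proof (intro vec_tendstoI)
    show "((\<lambda>t. ((1 / t\<^sup>2) *\<^sub>R (q t - mat 1)) $ i $ j) \<longlongrightarrow> 0 $ i $ j) (at 0)" for i j
      using q[of i j] by (simp add: jet2_def mat_def)
  qed
  then have nq: "((\<lambda>t. norm (q t - mat 1) / t\<^sup>2) \<longlongrightarrow> 0) (at 0)"
    using tendsto_norm by fastforce
  have "((\<lambda>t. q t) \<longlongrightarrow> mat 1) (at 0)"
    using jet2_limit[OF q] by (intro vec_tendstoI) (simp add: mat_def)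
  moreover have "\<forall>\<^sub>F t in at 0. transpose (q t) = q t"
    using evU by eventually_elim (simp add: q_def matrix_transpose_mul matrix_mul_assoc transpose_G)
  ultimately obtain E2 where E2: "\<forall>\<^sub>F t in at 0. E2 t ** q t ** transpose (E2 t) = mat 1 \<and>
      norm (E2 t - mat 1) \<le> norm (q t - mat 1)"
    by (rule orthonormalize_tendsto)
  \<comment> \<open>The orthonormalizing correction is o(t^2), hence invisible in the expansion of
    the frame.\<close>
  have jE2: "jet2 (\<lambda>t. E2 t $ i $ s) (dl i s) 0 0" for i s
  proof -
    have "\<forall>\<^sub>F t in at 0. norm ((E2 t $ i $ s - dl i s) / t\<^sup>2) \<le> norm (q t - mat 1) / t\<^sup>2"
      using E2
    proof eventually_elim
      case (elim t)
      have "\<bar>E2 t $ i $ s - dl i s\<bar> = \<bar>(E2 t - mat 1) $ i $ s\<bar>" by (simp add: mat_def)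
      also have "\<dots> \<le> norm ((E2 t - mat 1) $ i)" by (rule component_le_norm_cart)
      also have "\<dots> \<le> norm (E2 t - mat 1)" by (rule Finite_Cartesian_Product.norm_nth_le)
      also have "\<dots> \<le> norm (q t - mat 1)" using elim by simp
      finally show ?case by (simp add: divide_right_mono)
    qed
    then have "((\<lambda>t. (E2 t $ i $ s - dl i s) / t\<^sup>2) \<longlongrightarrow> 0) (at 0)"
      using nq by (rule Lim_null_comparison)
    then show ?thesis by (simp add: jet2_def)
  qed
  show thesis
  proof (rule that[of "\<lambda>t. E2 t ** E1 t"])
    show "\<forall>\<^sub>F t in at 0. p + t *\<^sub>R axis c 1 \<in> U \<and> orthonormal_frame (G (p + t *\<^sub>R axis c 1)) (E2 t ** E1 t)"
      using E2 evU
    proof eventually_elim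
      case (elim t)
      have "E2 t ** E1 t ** G (x t) ** transpose (E2 t ** E1 t) = E2 t ** q t ** transpose (E2 t)"
        by (simp add: q_def matrix_transpose_mul matrix_mul_assoc)
      then show ?case using elim by (simp add: orthonormal_frame_iff x_def)
    qed
    show "jet2 (\<lambda>t. (E2 t ** E1 t) $ i $ s) (dl i s) 0 (- dGam c s c i / 2)" for i s
    proof -
      have "jet2 (\<lambda>t. \<Oplus>a. E1 t $ a $ s * E2 t $ i $ a) (dl i s) 0 (N i s + (\<Oplus>a. dl a s * 0))"
        by (rule jet2_contract[OF E1 jE2])
      then show ?thesis by (simp add: matrix_matrix_mult_def N_def mult.commute)
    qed
  qed
qed

text \<open>Along each coordinate line the curvature in the nearly parallel frame has quadratic
  coefficient \<open>D2 c c / 2\<close>, so minimality makes its contraction with \<open>l\<close>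
  nonnegative; the sum over \<open>c\<close> gives the Laplacian.\<close>

theorem maximum_principle:
  assumes min: "\<And>x E. x \<in> U \<Longrightarrow> orthonormal_frame (G x) E \<Longrightarrow> l \<bullet> riemann G p
    \<le> l \<bullet> change_frame E (riemann G x)"
  shows "0 \<le> l \<bullet> (2 * \<rho>) *\<^sub>R riemann G p - l \<bullet> Q_curv (riemann G p)"
proof -
  have inner4: "l \<bullet> R = (\<Oplus>i j k m. l $ i $ j $ k $ m * R $ i $ j $ k $ m)" for R
    by (simp add: inner_vec_def)
  have "0 \<le> (\<Oplus>i j k m. l $ i $ j $ k $ m * D2 c c i j k m)" for c
  proof -
    obtain E where E: "\<forall>\<^sub>F t in at 0. p + t *\<^sub>R axis c 1 \<in> U
      \<and> orthonormal_frame (G (p + t *\<^sub>R axis c 1)) (E t)"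
      and jE: "\<And>i s. jet2 (\<lambda>t. E t $ i $ s) (dl i s) 0 (- dGam c s c i / 2)"
      using parallel_frame[of c] by blast
    define Rt where "Rt t = change_frame (E t) (riemann G (p + t *\<^sub>R axis c 1))" for t
    define d where "d i j k m = \<partial> c (\<lambda>x. riemann G x $ i $ j $ k $ m) p" for i j k m
    have jR: "jet2 (\<lambda>t. Rt t $ i $ j $ k $ m) (riemann G p $ i $ j $ k $ m) (d i j k m)
      (D2 c c i j k m / 2)" for i j k m
    proof -
      define P where "P i j k m = \<partial> c (\<partial> c (\<lambda>x. riemann G x $ i $ j $ k $ m)) p / 2" for i j k m
      define n where "n i s = - dGam c s c i / 2" for i s
      define r where "r t = riemann G (p + t *\<^sub>R axis c 1)" for t
      note jE' = jE[folded n_def]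
      have j0: "jet2 (\<lambda>t. r t $ i $ j $ k $ m) (K i j k m) (d i j k m) (P i j k m)" for i j k m
        using jet2_smooth[OF open_U p smooth_riemann] unfolding d_def P_def r_def riemann_p[symmetric] .
      \<comment> \<open>The four slots are contracted with the frame one at a time, from last to
        first; each adds the correction of that slot in \<open>D2\<close>.\<close>
      define P1 where "P1 i j k m = P i j k m + (\<Oplus>s. K i j k s * n m s)" for i j k m
      have j1: "jet2 (\<lambda>t. \<Oplus>s. r t $ i $ j $ k $ s * E t $ m $ s) (K i j k m) (d i j k m) (P1 i j k m)"
        for i j k m
        unfolding P1_def by (rule jet2_contract[where f="\<lambda>s t. r t $ i $ j $ k $ s", OF j0 jE'])
      define P2 where "P2 i j k m = P1 i j k m + (\<Oplus>s. K i j s m * n k s)" for i j k m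
      have j2: "jet2 (\<lambda>t. \<Oplus>b. (\<Oplus>s. r t $ i $ j $ b $ s * E t $ m $ s) * E t $ k $ b) (K i j k m)
        (d i j k m) (P2 i j k m)" for i j k m
        unfolding P2_def by (rule jet2_contract[where f="\<lambda>b t. \<Oplus>s. r t $ i $ j $ b $ s * E t $ m $ s",
          OF j1 jE'])
      define P3 where "P3 i j k m = P2 i j k m + (\<Oplus>s. K i s k m * n j s)" for i j k m
      have j3: "jet2 (\<lambda>t. \<Oplus>a. (\<Oplus>b. (\<Oplus>s. r t $ i $ a $ b $ s * E t $ m $ s) * E t $ k $ b)
        * E t $ j $ a) (K i j k m) (d i j k m) (P3 i j k m)" for i j k m
        unfolding P3_def by (rule jet2_contract[where f="\<lambda>a t. \<Oplus>b. (\<Oplus>s.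
          r t $ i $ a $ b $ s * E t $ m $ s) * E t $ k $ b", OF j2 jE'])
      have "jet2 (\<lambda>t. \<Oplus>h. (\<Oplus>a. (\<Oplus>b. (\<Oplus>s. r t $ h $ a $ b $ s * E t $ m $ s) * E t $ k $ b)
        * E t $ j $ a) * E t $ i $ h)
         (K i j k m) (d i j k m) (P3 i j k m + (\<Oplus>s. K s j k m * n i s))"
        by (rule jet2_contract[where f="\<lambda>h t. \<Oplus>a. (\<Oplus>b. (\<Oplus>s.
          r t $ h $ a $ b $ s * E t $ m $ s) * E t $ k $ b) * E t $ j $ a", OF j3 jE'])
      then have "jet2 (\<lambda>t. Rt t $ i $ j $ k $ m) (K i j k m) (d i j k m) (P3 i j k m + (\<Oplus>s.
        K s j k m * n i s))"
        by (rule jet2_cong[rotated]) (simp add: Rt_def r_def change_frame_nth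
          tensor4_apply_def sum_distrib_left mult_ac)
      moreover have "P3 i j k m + (\<Oplus>s. K s j k m * n i s) = D2 c c i j k m / 2"
        unfolding D2_def P3_def P2_def P1_def P_def n_def
        by (simp add: sum.distrib sum_negf sum_divide_distrib[symmetric]
          diff_divide_distrib add_divide_distrib mult.commute)
      ultimately show ?thesis unfolding riemann_p by (simp only:)
    qed
    have "jet2 (\<lambda>t. l \<bullet> Rt t + (- (l \<bullet> riemann G p))) (l \<bullet> riemann G p + (- (l \<bullet> riemann G p)))
       ((\<Oplus>i j k m. l $ i $ j $ k $ m * d i j k m + 0 * riemann G p $ i $ j $ k $ m) + 0)
       ((\<Oplus>i j k m. l $ i $ j $ k $ m * (D2 c c i j k m / 2) + 0 * d i j k m
         + 0 * riemann G p $ i $ j $ k $ m) + 0)"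
      unfolding inner4 by (intro jet2_add jet2_sum jet2_mult jet2_const jR)
    then have "0 \<le> (\<Oplus>i j k m. l $ i $ j $ k $ m * (D2 c c i j k m / 2) + 0 * d i j k m
      + 0 * riemann G p $ i $ j $ k $ m) + 0"
    proof (intro jet2_nonneg)
      show "\<forall>\<^sub>F t in at 0. 0 \<le> l \<bullet> Rt t + - (l \<bullet> riemann G p)"
        using E by eventually_elim (use min in \<open>auto simp: Rt_def\<close>)
    qed simp
    then show ?thesis by (simp flip: sum_divide_distrib)
  qed
  then have "0 \<le> (\<Oplus>c i j k m. l $ i $ j $ k $ m * D2 c c i j k m)"
    by (rule sum_nonneg)
  also have "\<dots> = (\<Oplus>i j k m c. l $ i $ j $ k $ m * D2 c c i j k m)"
    by (rule trans[OF sum.swap], rule sum.cong[OF refl], rule sum4_pull[symmetric])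
  also have "\<dots> = l \<bullet> ((2 * \<rho>) *\<^sub>R riemann G p - Q_curv (riemann G p))"
    unfolding inner4 sum_distrib_left[symmetric] laplacian_riemann by simp
  finally show ?thesis by (simp add: inner_diff_right)
qed

end

section \<open>Curvature in orthonormal frames\<close>

lemma orthonormal_frame_inverse:
  assumes "orthonormal_frame G E"
  shows "G ** transpose E ** E = mat 1" "E ** (G ** transpose E) = mat 1" "matrix_inv G = transpose E ** E"
proof -
  show 1: "E ** (G ** transpose E) = mat 1"
    using assms by (simp add: orthonormal_frame_iff matrix_mul_assoc)
  then show 2: "G ** transpose E ** E = mat 1" by (simp add: matrix_left_right_inverse)
  then have "G ** (transpose E ** E) = mat 1" by (simp add: matrix_mul_assoc)
  moreover from this have "(transpose E ** E) ** G = mat 1" by (simp add: matrix_left_right_inverse)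
  moreover from calculation have "invertible G" unfolding invertible_def by blast
  ultimately show "matrix_inv G = transpose E ** E"
    by (metis matrix_inv_works(1) matrix_mul_assoc matrix_mul_lid matrix_mul_rid)
qed

text \<open>The inverse metric is the sum of the squares of the frame vectors, so tracing over the
  frame is contracting with it.\<close>

lemma ricci_change_frame:
  assumes E: "orthonormal_frame (G x) E"
  shows "ricci (change_frame E (riemann G x)) = E ** ricci_metric G x ** transpose E"
proof -
  define R where "R = riemann G x"
  have inv: "matrix_inv (G x) $ b $ d = (\<Oplus>j. E $ j $ b * E $ j $ d)" for b d
    by (simp add: orthonormal_frame_inverse(3)[OF E] matrix_matrix_mult_def transpose_def)
  have "ricci (change_frame E R) $ i $ k = (E ** ricci_metric G x ** transpose E) $ i $ k" for i k
  proof -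
    have "ricci (change_frame E R) $ i $ k
      = (\<Oplus>j a b c d. R $ a $ b $ c $ d * E $ i $ a * E $ j $ b * E $ k $ c * E $ j $ d)"
      by (simp add: ricci_def change_frame_nth tensor4_apply_def)
    also have "\<dots> = (\<Oplus>a b c d j. R $ a $ b $ c $ d * E $ i $ a * E $ j $ b * E $ k $ c * E $ j $ d)"
      by (rule trans[OF sum.swap], rule sum.cong[OF refl], rule sum4_pull[symmetric])
    also have "\<dots> = (\<Oplus>a b c d. E $ i $ a * (matrix_inv (G x) $ b $ d * R $ a $ b $ c $ d) * E $ k $ c)"
      unfolding inv by (simp add: sum_distrib_left sum_distrib_right mult_ac)
    also have "\<dots> = (\<Oplus>a c b d. E $ i $ a * (matrix_inv (G x) $ b $ d * R $ a $ b $ c $ d) * E $ k $ c)"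
      by (rule sum.cong[OF refl sum.swap])
    also have "\<dots> = (\<Oplus>a c. E $ i $ a * ricci_metric G x $ a $ c * E $ k $ c)"
      by (simp add: ricci_metric_def R_def sum_distrib_left sum_distrib_right)
    also have "\<dots> = (E ** ricci_metric G x ** transpose E) $ i $ k"
      unfolding bilin_frame[symmetric] bilin_sum ..
    finally show ?thesis .
  qed
  then show ?thesis by (simp add: vec_eq_iff R_def)
qed

lemma matrix_mult_scaleR: "(c *\<^sub>R A) ** B = c *\<^sub>R (A ** B)" "A ** (c *\<^sub>R B) = c *\<^sub>R (A ** B)"
  for A B :: "real ^ 'n ^ 'n"
  by (simp_all add: vec_eq_iff matrix_matrix_mult_def sum_distrib_left mult_ac)

lemma ricci_change_frame_einstein:
  assumes E: "orthonormal_frame (G x) E" and ein: "ricci_metric G x = \<rho> *\<^sub>R G x"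
  shows "ricci (change_frame E (riemann G x)) = \<rho> *\<^sub>R mat 1"
  using E unfolding ricci_change_frame[where G=G and x=x, OF E] ein
    by (simp add: matrix_mult_scaleR orthonormal_frame_iff)

lemma einstein_of_ricci_frame:
  assumes E: "orthonormal_frame (G x) E" and ric: "ricci (change_frame E (riemann G x)) = \<rho> *\<^sub>R mat 1"
  shows "ricci_metric G x = \<rho> *\<^sub>R G x"
proof -
  have inv: "(G x ** transpose E) ** E = mat 1" by (rule orthonormal_frame_inverse(1)[OF E])
  have inv': "transpose E ** (E ** G x) = mat 1"
  proof -
    have "(E ** G x) ** transpose E = mat 1" using E by (simp add: orthonormal_frame_iff)
    then show ?thesis by (simp add: matrix_left_right_inverse)
  qed
  have "E ** ricci_metric G x ** transpose E = \<rho> *\<^sub>R mat 1"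
    using ric unfolding ricci_change_frame[where G=G and x=x, OF E] .
  then have "(G x ** transpose E) ** (E ** ricci_metric G x ** transpose E) ** (E ** G x)
    = (G x ** transpose E) ** (\<rho> *\<^sub>R mat 1) ** (E ** G x)" by simp
  moreover have "(G x ** transpose E) ** (E ** ricci_metric G x ** transpose E) ** (E ** G x)
    = ((G x ** transpose E) ** E) ** ricci_metric G x ** (transpose E ** (E ** G x))"
    by (simp only: matrix_mul_assoc)
  moreover have "(G x ** transpose E) ** (\<rho> *\<^sub>R mat 1) ** (E ** G x)
    = \<rho> *\<^sub>R (((G x ** transpose E) ** E) ** G x)"
    by (simp add: matrix_mult_scaleR matrix_mul_assoc)
  ultimately show ?thesis unfolding inv inv' by simp
qed

section \<open>Frames and the Einstein condition under a change of coordinates\<close>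

context chart_change
begin

text \<open>Rows are images of coordinate vectors, so right multiplication by this matrix pushes the
  rows of a frame forward along \<open>f\<close>.\<close>

definition Jm :: "real ^ 'n \<Rightarrow> real ^ 'n ^ 'n" where
  "Jm y = (\<chi> i. J i y)"

lemma orthonormal_frame_push:
  assumes y: "y \<in> U'" and E: "orthonormal_frame (G' y) E"
  shows "orthonormal_frame (G (f y)) (E ** Jm y)"
proof -
  have "G' y = Jm y ** G (f y) ** transpose (Jm y)"
    by (simp add: vec_eq_iff bilin_frame[symmetric] pullback_J[OF y] Jm_def)
  then show ?thesis using E by (simp add: orthonormal_frame_iff matrix_transpose_mul matrix_mul_assoc)
qed

lemma change_frame_push:
  assumes y: "y \<in> U'"
  shows "change_frame E (riemann G' y) = change_frame (E ** Jm y) (riemann G (f y))"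
  by (simp add: riemann_transform[OF y] Jm_def change_frame_mult)

text \<open>In an orthonormal frame the Einstein condition concerns frame components only, and these
  are unchanged by pushing the frame forward.\<close>

lemma einstein_pullback:
  assumes y: "y \<in> U'" and ein: "ricci_metric G (f y) = \<rho> *\<^sub>R G (f y)"
  shows "ricci_metric G' y = \<rho> *\<^sub>R G' y"
proof -
  obtain E where E: "orthonormal_frame (G' y) E" using tgt.orthonormal_frame_exists[OF y] .
  show ?thesis
    by (rule einstein_of_ricci_frame[where G=G' and x=y, OF E])
      (simp add: change_frame_push[OF y] ricci_change_frame_einstein[where G=G,
        OF orthonormal_frame_push[OF y E] ein])
qed

end

text \<open>In the coordinates \<open>x\<^sub>0 + L y - \<Gamma>(L y, L y) / 2\<close> the metric is the identity and its Christoffel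
  symbols vanish at \<open>y = 0\<close>.\<close>

lemma (in metric_chart) normal_coordinates:
  assumes x0: "x0 \<in> U" and E0: "orthonormal_frame (G x0) E0"
  obtains U' G' f where "chart_change U G U' G' f" "0 \<in> U'" "f 0 = x0" "G' 0 = mat 1"
    "\<And>k i j. christoffel G' k i j 0 = 0" "chart_change.Jm f 0 = E0"
proof -
  define cc where "cc a i j = chr x0 (E0 $ i) (E0 $ j) $ a / 2" for a i j
  have cc_sym: "cc a i j = cc a j i" for a i j
    unfolding cc_def using chr_sym[OF x0] by simp
  define f where "f y = (\<chi> a. x0 $ a + (\<Oplus>i. y $ i * E0 $ i $ a)
     - (\<Oplus>i j. y $ i * (y $ j * cc a i j)))" for y
  define Jf where "Jf i y = (\<chi> a. \<partial> i (\<lambda>y. f y $ a) y)" for i and y :: "real ^ 'n"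
  \<comment> \<open>Invertibility of the Jacobian makes the pulled back metric positive
    definite.\<close>
  define U' where "U' = {y. f y \<in> U \<and> det (\<chi> i. Jf i y) \<noteq> 0}"
  define G' where "G' y = (\<chi> i j. bilin (G (f y)) (Jf i y) (Jf j y))" for y
  have proj: "smooth_on S (\<lambda>y::real^'n. y $ i)" for S i
    by (rule bounded_linear_smooth_on[OF bounded_linear_vec_nth])
  have fs: "smooth_on UNIV (\<lambda>y. f y $ a)" for a
    unfolding f_def vec_lambda_beta
    by (intro smooth_on_diff smooth_on_add smooth_on_sum smooth_on_mult smooth_on_const proj open_UNIV)
  have dproj: "(\<lambda>y::real^'n. y $ i) differentiable (at y)" for i y
    by (rule bounded_linear_imp_differentiable[OF bounded_linear_vec_nth])
  have pproj: "\<partial> k (\<lambda>y::real^'n. y $ i) y = dl i k" for k i y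
    by (subst partial_deriv_eq[OF bounded_linear_imp_has_derivative[OF bounded_linear_vec_nth]])
      (simp add: axis_def)
  have Jf_nth: "Jf k y $ a = E0 $ k $ a - 2 * (\<Oplus>j. y $ j * cc a k j)" for k y a
  proof -
    have "Jf k y $ a = (\<Oplus>i. dl i k * E0 $ i $ a)
      - (\<Oplus>i j. y $ i * (dl j k * cc a i j) + dl i k * (y $ j * cc a i j))"
      unfolding Jf_def f_def
      by (simp add: partial_deriv_diff partial_deriv_add partial_deriv_sum partial_deriv_mult dproj pproj
         differentiable_mult differentiable_sum differentiable_add differentiable_diff)
    also have "(\<Oplus>i. dl i k * E0 $ i $ a) = E0 $ k $ a" by (rule sum_dl)
    also have "(\<Oplus>i j. y $ i * (dl j k * cc a i j) + dl i k * (y $ j * cc a i j))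
      = (\<Oplus>i. y $ i * (\<Oplus>j. dl j k * cc a i j)) + (\<Oplus>i. dl i k * (\<Oplus>j. y $ j * cc a i j))"
      by (simp only: sum.distrib sum_distrib_left)
    also have "\<dots> = (\<Oplus>i. y $ i * cc a i k) + (\<Oplus>j. y $ j * cc a k j)"
      by (simp only: sum_dl)
    \<comment> \<open>By symmetry both halves of the derivative of the quadratic term agree; the
      resulting factor 2 undoes the 1/2 in \<open>cc\<close>.\<close>
    also have "(\<Oplus>i. y $ i * cc a i k) = (\<Oplus>j. y $ j * cc a k j)"
      by (simp only: cc_sym[of a _ k])
    finally show ?thesis by simp
  qed
  have f0: "f 0 = x0" by (simp add: f_def vec_eq_iff)
  have J0: "Jf k 0 = E0 $ k" for k by (simp add: vec_eq_iff Jf_nth)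
  have fcont: "continuous_on UNIV f"
    using smooth_on_continuous[OF fs] unfolding f_def by (auto intro: continuous_on_vec_lambda)
  have detcont: "continuous_on UNIV (\<lambda>y. det (\<chi> i. Jf i y))"
    unfolding det_def vec_lambda_beta Jf_nth by (intro continuous_intros)
  have "U' = f -` U \<inter> (\<lambda>y. det (\<chi> i. Jf i y)) -` (- {0})" by (auto simp: U'_def)
  then have openU': "open U'"
    using open_vimage[OF open_U fcont] open_vimage[OF _ detcont, of "- {0}"] by auto
  have "det E0 \<noteq> 0"
    using orthonormal_frame_inverse(2)[OF E0] invertible_det_nz[of E0] invertible_right_inverse[of E0]
      by blast
  moreover have "(\<chi> i. Jf i 0) = E0" by (simp add: J0 vec_eq_iff)
  ultimately have zero: "0 \<in> U'" using x0 by (simp add: U'_def f0)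
  have fU: "f ` U' \<subseteq> U" by (auto simp: U'_def)
  have fs': "smooth_on U' (\<lambda>y. f y $ a)" for a by (rule smooth_on_subset[OF fs]) auto
  have Js: "smooth_on U' (\<lambda>y. Jf i y $ a)" for i a
    unfolding Jf_def vec_lambda_beta by (rule smooth_on_partial_deriv[OF fs'])
  have mc: "metric_chart U' G'"
  proof
    show "open U'" by (rule openU')
    show "smooth_on U' (\<lambda>x. G' x $ i $ j)" for i j
      unfolding G'_def bilin_sum vec_lambda_beta
      by (intro smooth_on_sum smooth_on_mult openU' Js smooth_on_compose[OF openU' open_U fs' fU] smooth_G)
    show "G' x $ i $ j = G' x $ j $ i" if "x \<in> U'" for x i j
      using bilin_sym[of "f x"] that by (simp add: G'_def U'_def)
    show "0 < bilin (G' x) v v" if x: "x \<in> U'" and v: "v \<noteq> 0" for x v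
    proof -
      define w where "w = (\<Oplus>k. v $ k *\<^sub>R Jf k x)"
      have "w = transpose (\<chi> i. Jf i x) *v v"
        by (simp add: w_def matrix_vector_mult_def transpose_def vec_eq_iff mult.commute)
      moreover have "invertible (transpose (\<chi> i. Jf i x))"
        using x by (simp add: U'_def invertible_det_nz)
      ultimately have "w \<noteq> 0"
        using v by (metis invertible_left_inverse matrix_left_invertible_ker)
      then have "0 < bilin (G (f x)) w w" using x by (intro pos_G) (auto simp: U'_def)
      also have "bilin (G (f x)) w w = bilin (G' x) v v"
        unfolding w_def bilin_sum_left bilin_sum_right unfolding bilin_sum[of "G' x"]
        by (simp add: G'_def sum_distrib_left mult_ac sum.swap[of "\<lambda>i j.
          v $ i * (v $ j * bilin (G (f x)) (Jf i x) (Jf j x))"])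
      finally show ?thesis .
    qed
  qed
  have ch: "chart_change U G U' G' f"
    unfolding chart_change_def chart_change_axioms_def
    using mc metric_chart_axioms fs' fU by (simp add: G'_def Jf_def)
  interpret ch: chart_change U G U' G' f by (rule ch)
  have JJ: "ch.J i y = Jf i y" for i y by (simp add: ch.J_def Jf_def)
  have G0: "G' 0 = mat 1"
    using E0 by (simp add: G'_def f0 J0 orthonormal_frame_def vec_eq_iff mat_def)
  have Gam0: "christoffel G' m i j 0 = 0" for m i j
  proof -
    have "ch.dJ i j 0 $ a = - 2 * cc a j i" for a
    proof -
      have "ch.dJ i j 0 $ a = \<partial> i (\<lambda>y. E0 $ j $ a - 2 * (\<Oplus>k. y $ k * cc a j k)) 0"
        by (simp add: ch.dJ_def JJ Jf_nth)
      also have "\<dots> = - 2 * (\<Oplus>k. dl k i * cc a j k)"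
        by (simp add: partial_deriv_diff partial_deriv_sum partial_deriv_mult dproj pproj
         differentiable_mult differentiable_sum)
      finally show ?thesis by (simp only: sum_dl)
    qed
    \<comment> \<open>This cancels the \<Gamma> term in \<open>dJ_eq\<close>, so the combination of
      the independent rows of \<open>E0\<close> with the new Christoffel symbols as coefficients is
      zero.\<close>
    then have "ch.dJ i j 0 = - chr x0 (E0 $ i) (E0 $ j)"
      using cc_sym by (simp add: vec_eq_iff cc_def)
    then have "(\<Oplus>k. christoffel G' k i j 0 *\<^sub>R E0 $ k) = 0"
      using ch.dJ_eq[OF zero, of i j] by (simp add: JJ J0 f0)
    then have "0 = bilin (G x0) (\<Oplus>k. christoffel G' k i j 0 *\<^sub>R E0 $ k) (E0 $ m)"
      by (simp add: bilin_sum)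
    also have "\<dots> = (\<Oplus>k. christoffel G' k i j 0 * dl k m)"
      unfolding bilin_sum_left using E0 by (simp add: orthonormal_frame_def)
    finally show ?thesis by (simp only: sum_dl)
  qed
  have "ch.Jm 0 = E0" by (simp add: ch.Jm_def JJ J0 vec_eq_iff)
  then show thesis using that ch zero f0 G0 Gam0 by blast
qed

text \<open>Normal coordinates with differential \<open>E0\<close> turn the given frame into the
  standard basis; orthonormal frames of the pullback push forward to orthonormal frames of
  \<open>G\<close> with the same curvature components.\<close>

theorem (in metric_chart) maximum_principle_frame:
  assumes ein: "\<And>x. x \<in> U \<Longrightarrow> ricci_metric G x = \<rho> *\<^sub>R G x" and alg: "\<And>x. x \<in> U \<Longrightarrow> riemann G x \<in> alg_curv"
    and x0: "x0 \<in> U" and E0: "orthonormal_frame (G x0) E0"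
    and min: "\<And>x E. x \<in> U \<Longrightarrow> orthonormal_frame (G x) E \<Longrightarrow>
      l \<bullet> change_frame E0 (riemann G x0) \<le> l \<bullet> change_frame E (riemann G x)"
  shows "l \<bullet> Q_curv (change_frame E0 (riemann G x0)) \<le> 2 * \<rho> * (l \<bullet> change_frame E0 (riemann G x0))"
proof -
  obtain U' G' f where ch: "chart_change U G U' G' f" and n: "0 \<in> U'" "f 0 = x0" "G' 0 = mat 1"
    "\<And>k i j. christoffel G' k i j 0 = 0" "chart_change.Jm f 0 = E0"
    using normal_coordinates[OF x0 E0] by blast
  interpret ch: chart_change U G U' G' f by (rule ch)
  have alg': "riemann G' y \<in> alg_curv" if "y \<in> U'" for y
    unfolding ch.riemann_transform[OF that] by (rule change_frame_alg_curv[OF alg[OF ch.f_in[OF that]]])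
  interpret N: normal_point U' G' 0 \<rho>
    using n ein alg' ch.f_in ch.einstein_pullback
    by unfold_locales auto
  have R0: "riemann G' 0 = change_frame E0 (riemann G x0)"
    using ch.change_frame_push[OF n(1), of "mat 1"] by (simp add: change_frame_mat_1 n)
  have "0 \<le> l \<bullet> (2 * \<rho>) *\<^sub>R riemann G' 0 - l \<bullet> Q_curv (riemann G' 0)"
  proof (rule N.maximum_principle)
    fix x E assume "x \<in> U'" "orthonormal_frame (G' x) E"
    then show "l \<bullet> riemann G' 0 \<le> l \<bullet> change_frame E (riemann G' x)"
      unfolding R0 using min ch.f_in ch.orthonormal_frame_push by (simp add: ch.change_frame_push)
  qed
  then show ?thesis by (simp add: R0)
qed

text \<open>Orthonormalizing \<open>E0\<close> at nearby points gives frames converging to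
  \<open>E0\<close>, in which the curvature stays close; all other frames differ by orthogonal
  matrices, under which \<open>C\<close> and \<open>id_curv\<close> are invariant.\<close>

lemma (in metric_chart) frames_persist:
  assumes alg: "\<And>x. x \<in> U \<Longrightarrow> riemann G x \<in> alg_curv" and x0: "x0 \<in> U" and E0: "orthonormal_frame (G x0) E0"
    and C: "O_invariant C" and int: "change_frame E0 (riemann G x0) - \<kappa> *\<^sub>R id_curv \<in> interior_alg_curv C"
  obtains e N where "e > 0" "open N" "x0 \<in> N" "N \<subseteq> U"
    "\<And>x E. x \<in> N \<Longrightarrow> orthonormal_frame (G x) E \<Longrightarrow> change_frame E (riemann G x) - (\<kappa> + e) *\<^sub>R id_curv \<in> C"
proof -
  define R0 where "R0 = change_frame E0 (riemann G x0)"
  obtain W where W: "open W" "R0 - \<kappa> *\<^sub>R id_curv \<in> W" "alg_curv \<inter> W \<subseteq> C"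
    using int unfolding interior_alg_curv_def interior_of_def openin_open R0_def by auto
  then obtain d where d: "d > 0" "ball (R0 - \<kappa> *\<^sub>R id_curv) d \<subseteq> W" using open_contains_ball by blast
  define m where "m = norm (id_curv :: 'n tensor4) + 1"
  have m: "m > 0" by (simp add: m_def add_nonneg_pos)
  \<comment> \<open>Half of the radius \<open>d\<close> is reserved for \<open>e\<close> times
    \<open>id_curv\<close>, the other half for the variation of the curvature.\<close>
  define e where "e = d / (2 * m)"
  have e: "e > 0" using d m by (simp add: e_def)
  have e_id: "e * norm (id_curv :: 'n tensor4) \<le> d / 2"
  proof -
    have "e * norm (id_curv :: 'n tensor4) \<le> e * m"
      using e by (intro mult_left_mono) (auto simp: m_def)
    also have "\<dots> = d / 2"
      using m by (simp add: e_def)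
    finally show ?thesis .
  qed
  define M where "M x = E0 ** G x ** transpose E0" for x
  have "continuous_on U (\<lambda>x. \<chi> i j. G x $ i $ j)" "continuous_on U (\<lambda>x. \<chi> i j k l.
    riemann G x $ i $ j $ k $ l)"
    by (intro continuous_on_vec_lambda smooth_on_continuous smooth_G smooth_riemann)+
  then have limG: "(G \<longlongrightarrow> G x0) (nhds x0)" and limR: "(riemann G \<longlongrightarrow> riemann G x0) (nhds x0)"
    using open_U x0 by (auto simp: continuous_on_eq_continuous_at tendsto_nhds_iff isCont_def)
  have lim_mult: "((\<lambda>x. A x ** B x) \<longlongrightarrow> A0 ** B0) F" if "(A \<longlongrightarrow> A0) F" "(B \<longlongrightarrow> B0) F"
    for A B :: "real ^ 'n \<Rightarrow> real ^ 'n ^ 'n" and A0 B0 F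
    unfolding matrix_matrix_mult_def using that
    by (intro tendsto_vec_lambda tendsto_sum tendsto_mult tendsto_vec_nth)
  have "(M \<longlongrightarrow> E0 ** G x0 ** transpose E0) (nhds x0)"
    unfolding M_def by (intro lim_mult limG tendsto_const)
  then have limM: "(M \<longlongrightarrow> mat 1) (nhds x0)" using E0 by (simp add: orthonormal_frame_iff)
  have evU: "\<forall>\<^sub>F x in nhds x0. x \<in> U" using open_U x0 by (rule eventually_nhds_in_open)
  have "\<forall>\<^sub>F x in nhds x0. transpose (M x) = M x"
    using evU by eventually_elim (simp add: M_def matrix_transpose_mul matrix_mul_assoc transpose_G)
  then obtain B where B: "\<forall>\<^sub>F x in nhds x0. B x ** M x ** transpose (B x) = mat 1 \<and>
      norm (B x - mat 1) \<le> norm (M x - mat 1)"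
    by (rule orthonormalize_tendsto[OF limM])
  have "((\<lambda>x. B x - mat 1) \<longlongrightarrow> 0) (nhds x0)"
  proof (rule Lim_null_comparison)
    show "\<forall>\<^sub>F x in nhds x0. norm (B x - mat 1) \<le> norm (M x - mat 1)"
      using B by eventually_elim simp
    show "((\<lambda>x. norm (M x - mat 1)) \<longlongrightarrow> 0) (nhds x0)"
      using limM by (simp add: tendsto_norm_zero LIM_zero)
  qed
  then have limB: "(B \<longlongrightarrow> mat 1) (nhds x0)" by (simp add: LIM_zero_iff)
  have "((\<lambda>x. change_frame (B x ** E0) (riemann G x)) \<longlongrightarrow> change_frame (mat 1 ** E0) (riemann G x0))
    (nhds x0)"
    by (intro tendsto_change_frame lim_mult limB limR tendsto_const)
  then have "((\<lambda>x. change_frame (B x ** E0) (riemann G x)) \<longlongrightarrow> R0) (nhds x0)" by (simp add: R0_def)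
  then have "\<forall>\<^sub>F x in nhds x0. dist (change_frame (B x ** E0) (riemann G x)) R0 < d / 2"
    using d by (intro tendstoD) auto
  then have "\<forall>\<^sub>F x in nhds x0. x \<in> U \<and> B x ** M x ** transpose (B x) = mat 1
    \<and> dist (change_frame (B x ** E0) (riemann G x)) R0 < d / 2"
    using evU B by eventually_elim simp
  then obtain N where N: "open N" "x0 \<in> N" "\<And>x. x \<in> N \<Longrightarrow> x \<in> U \<and> B x ** M x ** transpose (B x) = mat 1
    \<and> dist (change_frame (B x ** E0) (riemann G x)) R0 < d / 2"
    unfolding eventually_nhds by blast
  show thesis
  proof (rule that[OF e N(1,2)])
    show "N \<subseteq> U" using N(3) by blast
    fix x E assume x: "x \<in> N" and E: "orthonormal_frame (G x) E"
    define R where "R = change_frame (B x ** E0) (riemann G x)"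
    have "B x ** E0 ** G x ** transpose (B x ** E0) = B x ** M x ** transpose (B x)"
      by (simp add: M_def matrix_transpose_mul matrix_mul_assoc)
    then have BE: "orthonormal_frame (G x) (B x ** E0)" using N(3)[OF x]
      by (simp add: orthonormal_frame_iff)
    obtain A where A: "orthogonal_matrix A" "E = A ** (B x ** E0)"
      using orthonormal_frames_related[OF BE E] transpose_G N(3)[OF x] by metis
    have "R - (\<kappa> + e) *\<^sub>R id_curv \<in> alg_curv"
      unfolding R_def using alg N(3)[OF x]
      by (intro subspace_diff subspace_scale subspace_alg_curv
        change_frame_alg_curv id_curv_in_alg_curv) auto
    moreover have "dist (R0 - \<kappa> *\<^sub>R id_curv) (R - (\<kappa> + e) *\<^sub>R id_curv) < d"
    proof -
      have "(R0 - \<kappa> *\<^sub>R id_curv) - (R - (\<kappa> + e) *\<^sub>R id_curv) = (R0 - R) + e *\<^sub>R id_curv"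
        by (simp add: algebra_simps)
      then have "dist (R0 - \<kappa> *\<^sub>R id_curv) (R - (\<kappa> + e) *\<^sub>R id_curv)
        \<le> norm (R0 - R) + norm (e *\<^sub>R (id_curv :: 'n tensor4))"
        unfolding dist_norm by (metis norm_triangle_ineq)
      also have "norm (R0 - R) < d / 2"
        using N(3)[OF x] by (simp add: R_def dist_norm norm_minus_commute)
      finally show ?thesis using e_id e by simp
    qed
    ultimately have "R - (\<kappa> + e) *\<^sub>R id_curv \<in> C" using W(3) d(2) by auto
    then have "change_frame A (R - (\<kappa> + e) *\<^sub>R id_curv) \<in> C" using C A(1) unfolding O_invariant_def by blast
    then show "change_frame E (riemann G x) - (\<kappa> + e) *\<^sub>R id_curv \<in> C"
      unfolding A(2) by (simp add: change_frame_mult R_def linear_diff[OF linear_change_frame]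
        linear_cmul[OF linear_change_frame] change_frame_id_curv[OF A(1)])
  qed
qed

section \<open>Riemannian manifolds\<close>

lemma riemannian_metric_chart:
  assumes M: "riemannian_manifold X A g" and c: "c \<in> A" and U: "open U" "U \<subseteq> chart_image c"
  shows "metric_chart U (g c)"
proof
  have "smooth_on (chart_image c) (g c)"
    and g: "\<And>x. x \<in> chart_image c \<Longrightarrow> transpose (g c x) = g c x \<and> (\<forall>v. v \<noteq> 0 \<longrightarrow> 0 < bilin (g c x) v v)"
    using M c unfolding riemannian_manifold_def riemannian_metric_def by auto
  then have "smooth_on U (g c)" using U(2) smooth_on_subset by blast
  then show "smooth_on U (\<lambda>x. g c x $ i $ j)" for i j
    by (intro smooth_on_vec_nth[OF U(1)])
  show "open U" by (rule U)
  show "g c x $ i $ j = g c x $ j $ i" if "x \<in> U" for x i j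
  proof -
    have "transpose (g c x) $ j $ i = g c x $ j $ i" using g that U(2) by auto
    then show ?thesis by (simp add: transpose_def)
  qed
  show "0 < bilin (g c x) v v" if "x \<in> U" "v \<noteq> 0" for x v
    using g that U(2) by blast
qed

lemma chart_properties:
  assumes M: "riemannian_manifold X A g" and c: "c \<in> A"
  shows "open (chart_image c)" "openin X (chart_dom c)" "inj_on (coord c) (chart_dom c)" "chart_dom c
    \<subseteq> topspace X"
    "\<And>V. openin X V \<Longrightarrow> V \<subseteq> chart_dom c \<Longrightarrow> open (coord c ` V)"
    "\<And>N. open N \<Longrightarrow> openin X {q \<in> chart_dom c. coord c q \<in> N}"
proof -
  have ch: "openin X (chart_dom c)" "open (chart_image c)"
    "homeomorphic_map (subtopology X (chart_dom c)) (top_of_set (chart_image c)) (coord c)"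
    using M c unfolding riemannian_manifold_def smooth_manifold_def chart_on_def by auto
  show "open (chart_image c)" "openin X (chart_dom c)" by fact+
  show sub: "chart_dom c \<subseteq> topspace X" using ch(1) by (rule openin_subset)
  then have top: "topspace (subtopology X (chart_dom c)) = chart_dom c" by auto
  show "inj_on (coord c) (chart_dom c)"
    using homeomorphic_imp_injective_map[OF ch(3)] top by simp
  show "open (coord c ` V)" if "openin X V" "V \<subseteq> chart_dom c" for V
  proof -
    have "openin (subtopology X (chart_dom c)) V" using that ch(1) by (simp add: openin_open_subtopology)
    then have "openin (top_of_set (chart_image c)) (coord c ` V)"
      using homeomorphic_imp_open_map[OF ch(3)] unfolding open_map_def by blast
    then show ?thesis using ch(2) openin_open_trans by blast
  qed
  show "openin X {q \<in> chart_dom c. coord c q \<in> N}" if "open N" for N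
  proof -
    have "continuous_map (subtopology X (chart_dom c)) (top_of_set (chart_image c)) (coord c)"
      using homeomorphic_imp_continuous_map[OF ch(3)] .
    then have "continuous_map (subtopology X (chart_dom c)) euclidean (coord c)"
      by (simp add: continuous_map_in_subtopology)
    then have "openin (subtopology X (chart_dom c)) {q
      \<in> topspace (subtopology X (chart_dom c)). coord c q \<in> N}"
      by (rule openin_continuous_map_preimage) (use that in auto)
    then have "openin (subtopology X (chart_dom c)) {q \<in> chart_dom c. coord c q \<in> N}" by (simp only: top)
    then show ?thesis using ch(1) by (rule openin_trans_full)
  qed
qed

text \<open>Transition maps pull the metric of \<open>d\<close> back to that of \<open>c\<close>, so
  the curvature results for pullbacks apply on overlaps.\<close>

lemma transition_chart_change:
  assumes M: "riemannian_manifold X A g" and c: "c \<in> A" and d: "d \<in> A"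
  shows "chart_change (chart_image d) (g d) (coord c ` (chart_dom c \<inter> chart_dom d)) (g c) (transition c d)"
proof -
  note pc = chart_properties[OF M c] and pd = chart_properties[OF M d]
  define U' where "U' = coord c ` (chart_dom c \<inter> chart_dom d)"
  have oU': "open U'" unfolding U'_def by (intro pc(5) openin_Int pc(2) pd(2)) auto
  have tr: "transition c d (coord c p) = coord d p" if "p \<in> chart_dom c" for p
    using that pc(3) by (simp add: transition_def inv_into_f_f)
  have sm: "smooth_on U' (transition c d)"
    using M c d unfolding riemannian_manifold_def smooth_manifold_def U'_def by auto
  have sub: "U' \<subseteq> chart_image c" by (auto simp: U'_def chart_image_def)
  have "chart_change (chart_image d) (g d) U' (g c) (transition c d)"
    unfolding chart_change_def chart_change_axioms_def
  proof (intro conjI allI impI)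
    show "metric_chart (chart_image d) (g d)" by (rule riemannian_metric_chart[OF M d pd(1)]) simp
    show "metric_chart U' (g c)" by (rule riemannian_metric_chart[OF M c oU' sub])
    show "smooth_on U' (\<lambda>y. transition c d y $ a)" for a by (rule smooth_on_vec_nth[OF oU' sm])
    show "transition c d ` U' \<subseteq> chart_image d" using tr by (auto simp: U'_def chart_image_def)
    fix y i j assume y: "y \<in> U'"
    then obtain p where p: "p \<in> chart_dom c" "p \<in> chart_dom d" "y = coord c p" by (auto simp: U'_def)
    have dt: "transition c d differentiable (at y)" by (rule smooth_on_differentiable[OF oU' sm y])
    have col: "frechet_derivative (transition c d) (at y) (axis i 1) = (\<chi> a. \<partial> i (\<lambda>y.
      transition c d y $ a) y)" for i
      unfolding partial_deriv_def[symmetric] by (simp add: vec_eq_iff partial_deriv_vec_nth[OF dt])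
    have "g c y $ i $ j = bilin (g c y) (axis i 1) (axis j 1)"
      by (simp add: bilin_def matrix_vector_mult_basis column_def inner_axis')
    also have "\<dots> = bilin (g d (coord d p)) (frechet_derivative (transition c d) (at y) (axis i 1))
      (frechet_derivative (transition c d) (at y) (axis j 1))"
    proof -
      have "\<forall>c\<in>A. \<forall>d\<in>A. \<forall>p\<in>chart_dom c \<inter> chart_dom d. \<forall>v w.
        bilin (g c (coord c p)) v w = bilin (g d (coord d p))
          (frechet_derivative (transition c d) (at (coord c p)) v) (frechet_derivative
            (transition c d) (at (coord c p)) w)"
        using M unfolding riemannian_manifold_def riemannian_metric_def by blast
      then show ?thesis using c d p by blast
    qed
    finally show "g c y $ i $ j = bilin (g d (transition c d y)) (\<chi> a. \<partial> i (\<lambda>y. transition c d y $ a) y)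
       (\<chi> a. \<partial> j (\<lambda>y. transition c d y $ a) y)"
      using tr[OF p(1)] unfolding p(3)[symmetric] col by (simp only:)
  qed
  then show ?thesis by (simp add: U'_def)
qed

text \<open>The push-forward of \<open>E\<close> to the chart \<open>d\<close> is again orthonormal,
  hence covered by the hypothesis, and it has the same curvature components.\<close>

lemma curvature_in_all_charts:
  assumes M: "riemannian_manifold X A g" and c: "c \<in> A" and d: "d \<in> A" and p: "p \<in> chart_dom c" "p
    \<in> chart_dom d"
    and K: "\<And>E. orthonormal_frame (g d (coord d p)) E \<Longrightarrow> change_frame E (riemann (g d) (coord d p)) \<in> K"
    and E: "orthonormal_frame (g c (coord c p)) E"
  shows "change_frame E (riemann (g c) (coord c p)) \<in> K"
proof -
  interpret ch: chart_change "chart_image d" "g d" "coord c ` (chart_dom c \<inter> chart_dom d)" "g c"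
    "transition c d"
    by (rule transition_chart_change[OF M c d])
  have y: "coord c p \<in> coord c ` (chart_dom c \<inter> chart_dom d)" using p by auto
  have "transition c d (coord c p) = coord d p"
    using p chart_properties(3)[OF M c] by (simp add: transition_def inv_into_f_f)
  then show ?thesis
    unfolding ch.change_frame_push[OF y] using ch.orthonormal_frame_push[OF y E] by (metis K)
qed

section \<open>Sectional curvature from the curvature in a frame\<close>

lemma change_frame_inverse:
  assumes "orthonormal_frame G E"
  shows "change_frame (G ** transpose E) (change_frame E R) = R"
  using orthonormal_frame_inverse(1)[OF assms] by (simp flip: change_frame_mult add: change_frame_mat_1)

text \<open>In coefficients with respect to the frame, numerator and denominator are \<kappa> times
  the same Gram determinant and that determinant itself.\<close>

lemma sectional_curvature_of_frame:
  fixes v w :: "real ^ 'n::finite"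
  assumes dim: "CARD('n) \<ge> 2" and E: "orthonormal_frame (G x) E"
    and R: "change_frame E (riemann G x) = \<kappa> *\<^sub>R id_curv" and vw: "v \<noteq> w" "independent {v, w}"
  shows "sectional_curvature G x v w = \<kappa>"
proof -
  obtain i j :: 'n where ij: "i \<noteq> j"
    using dim by (metis card_2_iff' card_le_Suc0_iff_eq finite not_less_eq_eq numeral_2_eq_2 UNIV_I)
  \<comment> \<open>Only two rows matter; filling a whole matrix lets the composition rule for
    \<open>change_frame\<close> apply.\<close>
  define W where "W = (\<chi> k. if k = i then v else w)"
  define B where "B = W ** (G x ** transpose E)"
  have BE: "B ** E = W"
    using orthonormal_frame_inverse(1)[OF E] by (simp add: B_def flip: matrix_mul_assoc)
  have W: "W $ i = v" "W $ j = w" using ij by (simp_all add: W_def)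
  define a where "a = B $ i"
  define b where "b = B $ j"
  have vE: "v = (\<Oplus>k. a $ k *\<^sub>R E $ k)" and wE: "w = (\<Oplus>k. b $ k *\<^sub>R E $ k)"
  proof -
    have "(B ** E) $ m = (\<Oplus>k. B $ m $ k *\<^sub>R E $ k)" for m
      by (simp add: vec_eq_iff matrix_matrix_mult_def)
    then show "v = (\<Oplus>k. a $ k *\<^sub>R E $ k)" "w = (\<Oplus>k. b $ k *\<^sub>R E $ k)"
      using BE W unfolding a_def b_def by metis+
  qed
  have "tensor4_apply (riemann G x) v w v w = change_frame W (riemann G x) $ i $ j $ i $ j"
    by (simp add: change_frame_nth W)
  also have "\<dots> = tensor4_apply (\<kappa> *\<^sub>R id_curv) a b a b"
    by (simp add: BE[symmetric] change_frame_mult R change_frame_nth a_def b_def)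
  also have "\<dots> = \<kappa> * ((a \<bullet> a) * (b \<bullet> b) - (a \<bullet> b)\<^sup>2)"
    by (simp add: linear_cmul[OF linear_tensor4_apply(5)]
      tensor4_apply_id_curv inner_commute power2_eq_square)
  finally have num: "tensor4_apply (riemann G x) v w v w = \<kappa> * ((a \<bullet> a) * (b \<bullet> b) - (a \<bullet> b)\<^sup>2)" .
  have gram: "bilin (G x) (W $ m) (W $ n) = B $ m \<bullet> B $ n" for m n
  proof -
    have "W ** G x ** transpose W = B ** (E ** G x ** transpose E) ** transpose B"
      by (simp add: BE[symmetric] matrix_transpose_mul matrix_mul_assoc)
    then have "W ** G x ** transpose W = B ** transpose B"
      using E by (simp add: orthonormal_frame_iff)
    then show ?thesis unfolding bilin_frame by (simp add:
      matrix_matrix_mult_def transpose_def inner_vec_def)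
  qed
  have den: "bilin (G x) v v * bilin (G x) w w - (bilin (G x) v w)\<^sup>2 = (a \<bullet> a) * (b \<bullet> b) - (a \<bullet> b)\<^sup>2"
    using gram[of i i] gram[of j j] gram[of i j] by (simp add: W a_def b_def)
  \<comment> \<open>A vanishing Gram determinant is equality in Cauchy-Schwarz, which would make
    \<open>v\<close> and \<open>w\<close> dependent.\<close>
  have "(a \<bullet> a) * (b \<bullet> b) - (a \<bullet> b)\<^sup>2 \<noteq> 0"
  proof
    assume "(a \<bullet> a) * (b \<bullet> b) - (a \<bullet> b)\<^sup>2 = 0"
    then have "(a \<bullet> b)\<^sup>2 = (norm a * norm b)\<^sup>2"
      by (simp add: power_mult_distrib dot_square_norm)
    then have "\<bar>a \<bullet> b\<bar> = norm a * norm b" by (metis abs_norm_cancel abs_mult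
      power2_eq_iff_nonneg abs_ge_zero power2_abs)
    then have "norm a *\<^sub>R b = norm b *\<^sub>R a \<or> norm a *\<^sub>R b = - norm b *\<^sub>R a"
      unfolding norm_cauchy_schwarz_abs_eq by auto
    then obtain r where r: "norm a *\<^sub>R b = r *\<^sub>R a" by blast
    have "norm a *\<^sub>R w = (\<Oplus>k. (norm a *\<^sub>R b) $ k *\<^sub>R E $ k)"
      by (simp add: wE scaleR_sum_right)
    also have "\<dots> = r *\<^sub>R v" unfolding r by (simp add: vE scaleR_sum_right)
    finally have rw: "norm a *\<^sub>R w = r *\<^sub>R v" .
    have "v \<noteq> 0" using vw(2) dependent_zero by blast
    then have "a \<noteq> 0" using vE by auto
    then have "w = (r / norm a) *\<^sub>R v"
      using rw by (metis divide_inverse_commute norm_eq_zero scaleR_scaleR scaleR_one left_inverse)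
    then have "w \<in> span {v}" by (simp add: span_scale span_base)
    moreover have "w \<notin> span {v}"
      using vw independent_insert[of w "{v}"] by (auto simp: insert_commute)
    ultimately show False by blast
  qed
  then show ?thesis unfolding sectional_curvature_def num den by simp
qed

definition curvature_ge ::
    "('m, 'n::finite) chart set \<Rightarrow> ('m, 'n) metric_field \<Rightarrow> 'n tensor4 set \<Rightarrow> real \<Rightarrow> bool" where
  "curvature_ge A g C \<kappa> \<longleftrightarrow> (\<forall>c\<in>A. \<forall>x\<in>chart_image c. \<forall>E. orthonormal_frame (g c x) E \<longrightarrow>
     change_frame E (riemann (g c) x) - \<kappa> *\<^sub>R id_curv \<in> C)"

text \<open>Every point has a neighbourhood with its own gain; a finite subcover yields a positive
  minimum, to which the gains are lowered by adding multiples of \<open>id_curv\<close>. Applied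
  with 0 it shows \<kappa> > 0, and at the supremum it forces contact with the boundary.\<close>

lemma curvature_ge_improve:
  assumes M: "riemannian_manifold X A g" and X: "compact_space X" and C: "O_invariant C"
    and add: "\<And>R s. R \<in> C \<Longrightarrow> 0 \<le> s \<Longrightarrow> R + s *\<^sub>R id_curv \<in> C"
    and alg: "\<And>c x. c \<in> A \<Longrightarrow> x \<in> chart_image c \<Longrightarrow> riemann (g c) x \<in> alg_curv"
    and int: "\<And>c x. c \<in> A \<Longrightarrow> x \<in> chart_image c \<Longrightarrow>
      \<exists>E. orthonormal_frame (g c x) E \<and> change_frame E (riemann (g c) x) - \<kappa> *\<^sub>R id_curv
        \<in> interior_alg_curv C"
  shows "\<exists>e>0. curvature_ge A g C (\<kappa> + e)"
proof -
  define P where "P V e \<longleftrightarrow> e > 0 \<and> (\<forall>q\<in>V. \<forall>d\<in>A. q \<in> chart_dom d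
    \<longrightarrow> (\<forall>E. orthonormal_frame (g d (coord d q)) E \<longrightarrow>
      change_frame E (riemann (g d) (coord d q)) - (\<kappa> + e) *\<^sub>R id_curv \<in> C))" for V and e :: real
  have "\<exists>V. openin X V \<and> p \<in> V \<and> (\<exists>e. P V e)" if p: "p \<in> topspace X" for p
  proof -
    have "\<Union> (chart_dom ` A) = topspace X"
      using M unfolding riemannian_manifold_def smooth_manifold_def by (elim conjE)
    then obtain c where c: "c \<in> A" "p \<in> chart_dom c" using p by blast
    note pc = chart_properties[OF M c(1)]
    interpret metric_chart "chart_image c" "g c" by (rule riemannian_metric_chart[OF M c(1) pc(1)]) simp
    have x: "coord c p \<in> chart_image c" using c by (simp add: chart_image_def)
    obtain E where E: "orthonormal_frame (g c (coord c p)) E"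
      "change_frame E (riemann (g c) (coord c p)) - \<kappa> *\<^sub>R id_curv \<in> interior_alg_curv C"
      using int[OF c(1) x] by blast
    obtain e N where N: "e > 0" "open N" "coord c p \<in> N" "N \<subseteq> chart_image c"
      and NC: "\<And>x E. x \<in> N \<Longrightarrow> orthonormal_frame (g c x) E
        \<Longrightarrow> change_frame E (riemann (g c) x) - (\<kappa> + e) *\<^sub>R id_curv \<in> C"
      using frames_persist[OF alg[OF c(1)] x E(1) C E(2)] by blast
    define V where "V = {q \<in> chart_dom c. coord c q \<in> N}"
    have "P V e"
      unfolding P_def
    proof (intro conjI ballI impI allI)
      show "e > 0" by (rule N)
      fix q d E assume q: "q \<in> V" and d: "d \<in> A" "q
        \<in> chart_dom d" and E: "orthonormal_frame (g d (coord d q)) E"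
      have "change_frame E (riemann (g d) (coord d q)) \<in> {R. R - (\<kappa> + e) *\<^sub>R id_curv \<in> C}"
        by (rule curvature_in_all_charts[OF M d(1) c(1) d(2) _ _ E]) (use q NC in \<open>auto simp: V_def\<close>)
      then show "change_frame E (riemann (g d) (coord d q)) - (\<kappa> + e) *\<^sub>R id_curv \<in> C" by simp
    qed
    moreover have "openin X V" unfolding V_def by (rule pc(6)[OF N(2)])
    moreover have "p \<in> V" using c N by (simp add: V_def)
    ultimately show ?thesis by blast
  qed
  then have "topspace X \<subseteq> \<Union> {V. openin X V \<and> (\<exists>e. P V e)}" by blast
  then obtain F where F: "finite F" "F \<subseteq> {V. openin X V \<and> (\<exists>e. P V e)}" "topspace X \<subseteq> \<Union> F"
    using X unfolding compact_space_alt by (metis (no_types, lifting) mem_Collect_eq)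
  then have "\<forall>V\<in>F. \<exists>e. P V e" by blast
  then obtain e where e: "\<And>V. V \<in> F \<Longrightarrow> P V (e V)" by metis
  \<comment> \<open>Inserting 1 keeps the minimum defined and positive when the cover is
    empty.\<close>
  define m where "m = Min (insert 1 (e ` F))"
  have m: "m > 0" "\<And>V. V \<in> F \<Longrightarrow> m \<le> e V"
    using F(1) e by (auto simp: m_def P_def)
  have "curvature_ge A g C (\<kappa> + m)"
    unfolding curvature_ge_def
  proof (intro ballI allI impI)
    fix c x E assume c: "c \<in> A" and x: "x \<in> chart_image c" and E: "orthonormal_frame (g c x) E"
    obtain q where q: "q \<in> chart_dom c" "x = coord c q" using x by (auto simp: chart_image_def)
    then have "q \<in> topspace X" using chart_properties(4)[OF M c] by blast
    then obtain V where V: "V \<in> F" "q \<in> V" using F(3) by blast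
    have "change_frame E (riemann (g c) x) - (\<kappa> + e V) *\<^sub>R id_curv \<in> C"
      using e[OF V(1)] V(2) c q E unfolding P_def by blast
    from add[OF this, of "e V - m"] show "change_frame E (riemann (g c) x) - (\<kappa> + m) *\<^sub>R id_curv \<in> C"
      using m(2)[OF V(1)] by (simp add: algebra_simps)
  qed
  then show ?thesis using m(1) by blast
qed

lemma ricci_id_curv: "ricci (id_curv :: ('n::finite) tensor4) = (real CARD('n) - 1) *\<^sub>R mat 1"
proof -
  have "(\<Oplus>j. id_curv $ i $ j $ k $ j) = (\<Sum>j::'n\<in>UNIV. dl i k) - (\<Oplus>j. dl i j * dl j k)" for i k :: 'n
    by (simp add: id_curv_nth sum_subtractf)
  then have "(\<Oplus>j. id_curv $ i $ j $ k $ j) = (real CARD('n) - 1) * dl i k" for i k :: 'n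
    by (simp only: sum_dl) (simp add: algebra_simps)
  then show ?thesis by (simp add: ricci_def vec_eq_iff mat_def)
qed

lemma linear_ricci: "linear ricci"
  by (rule linearI) (simp_all add: ricci_def vec_eq_iff sum.distrib sum_distrib_left)

theorem theorem3:
  fixes C :: "('n::finite) tensor4 set"
    and X :: "'m topology"
    and A :: "('m, 'n) chart set"
    and g :: "('m, 'n) metric_field"
    and \<rho> :: real
  assumes dim: "CARD('n) \<ge> 4"
    and C_sub: "C \<subseteq> alg_curv"
    and C_cone: "\<forall>R\<in>C. \<forall>c>0. c *\<^sub>R R \<in> C"
    and C_closed: "closed C"
    and C_convex: "convex C"
    and C_O: "O_invariant C"
    and C_ode: "Q_ode_invariant C"
    and C_ricci: "\<forall>R\<in>C - {0}. scal R \<ge> 0 \<and> ricci R \<noteq> 0"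
    and C_id: "id_curv \<in> interior_alg_curv C"
    and M: "riemannian_manifold X A g"
    and M_compact: "compact_space X"
    and M_einstein: "einstein_metric A g \<rho>"
    and M_curv: "\<forall>p\<in>topspace X. curvature_in_at A g (interior_alg_curv C) p"
  shows "constant_sectional_curvature A g"
proof -
  let ?n = "real CARD('n)"
  have n: "?n \<ge> 4" using dim by simp
  have int_sub: "interior_alg_curv C \<subseteq> C"
    unfolding interior_alg_curv_def by (rule interior_of_subset)
  have id_C: "id_curv \<in> C" using C_id int_sub by blast
  have add: "R + S \<in> C" if "R \<in> C" "S \<in> C" for R S
  proof -
    have "(1/2) *\<^sub>R R + (1/2) *\<^sub>R S \<in> C" using C_convex that by (rule convexD) auto
    then have "2 *\<^sub>R ((1/2) *\<^sub>R R + (1/2) *\<^sub>R S) \<in> C" using C_cone by (metis zero_less_numeral)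
    then show ?thesis by (simp add: scaleR_add_right)
  qed
  have add_id: "R + s *\<^sub>R id_curv \<in> C" if "R \<in> C" "0 \<le> s" for R s
    using add[OF that(1), of "s *\<^sub>R id_curv"] C_cone id_C that by (cases "s = 0") auto
  have chart: "metric_chart (chart_image c) (g c)" if "c \<in> A" for c
    by (rule riemannian_metric_chart[OF M that chart_properties(1)[OF M that]]) simp
  have int: "change_frame E (riemann (g c) x) \<in> interior_alg_curv C"
    if cx: "c \<in> A" "x \<in> chart_image c" "orthonormal_frame (g c x) E" for c x E
  proof -
    obtain p where p: "p \<in> chart_dom c" "x = coord c p" using cx(2) by (auto simp: chart_image_def)
    then have "curvature_in_at A g (interior_alg_curv C) p"
      using M_curv chart_properties(4)[OF M cx(1)] by blast
    then show ?thesis using cx(1,3) p unfolding curvature_in_at_def by blast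
  qed
  \<comment> \<open>The symmetries of the curvature need no computation: its components in a frame
    lie in \<open>C\<close>, hence in \<open>alg_curv\<close>, and undoing the frame preserves
    this.\<close>
  have alg: "riemann (g c) x \<in> alg_curv" if cx: "c \<in> A" "x \<in> chart_image c" for c x
  proof -
    obtain E where E: "orthonormal_frame (g c x) E"
      by (rule metric_chart.orthonormal_frame_exists[OF chart[OF cx(1)] cx(2)])
    have "change_frame (g c x ** transpose E) (change_frame E (riemann (g c) x)) \<in> alg_curv"
      by (rule change_frame_alg_curv) (use int[OF cx E] int_sub C_sub in blast)
    then show ?thesis by (simp add: change_frame_inverse[OF E])
  qed
  have ein: "ricci_metric (g c) x = \<rho> *\<^sub>R g c x" if "c \<in> A" "x \<in> chart_image c" for c x
    using M_einstein that unfolding einstein_metric_def by blast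
  have ric: "ricci (change_frame E (riemann (g c) x) - \<kappa> *\<^sub>R id_curv) = (\<rho> - \<kappa> * (?n - 1)) *\<^sub>R mat 1"
    if "c \<in> A" "x \<in> chart_image c" "orthonormal_frame (g c x) E" for c x E \<kappa>
    using ricci_change_frame_einstein[where G="g c", OF that(3) ein[OF that(1,2)]]
    by (simp add: linear_diff[OF linear_ricci] linear_cmul[OF linear_ricci] ricci_id_curv algebra_simps)
  show ?thesis
  \<comment> \<open>The upper bound for \<kappa> requires a point; without one the conclusion is
    vacuous.\<close>
  proof (cases "\<exists>c\<in>A. chart_image c \<noteq> {}")
    case False
    then show ?thesis by (auto simp: constant_sectional_curvature_def)
  next
    case True
    then obtain c0 x0 where c0: "c0 \<in> A" "x0 \<in> chart_image c0" by blast
    obtain E0 where E0: "orthonormal_frame (g c0 x0) E0"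
      by (rule metric_chart.orthonormal_frame_exists[OF chart[OF c0(1)] c0(2)])
    have bound: "\<kappa> * (?n - 1) \<le> \<rho>" if "curvature_ge A g C \<kappa>" for \<kappa>
    proof -
      let ?S = "change_frame E0 (riemann (g c0) x0) - \<kappa> *\<^sub>R id_curv"
      have "?S \<in> C" using that c0 E0 unfolding curvature_ge_def by blast
      moreover have "scal (0 :: 'n tensor4) = 0" by (simp add: scal_def ricci_def trace_def)
      ultimately have "scal ?S \<ge> 0" using C_ricci by (cases "?S = 0") auto
      then have "(\<rho> - \<kappa> * (?n - 1)) * ?n \<ge> 0"
        by (simp add: scal_def ric[OF c0 E0] trace_def mat_def mult.commute)
      then show ?thesis using n by (simp add: zero_le_mult_iff)
    qed
    have "\<exists>e>0. curvature_ge A g C (0 + e)"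
    proof (rule curvature_ge_improve[OF M M_compact C_O add_id alg])
      fix c x assume cx: "c \<in> A" "x \<in> chart_image c"
      obtain E where E: "orthonormal_frame (g c x) E"
        by (rule metric_chart.orthonormal_frame_exists[OF chart[OF cx(1)] cx(2)])
      then show "\<exists>E. orthonormal_frame (g c x) E \<and> change_frame E (riemann (g c) x) - 0 *\<^sub>R id_curv
        \<in> interior_alg_curv C"
        using int[OF cx E] by auto
    qed
    then obtain e0 where e0: "e0 > 0" "curvature_ge A g C e0" by auto
    define \<kappa> where "\<kappa> = Sup {\<kappa>. curvature_ge A g C \<kappa>}"
    have bdd: "bdd_above {\<kappa>. curvature_ge A g C \<kappa>}"
      using bound n by (intro bdd_aboveI[of _ "\<rho> / (?n - 1)"]) (simp add: pos_le_divide_eq)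
    have \<kappa>_pos: "\<kappa> > 0"
      using cSup_upper[OF _ bdd, of e0] e0 by (simp add: \<kappa>_def)
    \<comment> \<open>The supremum is attained because \<open>C\<close> is closed.\<close>
    have ge: "curvature_ge A g C \<kappa>"
      unfolding curvature_ge_def
    proof (intro ballI allI impI)
      fix c x E assume cx: "c \<in> A" "x \<in> chart_image c" "orthonormal_frame (g c x) E"
      define T where "T = {s. change_frame E (riemann (g c) x) - s *\<^sub>R id_curv \<in> C}"
      have "closed T"
      proof -
        have "closed ((\<lambda>s. change_frame E (riemann (g c) x) - s *\<^sub>R id_curv) -` C)"
          by (intro closed_vimage C_closed continuous_intros)
        then show ?thesis by (simp add: T_def vimage_def)
      qed
      moreover have "\<kappa> \<in> closure {\<kappa>. curvature_ge A g C \<kappa>}"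
        unfolding \<kappa>_def using e0 bdd by (intro closure_contains_Sup) auto
      moreover have "{\<kappa>. curvature_ge A g C \<kappa>} \<subseteq> T" using cx by (auto simp: curvature_ge_def T_def)
      ultimately have "\<kappa> \<in> T" using closure_minimal by blast
      then show "change_frame E (riemann (g c) x) - \<kappa> *\<^sub>R id_curv \<in> C" by (simp add: T_def)
    qed
    have "\<not> (\<forall>c\<in>A. \<forall>x\<in>chart_image c. \<exists>E. orthonormal_frame (g c x) E \<and>
        change_frame E (riemann (g c) x) - \<kappa> *\<^sub>R id_curv \<in> interior_alg_curv C)"
    proof
      assume "\<forall>c\<in>A. \<forall>x\<in>chart_image c. \<exists>E. orthonormal_frame (g c x) E \<and>
        change_frame E (riemann (g c) x) - \<kappa> *\<^sub>R id_curv \<in> interior_alg_curv C"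
      then obtain e where "e > 0" "curvature_ge A g C (\<kappa> + e)"
        using curvature_ge_improve[OF M M_compact C_O add_id alg, of \<kappa>] by blast
      then show False using cSup_upper[OF _ bdd, of "\<kappa> + e"] by (simp add: \<kappa>_def)
    qed
    then obtain c x where cx: "c \<in> A" "x \<in> chart_image c"
      and touch: "\<And>E. orthonormal_frame (g c x) E \<Longrightarrow> change_frame E (riemann (g c) x)
        - \<kappa> *\<^sub>R id_curv \<notin> interior_alg_curv C"
      by blast
    interpret metric_chart "chart_image c" "g c" by (rule chart[OF cx(1)])
    obtain E where E: "orthonormal_frame (g c x) E" using orthonormal_frame_exists[OF cx(2)] .
    define R where "R = change_frame E (riemann (g c) x)"
    define S where "S = R - \<kappa> *\<^sub>R id_curv"
    define \<mu> where "\<mu> = \<rho> - \<kappa> * (?n - 1)"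
    have S_C: "S \<in> C" using ge cx E unfolding curvature_ge_def S_def R_def by blast
    have S_int: "S \<notin> interior_alg_curv C" using touch[OF E] by (simp add: S_def R_def)
    have S_alg: "S \<in> alg_curv" using S_C C_sub by blast
    \<comment> \<open>\<open>C\<close> contains a nonempty relatively open subset of
      \<open>alg_curv\<close>, so its affine hull is that subspace. This makes the supporting
      hyperplane theorem for relative boundary points applicable, with strict inequality at
      \<open>id_curv\<close>.\<close>
    have rel_int: "rel_interior C = interior_alg_curv C"
    proof -
      have aff: "affine hull alg_curv = (alg_curv :: 'n tensor4 set)"
        using subspace_imp_affine[OF subspace_alg_curv] by simp
      have "openin (top_of_set alg_curv) (interior_alg_curv C)"
        unfolding interior_alg_curv_def by (rule openin_interior_of)
      then have "affine hull interior_alg_curv C = (alg_curv :: 'n tensor4 set)"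
        using affine_hull_openin[of alg_curv "interior_alg_curv C"] C_id aff by auto
      then have "affine hull C = alg_curv"
        using hull_mono[OF int_sub, of affine] hull_mono[OF C_sub, of affine] aff by auto
      then show ?thesis
        unfolding interior_alg_curv_def interior_of_def rel_interior_def by auto
    qed
    obtain a where a: "\<And>T. T \<in> C \<Longrightarrow> a \<bullet> S \<le> a \<bullet> T" "\<And>T. T \<in> rel_interior C \<Longrightarrow> a \<bullet> S < a \<bullet> T"
      using supporting_hyperplane_rel_boundary[OF C_convex S_C, unfolded rel_int, OF S_int] rel_int by metis
    have aS: "a \<bullet> S = 0"
    proof -
      \<comment> \<open>Minimality of \<open>a\<close> at \<open>S\<close> against both multiples
        bounds \<open>a \<bullet> S\<close> from both sides by zero.\<close>
      have "2 *\<^sub>R S \<in> C" "(1/2) *\<^sub>R S \<in> C" using C_cone S_C by auto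
      from a(1)[OF this(1)] a(1)[OF this(2)] show ?thesis by simp
    qed
    have a_id: "a \<bullet> id_curv > 0" using a(2)[of id_curv] C_id by (simp add: rel_int aS)
    have aQ: "a \<bullet> Q_curv S \<ge> 0" by (rule supporting_functional_Q_curv[OF C_ode C_sub S_C a(1)])
    have S_ric: "(\<Oplus>j. S $ i $ j $ k $ j) = \<mu> * dl i k" for i k
    proof -
      have "ricci S $ i $ k = (\<mu> *\<^sub>R mat 1) $ i $ k"
        using ric[OF cx E, of \<kappa>] by (simp add: S_def R_def \<mu>_def)
      then show ?thesis by (simp add: ricci_def mat_def)
    qed
    \<comment> \<open>Since \<open>R\<close> and \<open>S\<close> differ by the frame-independent
      \<kappa> \<open>id_curv\<close>, minimality of \<open>a\<close> at \<open>S\<close> carries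
      over to \<open>R\<close>.\<close>
    have "a \<bullet> Q_curv R \<le> 2 * \<rho> * (a \<bullet> R)"
      unfolding R_def
    proof (rule maximum_principle_frame[OF ein[OF cx(1)] alg[OF cx(1)] cx(2) E])
      fix y F assume yF: "y \<in> chart_image c" "orthonormal_frame (g c y) F"
      have "change_frame F (riemann (g c) y) - \<kappa> *\<^sub>R id_curv \<in> C"
        using ge cx(1) yF unfolding curvature_ge_def by blast
      from a(1)[OF this] show "a \<bullet> change_frame E (riemann (g c) x) \<le> a \<bullet> change_frame F (riemann (g c) y)"
        by (simp add: S_def R_def inner_diff_right)
    qed
    moreover have "R = S + \<kappa> *\<^sub>R id_curv" by (simp add: S_def)
    ultimately have "a \<bullet> Q_curv S + (4 * \<kappa> * \<mu> + 2 * (?n - 1) * \<kappa>\<^sup>2) * (a \<bullet> id_curv)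
      \<le> 2 * \<rho> * (\<kappa> * (a \<bullet> id_curv))"
      using Q_curv_add_id_curv[OF S_alg S_ric, of \<kappa>] aS by (simp add: inner_add_right)
    moreover have "\<rho> = \<mu> + \<kappa> * (?n - 1)" by (simp add: \<mu>_def)
    ultimately have "a \<bullet> Q_curv S + 2 * (\<kappa> * (a \<bullet> id_curv)) * \<mu> \<le> 0"
      by (simp add: algebra_simps power2_eq_square)
    then have "2 * (\<kappa> * (a \<bullet> id_curv)) * \<mu> \<le> 0" using aQ by linarith
    then have "\<mu> \<le> 0" using \<kappa>_pos a_id by (simp add: mult_le_0_iff zero_less_mult_iff not_le)
    then have \<mu>0: "\<rho> - \<kappa> * (?n - 1) = 0" using bound[OF ge] by (simp add: \<mu>_def)
    \<comment> \<open>\<open>S\<close> lies in \<open>C\<close> and is Ricci-flat at every point, so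
      the nonvanishing of the Ricci tensor on nonzero elements of \<open>C\<close> forces it to be
      zero.\<close>
    have const: "change_frame F (riemann (g d) y) = \<kappa> *\<^sub>R id_curv"
      if "d \<in> A" "y \<in> chart_image d" "orthonormal_frame (g d y) F" for d y F
    proof -
      have "change_frame F (riemann (g d) y) - \<kappa> *\<^sub>R id_curv \<in> C"
        using ge that unfolding curvature_ge_def by blast
      moreover have "ricci (change_frame F (riemann (g d) y) - \<kappa> *\<^sub>R id_curv) = 0"
        using ric[OF that, of \<kappa>] \<mu>0 by simp
      ultimately show ?thesis using C_ricci by (metis Diff_iff eq_iff_diff_eq_0 singletonD)
    qed
    show ?thesis
      unfolding constant_sectional_curvature_def
    proof (intro exI[of _ \<kappa>] ballI allI impI)
      fix d y and v w :: "real ^ 'n" assume d: "d \<in> A" "y \<in> chart_image d" and vw: "v \<noteq> w"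
        "independent {v, w}"
      obtain F where F: "orthonormal_frame (g d y) F"
        by (rule metric_chart.orthonormal_frame_exists[OF chart[OF d(1)] d(2)])
      show "sectional_curvature (g d) y v w = \<kappa>"
        using dim by (intro sectional_curvature_of_frame[where E=F] F const d vw) auto
    qed
  qed
qed

end
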